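(* Let $(W,S)$ be a Coxeter system of finite rank, $c$ a Coxeter element and $A\subseteq W$. If $A$ is nonempty then $\bigwedge\pi_\downarrow^c(A)=\pi_\downarrow^c(\bigwedge A)$, and if $A$ has an upper bound then $\bigvee\pi_\downarrow^c(A)=\pi_\downarrow^c(\bigvee A)$, where $\pi_\downarrow^c(A)=\{\pi_\downarrow^c(a):a\in A\}$ and meets and joins are taken in the right weak order.
   Context: $S$ finite; $T$ = reflections; $\mathrm{inv}(w)=\{t\in T:\ell(tw)<\ell(w)\}$; weak order $v\le w$ iff $\mathrm{inv}(v)\subseteq\mathrm{inv}(w)$; it is a complete meet-semilattice (meets of nonempty sets exist, joins exist for sets with an upper bound). $W_J=\langle J\rangle$, $w_J\in W_J$ with $\mathrm{inv}(w_J)=\mathrm{inv}(w)\cap W_J$, $\langle s\rangle=S\setminus\{s\}$. Coxeter element $c=s_1\cdots s_n$ (all of $S$ in some order); $s$ initial in $c$ if a reduced word of $c$ begins with $s$; then $scs$ is a Coxeter element and $sc$ is a Coxeter element of $W_{\langle s\rangle}$. $\pi_\downarrow^c$: $\pi_\downarrow^c(e)=e$, and for $s$ initial in $c$, $\pi_\downarrow^c(w)=s\,\pi_\downarrow^{scs}(sw)$ if $w\ge s$ and $\pi_\downarrow^c(w)=\pi_\downarrow^{sc}(w_{\langle s\rangle})$ (the analogous map on $W_{\langle s\rangle}$) otherwise; independent of choices. *)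

theory Defs
  imports "HOL-Algebra.Generated_Groups" "HOL-Algebra.Complete_Lattice"
begin

section \<open>Coxeter systems\<close>

text \<open>The entry \<open>m s t = 0\<close> encodes \<open>m(s,t) = \<infinity>\<close> (no relation).\<close>

definition coxeter_matrix :: "'a set \<Rightarrow> ('a \<Rightarrow> 'a \<Rightarrow> nat) \<Rightarrow> bool" where
  "coxeter_matrix S m \<longleftrightarrow>
     (\<forall>s\<in>S. m s s = 1) \<and> (\<forall>s\<in>S. \<forall>t\<in>S. s \<noteq> t \<longrightarrow> m s t = m t s \<and> m s t \<noteq> 1)"

definition word_prod :: "('a, 'b) monoid_scheme \<Rightarrow> 'a list \<Rightarrow> 'a" where
  "word_prod G ws = foldr (\<otimes>\<^bsub>G\<^esub>) ws \<one>\<^bsub>G\<^esub>"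

text \<open>Deletion of one relator \<open>(st)\<^sup>m\<close>, \<open>m = m(s,t)\<close>. For \<open>s = t\<close> the relator is the word \<open>ss\<close>;
  for \<open>m s t = 0\<close> it is the empty word, so nothing is imposed.\<close>

inductive coxeter_step :: "'a set \<Rightarrow> ('a \<Rightarrow> 'a \<Rightarrow> nat) \<Rightarrow> 'a list \<Rightarrow> 'a list \<Rightarrow> bool"
  for S m where
  "\<lbrakk>us \<in> lists S; vs \<in> lists S; s \<in> S; t \<in> S\<rbrakk> \<Longrightarrow>
     coxeter_step S m (us @ concat (replicate (m s t) [s, t]) @ vs) (us @ vs)"

text \<open>The group presented by the generators \<open>S\<close> and the relations \<open>(st)\<^sup>m = 1\<close>, \<open>m = m(s,t)\<close>:
  since \<open>ss = 1\<close> is among the relations, no formal inverses are needed, and the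
  presented group is the set of words in \<open>S\<close> modulo the congruence generated by the relators.\<close>

locale coxeter_system = group G for G (structure) +
  fixes S :: "'a set"
  assumes gens_closed: "S \<subseteq> carrier G"
    and gens_generate: "generate G S = carrier G"
    and presentation:
      "\<exists>m. coxeter_matrix S m \<and>
         (\<forall>us\<in>lists S. \<forall>vs\<in>lists S.
            word_prod G us = word_prod G vs \<longleftrightarrow> equivclp (coxeter_step S m) us vs)"

section \<open>Length, inversions and weak order\<close>

text \<open>The notions below refer to the Coxeter system \<open>(\<langle>S\<rangle>, S)\<close> with \<open>\<langle>S\<rangle> = generate G S\<close> inside the
  group \<open>G\<close>. For \<open>J\<close> in place of \<open>S\<close> they are the notions of the standard parabolic
  subgroup \<open>W\<^sub>J\<close>; for a Coxeter system \<open>(G, S)\<close> itself \<open>generate G S = carrier G\<close>.\<close>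

definition cox_length :: "('a, 'b) monoid_scheme \<Rightarrow> 'a set \<Rightarrow> 'a \<Rightarrow> nat" where
  "cox_length G S w = (LEAST k. \<exists>ws\<in>lists S. length ws = k \<and> word_prod G ws = w)"

definition reduced_word :: "('a, 'b) monoid_scheme \<Rightarrow> 'a set \<Rightarrow> 'a list \<Rightarrow> 'a \<Rightarrow> bool" where
  "reduced_word G S ws w \<longleftrightarrow>
     ws \<in> lists S \<and> word_prod G ws = w \<and> length ws = cox_length G S w"

definition reflections :: "('a, 'b) monoid_scheme \<Rightarrow> 'a set \<Rightarrow> 'a set" where
  "reflections G S = {w \<otimes>\<^bsub>G\<^esub> s \<otimes>\<^bsub>G\<^esub> inv\<^bsub>G\<^esub> w | w s. w \<in> generate G S \<and> s \<in> S}"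

definition inversions :: "('a, 'b) monoid_scheme \<Rightarrow> 'a set \<Rightarrow> 'a \<Rightarrow> 'a set" where
  "inversions G S w =
     {t \<in> reflections G S. cox_length G S (t \<otimes>\<^bsub>G\<^esub> w) < cox_length G S w}"

definition weak_order :: "('a, 'b) monoid_scheme \<Rightarrow> 'a set \<Rightarrow> 'a gorder" where
  "weak_order G S =
     \<lparr>carrier = generate G S, eq = (=), le = (\<lambda>v w. inversions G S v \<subseteq> inversions G S w)\<rparr>"

definition parabolic_part :: "('a, 'b) monoid_scheme \<Rightarrow> 'a set \<Rightarrow> 'a set \<Rightarrow> 'a \<Rightarrow> 'a" where
  "parabolic_part G S J w =
     (THE v. v \<in> generate G J \<and> inversions G S v = inversions G S w \<inter> generate G J)"

section \<open>Coxeter elements and the downward projection\<close>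

definition coxeter_element :: "('a, 'b) monoid_scheme \<Rightarrow> 'a set \<Rightarrow> 'a \<Rightarrow> bool" where
  "coxeter_element G S c \<longleftrightarrow> (\<exists>cs. distinct cs \<and> set cs = S \<and> c = word_prod G cs)"

definition initial :: "('a, 'b) monoid_scheme \<Rightarrow> 'a set \<Rightarrow> 'a \<Rightarrow> 'a \<Rightarrow> bool" where
  "initial G S c s \<longleftrightarrow> (\<exists>ws. reduced_word G S (s # ws) c)"

text \<open>\<open>cox_proj G S c w x\<close>: the recursion, for some choice of initial letters, yields the value \<open>x\<close>
  at \<open>w\<close>. Independence of the choices makes this relation the graph of a function on \<open>generate G S\<close>
  whenever \<open>c\<close> is a Coxeter element.\<close>

inductive cox_proj :: "('a, 'b) monoid_scheme \<Rightarrow> 'a set \<Rightarrow> 'a \<Rightarrow> 'a \<Rightarrow> 'a \<Rightarrow> bool" for G where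
  one: "cox_proj G S c \<one>\<^bsub>G\<^esub> \<one>\<^bsub>G\<^esub>"
| above: "\<lbrakk>initial G S c s; s \<sqsubseteq>\<^bsub>weak_order G S\<^esub> w;
     cox_proj G S (s \<otimes>\<^bsub>G\<^esub> c \<otimes>\<^bsub>G\<^esub> s) (s \<otimes>\<^bsub>G\<^esub> w) x\<rbrakk>
   \<Longrightarrow> cox_proj G S c w (s \<otimes>\<^bsub>G\<^esub> x)"
| not_above: "\<lbrakk>initial G S c s; \<not> s \<sqsubseteq>\<^bsub>weak_order G S\<^esub> w;
     cox_proj G (S - {s}) (s \<otimes>\<^bsub>G\<^esub> c) (parabolic_part G S (S - {s}) w) x\<rbrakk>
   \<Longrightarrow> cox_proj G S c w x"

definition pi_down :: "('a, 'b) monoid_scheme \<Rightarrow> 'a set \<Rightarrow> 'a \<Rightarrow> 'a \<Rightarrow> 'a" where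
  "pi_down G S c w = (THE x. cox_proj G S c w x)"

end

theory Submission
  imports Defs Complex_Main
begin

text \<open>An element \<open>w\<close> is encoded by the finite set \<open>N w\<close> of positive roots made negative by \<open>w\<inverse>\<close> in the
  geometric representation. Weak order becomes inclusion, and the recursion for the projection becomes a
  recursion \<open>P cs\<close> on these sets, driven by a word \<open>cs\<close> for the Coxeter element. \<open>P cs\<close> is monotone: by
  induction on the number of inversions one follows polygons, the intervals \<open>R \<union> cone p q\<close> spanned by two
  covers of \<open>R\<close>, through the recursion, and the sign of the Euler form of \<open>cs\<close> on \<open>(p, q)\<close> decides which of
  the two chains is kept. The images of \<open>P cs\<close> are the sets aligned with the skew part of the Euler form, and
  \<open>P cs R\<close> is the largest of them inside \<open>R\<close>; hence the recursion does not depend on the choice of initial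
  letters. Meets and joins are then carried through the recursion, where alignment yields the one critical
  comparison: an aligned set joined with a simple root.\<close>

text \<open>Call an edge from \<open>R\<close> to \<open>insert p R\<close> kept if its ends have
  different images under \<open>P cs\<close>, and contracted otherwise. The obstacle is an inclusion
  \<open>R \<subseteq> R'\<close> with \<open>simple_root s\<close> in \<open>R'\<close> only: the
  recursion takes different branches and the two values come from different words.
  \<open>mono_step\<close> reduces this to one cover, from \<open>H\<close> to
  \<open>insert (simple_root s) H\<close>. Since \<open>refl s\<close> permutes such an
  \<open>H\<close>, both branches start from the same set, one with \<open>cs\<close> and the other
  with \<open>cs @ [s]\<close>, and \<open>cover_proj\<close> compares them. The Euler form fits
  because it is unchanged when the word is rotated and both arguments are reflected, and when the
  first letter is dropped and both arguments vanish there. A sign thus survives every step until a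
  letter meets one of the two roots; at a first or last letter one side of the form is a coordinate,
  which is nonnegative on positive roots. The group may be infinite, so no longest element exchanges
  joins and meets. Extremal sets are instead found below a finite bound, where two covers of a set
  always span a polygon.\<close>

definition simple_root :: "'a \<Rightarrow> 'a \<Rightarrow> real" where
  "simple_root s = (\<lambda>r. if r = s then 1 else 0)"

definition lin :: "real \<Rightarrow> ('a \<Rightarrow> real) \<Rightarrow> real \<Rightarrow> ('a \<Rightarrow> real) \<Rightarrow> 'a \<Rightarrow> real" where
  "lin a p b q = (\<lambda>r. a * p r + b * q r)"

definition supp_in :: "'a set \<Rightarrow> ('a \<Rightarrow> real) \<Rightarrow> bool" where
  "supp_in J v \<longleftrightarrow> (\<forall>r. v r \<noteq> 0 \<longrightarrow> r \<in> J)"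

text \<open>Nonvanishing is required so that a vector and its negative are never both positive; for
  roots, not being positive then means being negative.\<close>

definition vpos :: "('a \<Rightarrow> real) \<Rightarrow> bool" where
  "vpos v \<longleftrightarrow> (\<exists>r. v r \<noteq> 0) \<and> (\<forall>r. 0 \<le> v r)"

definition par :: "'a set \<Rightarrow> ('a \<Rightarrow> real) set \<Rightarrow> ('a \<Rightarrow> real) set" where
  "par J R = {\<beta> \<in> R. supp_in J \<beta>}"

lemma simple_root_apply [simp]: "simple_root s s = 1" "r \<noteq> s \<Longrightarrow> simple_root s r = 0"
  by (auto simp: simple_root_def)

lemma simple_root_nonneg [simp]: "0 \<le> simple_root s r"
  by (simp add: simple_root_def)

lemma simple_root_eq_iff [simp]: "simple_root s = simple_root t \<longleftrightarrow> s = t"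
  by (metis simple_root_apply zero_neq_one)

lemma vpos_simple [simp]: "vpos (simple_root s)"
  by (auto simp: vpos_def simple_root_def)

lemma vpos_nonneg: "vpos v \<Longrightarrow> 0 \<le> v r"
  by (simp add: vpos_def)

lemma lin_comm: "lin a p b q = lin b q a p"
  by (auto simp: lin_def)

lemma lin_0: "lin a p 0 q = (\<lambda>r. a * p r)" "lin 0 p b q = (\<lambda>r. b * q r)"
  by (auto simp: lin_def)

lemma supp_in_simple [simp]: "supp_in J (simple_root s) \<longleftrightarrow> s \<in> J"
  by (auto simp: supp_in_def simple_root_def)

lemma supp_in_mono: "supp_in J v \<Longrightarrow> J \<subseteq> K \<Longrightarrow> supp_in K v"
  by (auto simp: supp_in_def)

lemma supp_in_insert: "t \<notin> J \<Longrightarrow> supp_in (insert t J) v \<Longrightarrow> supp_in J v \<longleftrightarrow> v t = 0"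
  by (auto simp: supp_in_def)

lemma supp_in_lin: "supp_in J p \<Longrightarrow> supp_in J q \<Longrightarrow> supp_in J (lin a p b q)"
  unfolding supp_in_def lin_def by (metis add_0 mult_zero_right)

lemma par_subset: "par J R \<subseteq> R" by (auto simp: par_def)

lemma par_mono: "R \<subseteq> R' \<Longrightarrow> par J R \<subseteq> par J R'" by (auto simp: par_def)

section \<open>Cartan data and the Euler form\<close>

text \<open>\<open>A s t\<close> is the symmetric form on two simple roots, normalised to square
  length 2, so roots and coroots coincide. The cosine values enter only with the group.\<close>

locale cartan_datum =
  fixes S :: "'a set" and A :: "'a \<Rightarrow> 'a \<Rightarrow> real"
  assumes finite_S: "finite S"
    and A_diag: "s \<in> S \<Longrightarrow> A s s = 2"
    and A_sym: "s \<in> S \<Longrightarrow> t \<in> S \<Longrightarrow> A s t = A t s"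
    and A_nonpos: "s \<in> S \<Longrightarrow> t \<in> S \<Longrightarrow> s \<noteq> t \<Longrightarrow> A s t \<le> 0"
begin

definition coroot :: "'a \<Rightarrow> ('a \<Rightarrow> real) \<Rightarrow> real" where
  "coroot s v = (\<Sum>r\<in>S. A s r * v r)"

definition refl :: "'a \<Rightarrow> ('a \<Rightarrow> real) \<Rightarrow> 'a \<Rightarrow> real" where
  "refl s v = v(s := v s - coroot s v)"

lemma coroot_lin: "coroot s (lin a p b q) = a * coroot s p + b * coroot s q"
  by (simp add: coroot_def lin_def sum.distrib sum_distrib_left algebra_simps)

lemma coroot_simple: "t \<in> S \<Longrightarrow> coroot s (simple_root t) = A s t"
proof -
  assume t: "t \<in> S"
  have "coroot s (simple_root t) = (\<Sum>r\<in>S. if r = t then A s r else 0)"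
    unfolding coroot_def simple_root_def by (rule sum.cong) auto
  then show ?thesis using t finite_S by simp
qed

lemma refl_eq_lin: "refl s v = lin 1 v (- coroot s v) (simple_root s)"
  by (auto simp: refl_def lin_def simple_root_def)

lemma refl_other [simp]: "r \<noteq> s \<Longrightarrow> refl s v r = v r"
  by (simp add: refl_def)

lemma refl_same: "refl s v s = v s - coroot s v"
  by (simp add: refl_def)

lemma refl_lin: "refl s (lin a p b q) = lin a (refl s p) b (refl s q)"
  by (rule ext) (simp add: refl_def coroot_lin, simp add: lin_def algebra_simps)

lemma coroot_refl: "s \<in> S \<Longrightarrow> coroot s (refl s v) = - coroot s v"
  by (simp add: refl_eq_lin coroot_lin coroot_simple A_diag)

lemma refl_refl [simp]: "s \<in> S \<Longrightarrow> refl s (refl s v) = v"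
  by (rule ext) (simp add: refl_def[of s "refl s v"] coroot_refl refl_same)

lemma refl_image_iff: "s \<in> S \<Longrightarrow> \<beta> \<in> refl s ` X \<longleftrightarrow> refl s \<beta> \<in> X"
  using image_eqI[of \<beta> "refl s" "refl s \<beta>" X] by auto

lemma refl_simple: "s \<in> S \<Longrightarrow> refl s (simple_root s) = (\<lambda>r. - simple_root s r)"
  by (rule ext) (simp add: refl_def coroot_simple A_diag)

lemma refl_scale: "refl s (\<lambda>r. c * v r) = (\<lambda>r. c * refl s v r)"
  using refl_lin[of s c v 0 v] by (simp add: lin_def)

lemma supp_in_refl: "supp_in J v \<Longrightarrow> s \<in> J \<Longrightarrow> supp_in J (refl s v)"
  by (auto simp: supp_in_def refl_def)

text \<open>For a word without repetitions, the value on the simple roots of \<open>r\<close> and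
  \<open>s\<close> is 1 if \<open>r = s\<close>, \<open>A r s\<close> if \<open>r\<close> stands
  after \<open>s\<close>, and 0 if it stands before. This is the triangular half of \<open>A\<close>
  along the word; symmetrising it returns \<open>A\<close>.\<close>

fun euler :: "'a list \<Rightarrow> ('a \<Rightarrow> real) \<Rightarrow> ('a \<Rightarrow> real) \<Rightarrow> real" where
  "euler [] u v = 0"
| "euler (s # cs) u v = u s * v s + (\<Sum>r\<in>set cs. A r s * u r) * v s + euler cs u v"

lemma euler_lin_left: "euler cs (lin a p b q) v = a * euler cs p v + b * euler cs q v"
  by (induction cs) (simp_all add: lin_def sum.distrib sum_distrib_left algebra_simps)

lemma euler_lin_right: "euler cs v (lin a p b q) = a * euler cs v p + b * euler cs v q"
  by (induction cs) (simp_all add: lin_def algebra_simps)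

lemma euler_zero_left: "(\<And>r. r \<in> set cs \<Longrightarrow> u r = 0) \<Longrightarrow> euler cs u v = 0"
  by (induction cs) simp_all

lemma euler_zero_right: "(\<And>r. r \<in> set cs \<Longrightarrow> v r = 0) \<Longrightarrow> euler cs u v = 0"
  by (induction cs) simp_all

lemma euler_initial: "s \<notin> set cs \<Longrightarrow> euler (s # cs) (simple_root s) v = v s"
proof -
  assume s: "s \<notin> set cs"
  have "(\<Sum>r\<in>set cs. A r s * simple_root s r) = 0"
    by (rule sum.neutral) (use s in \<open>auto simp: simple_root_def\<close>)
  moreover have "euler cs (simple_root s) v = 0"
    by (rule euler_zero_left) (use s in \<open>auto simp: simple_root_def\<close>)
  ultimately show ?thesis by simp
qed

lemma euler_initial_right:
  "s \<notin> set cs \<Longrightarrow> euler (s # cs) v (simple_root s) = v s + (\<Sum>r\<in>set cs. A r s * v r)"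
proof -
  assume s: "s \<notin> set cs"
  have "euler cs v (simple_root s) = 0"
    by (rule euler_zero_right) (use s in \<open>auto simp: simple_root_def\<close>)
  then show ?thesis by simp
qed

lemma euler_snoc:
  assumes "distinct (s # cs)"
  shows "euler (cs @ [s]) u v = euler cs u v + u s * (\<Sum>r\<in>set cs. A s r * v r) + u s * v s"
  using assms
  by (induction cs) (auto simp: sum.distrib algebra_simps split: if_splits)

lemma euler_final:
  assumes "distinct (s # cs)"
  shows "euler (cs @ [s]) v (simple_root s) = v s"
proof -
  have "(\<Sum>r\<in>set cs. A s r * simple_root s r) = 0"
    by (rule sum.neutral) (use assms in \<open>auto simp: simple_root_def\<close>)
  moreover have "euler cs v (simple_root s) = 0"
    by (rule euler_zero_right) (use assms in \<open>auto simp: simple_root_def\<close>)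
  ultimately show ?thesis using assms by (simp add: euler_snoc)
qed

lemma coroot_supp:
  assumes "s \<notin> set cs" "set (s # cs) \<subseteq> S" "supp_in (set (s # cs)) v"
  shows "coroot s v = 2 * v s + (\<Sum>r\<in>set cs. A s r * v r)"
proof -
  have "coroot s v = (\<Sum>r\<in>set (s # cs). A s r * v r)"
    unfolding coroot_def
    by (rule sum.mono_neutral_right) (use assms finite_S in \<open>auto simp: supp_in_def\<close>)
  then show ?thesis using assms by (simp add: A_diag)
qed

lemma sum_A_sym:
  assumes "set (s # cs) \<subseteq> S"
  shows "(\<Sum>r\<in>set cs. A r s * v r) = (\<Sum>r\<in>set cs. A s r * v r)"
  by (rule sum.cong) (use assms A_sym in auto)

text \<open>Only the coordinate at \<open>s\<close> moves, to
  \<open>- w s - (\<Sum>r\<in>set cs. A s r * w r)\<close>, and this substitution turns the terms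
  with \<open>s\<close> last into those with \<open>s\<close> first. The supports keep
  \<open>coroot s\<close> from seeing letters outside the word. Rotating the word conjugates the
  Coxeter element by its first letter.\<close>

lemma euler_rotate:
  assumes d: "distinct (s # cs)" and S: "set (s # cs) \<subseteq> S"
    and u: "supp_in (set (s # cs)) u" and v: "supp_in (set (s # cs)) v"
  shows "euler (cs @ [s]) (refl s u) (refl s v) = euler (s # cs) u v"
proof -
  have s: "s \<notin> set cs" using d by simp
  have 1: "(\<Sum>r\<in>set cs. A s r * refl s w r) = (\<Sum>r\<in>set cs. A s r * w r)" for w
    by (rule sum.cong) (use s in \<open>auto simp: refl_def\<close>)
  have 2: "euler ds (refl s u) (refl s v) = euler ds u v" if "s \<notin> set ds" for ds
    using that
  proof (induction ds)
    case (Cons t ds)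
    have "(\<Sum>r\<in>set ds. A r t * refl s u r) = (\<Sum>r\<in>set ds. A r t * u r)"
      by (rule sum.cong) (use Cons in \<open>auto simp: refl_def\<close>)
    moreover have "t \<noteq> s" using Cons by auto
    ultimately show ?case using Cons by simp
  qed simp
  have "refl s w s = - w s - (\<Sum>r\<in>set cs. A s r * w r)" if "supp_in (set (s # cs)) w" for w
    using coroot_supp[OF s S that] by (simp add: refl_same)
  note e = this[OF u] this[OF v]
  have "euler (cs @ [s]) (refl s u) (refl s v) = euler cs u v
      + refl s u s * (\<Sum>r\<in>set cs. A s r * v r) + refl s u s * refl s v s"
    by (simp only: euler_snoc[OF d] 1 2[OF s])
  also have "\<dots> = euler (s # cs) u v"
    unfolding e euler.simps(2) sum_A_sym[OF S] by (simp add: algebra_simps)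
  finally show ?thesis .
qed

lemma euler_initial_nonpos:
  assumes "s \<notin> set cs" "set (s # cs) \<subseteq> S" "vpos v" "v s = 0"
  shows "euler (s # cs) v (simple_root s) \<le> 0"
proof -
  have "(\<Sum>r\<in>set cs. A r s * v r) \<le> 0"
    by (rule sum_nonpos)
      (use assms A_nonpos in \<open>auto simp: vpos_def intro!: mult_nonpos_nonneg\<close>)
  then show ?thesis using assms(4) by (simp only: euler_initial_right[OF assms(1)])
qed

end

section \<open>Families of inversion sets\<close>

text \<open>\<open>PR\<close> stands for the positive roots and \<open>W\<close> for the family of the sets \<open>N w\<close>. Below, \<open>tog s\<close>
  corresponds to left multiplication by \<open>s\<close> and \<open>par J\<close> to \<open>w \<mapsto> w\<^sub>J\<close>.\<close>

locale inversion_sets = cartan_datum S A for S :: "'a set" and A +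
  fixes PR :: "('a \<Rightarrow> real) set" and W :: "('a \<Rightarrow> real) set set"
  assumes PR_vpos: "\<beta> \<in> PR \<Longrightarrow> vpos \<beta>"
    and PR_supp: "\<beta> \<in> PR \<Longrightarrow> supp_in S \<beta>"
    and PR_simple: "s \<in> S \<Longrightarrow> simple_root s \<in> PR"
    and PR_scale: "\<beta> \<in> PR \<Longrightarrow> (\<lambda>r. c * \<beta> r) \<in> PR \<Longrightarrow> c = 1"
    and PR_refl: "s \<in> S \<Longrightarrow> \<beta> \<in> PR \<Longrightarrow> \<beta> \<noteq> simple_root s \<Longrightarrow> refl s \<beta> \<in> PR"
    and W_PR: "R \<in> W \<Longrightarrow> R \<subseteq> PR"
    and W_finite: "R \<in> W \<Longrightarrow> finite R"
    and W_empty: "{} \<in> W"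
    and W_above: "R \<in> W \<Longrightarrow> s \<in> S \<Longrightarrow> simple_root s \<in> R \<Longrightarrow> refl s ` (R - {simple_root s}) \<in> W"
    and W_below: "R \<in> W \<Longrightarrow> s \<in> S \<Longrightarrow> simple_root s \<notin> R \<Longrightarrow> insert (simple_root s) (refl s ` R) \<in> W"
    and W_up: "R \<in> W \<Longrightarrow> R' \<in> W \<Longrightarrow> R \<subset> R' \<Longrightarrow> \<exists>\<beta>\<in>R' - R. insert \<beta> R \<in> W"
    and W_convex: "R \<in> W \<Longrightarrow> \<beta> \<in> R \<Longrightarrow> \<gamma> \<in> R \<Longrightarrow> 0 \<le> a \<Longrightarrow> 0 \<le> b \<Longrightarrow>
        lin a \<beta> b \<gamma> \<in> PR \<Longrightarrow> lin a \<beta> b \<gamma> \<in> R"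
    and W_coconvex: "R \<in> W \<Longrightarrow> \<beta> \<in> PR \<Longrightarrow> \<gamma> \<in> PR \<Longrightarrow> 0 \<le> a \<Longrightarrow> 0 \<le> b \<Longrightarrow>
        lin a \<beta> b \<gamma> \<in> R \<Longrightarrow> \<beta> \<in> R \<or> \<gamma> \<in> R"
    and W_par: "R \<in> W \<Longrightarrow> J \<subseteq> S \<Longrightarrow> par J R \<in> W"
    and W_local_join: "R \<in> W \<Longrightarrow> insert p R \<in> W \<Longrightarrow> insert q R \<in> W \<Longrightarrow> p \<notin> R \<Longrightarrow> q \<notin> R \<Longrightarrow> p \<noteq> q \<Longrightarrow>
        U \<in> W \<Longrightarrow> insert p (insert q R) \<subseteq> U \<Longrightarrow>
        R \<union> {\<beta> \<in> PR. \<exists>a\<ge>0. \<exists>b\<ge>0. \<beta> = lin a p b q} \<in> W"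
    and W_polygon: "R \<in> W \<Longrightarrow> X \<in> W \<Longrightarrow> Y \<in> W \<Longrightarrow> X \<noteq> Y \<Longrightarrow>
        \<exists>\<beta>. \<beta> \<notin> R \<inter> X \<and> (X = insert \<beta> R \<or> R = insert \<beta> X) \<and> X \<noteq> R \<Longrightarrow>
        \<exists>\<beta>. \<beta> \<notin> R \<inter> Y \<and> (Y = insert \<beta> R \<or> R = insert \<beta> Y) \<and> Y \<noteq> R \<Longrightarrow>
        \<exists>R0 p q. R0 \<in> W \<and> insert p R0 \<in> W \<and> insert q R0 \<in> W \<and> p \<notin> R0 \<and> q \<notin> R0 \<and> p \<noteq> q \<and>
          R0 \<subseteq> R \<inter> X \<inter> Y \<and> R \<union> X \<union> Y \<subseteq> R0 \<union> {\<beta> \<in> PR. \<exists>a\<ge>0. \<exists>b\<ge>0. \<beta> = lin a p b q}"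
    and W_descend: "R \<in> W \<Longrightarrow> s \<in> S \<Longrightarrow> K \<subseteq> S \<Longrightarrow> s \<notin> K \<Longrightarrow> R = par (insert s K) R \<Longrightarrow>
        simple_root s \<notin> R \<Longrightarrow> R \<noteq> par K R \<Longrightarrow>
        \<exists>t\<in>R. \<exists>(I::nat set) a a' \<delta>. finite I \<and> t s = 1 \<and>
          t = (\<lambda>r. simple_root s r + (\<Sum>i\<in>I. a i * \<delta> i r)) \<and>
          (\<forall>i\<in>I. 0 \<le> a i \<and> 0 < a' i \<and> \<delta> i \<in> PR \<and> lin 1 t (- a' i) (\<delta> i) \<in> PR - R)"
begin

text \<open>For two covers \<open>insert p R\<close> and \<open>insert q R\<close> with a common
  upper bound, \<open>R \<union> cone p q\<close> is their join and the top of the polygon they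
  span.\<close>

definition cone :: "('a \<Rightarrow> real) \<Rightarrow> ('a \<Rightarrow> real) \<Rightarrow> ('a \<Rightarrow> real) set" where
  "cone p q = {\<beta> \<in> PR. \<exists>a\<ge>0. \<exists>b\<ge>0. \<beta> = lin a p b q}"

definition tog :: "'a \<Rightarrow> ('a \<Rightarrow> real) set \<Rightarrow> ('a \<Rightarrow> real) set" where
  "tog s R = (if simple_root s \<in> R then refl s ` (R - {simple_root s})
              else insert (simple_root s) (refl s ` R))"

definition Wp :: "'a set \<Rightarrow> ('a \<Rightarrow> real) set set" where
  "Wp J = {R \<in> W. \<forall>\<beta>\<in>R. supp_in J \<beta>}"

lemma WpD: "R \<in> Wp J \<Longrightarrow> R \<in> W" "R \<in> Wp J \<Longrightarrow> \<beta> \<in> R \<Longrightarrow> supp_in J \<beta>"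
  by (auto simp: Wp_def)

lemma Wp_simple: "R \<in> Wp J \<Longrightarrow> simple_root s \<in> R \<Longrightarrow> s \<in> J"
  using WpD(2)[of R J "simple_root s"] by simp

lemma Wp_PR: "R \<in> Wp J \<Longrightarrow> R \<subseteq> PR"
  using W_PR WpD by blast

lemma Wp_mono: "R \<in> Wp J \<Longrightarrow> J \<subseteq> K \<Longrightarrow> R \<in> Wp K"
  by (auto simp: Wp_def intro: supp_in_mono)

lemma Wp_sub: "R \<in> Wp J \<Longrightarrow> X \<in> W \<Longrightarrow> X \<subseteq> R \<Longrightarrow> X \<in> Wp J"
  by (auto simp: Wp_def)

lemma par_Wp: "R \<in> W \<Longrightarrow> J \<subseteq> S \<Longrightarrow> par J R \<in> Wp J"
  using W_par by (auto simp: Wp_def par_def)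

lemma par_id: "R \<in> Wp J \<Longrightarrow> par J R = R"
  by (auto simp: Wp_def par_def)

lemma Wp_S: "R \<in> W \<Longrightarrow> R \<in> Wp S"
  using W_PR PR_supp by (auto simp: Wp_def)

lemma Wp_empty: "{} \<in> Wp J"
  by (simp add: Wp_def W_empty)

lemma PR_lin_1: "p \<in> PR \<Longrightarrow> (\<lambda>r. a * p r) \<in> PR \<Longrightarrow> (\<lambda>r. a * p r) = p"
  using PR_scale[of p a] by simp

lemma lin_PR_0: "p \<in> PR \<Longrightarrow> lin a p 0 q \<in> PR \<Longrightarrow> lin a p 0 q = p"
    "q \<in> PR \<Longrightarrow> lin 0 p b q \<in> PR \<Longrightarrow> lin 0 p b q = q"
  by (simp_all add: lin_0 PR_lin_1)

lemma PR_nonneg: "p \<in> PR \<Longrightarrow> 0 \<le> p r"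
  by (rule vpos_nonneg[OF PR_vpos])

lemma PR_nonzero: "p \<in> PR \<Longrightarrow> \<exists>r. p r > 0"
  using PR_vpos[of p] unfolding vpos_def by (metis less_eq_real_def)

lemma PR_only_simple:
  assumes "s \<in> S" "p \<in> PR" "\<And>r. r \<noteq> s \<Longrightarrow> p r = 0"
  shows "p = simple_root s"
proof -
  have "p = (\<lambda>r. p s * simple_root s r)"
    using assms(3) by (auto simp: simple_root_def)
  with PR_lin_1[OF PR_simple[OF assms(1)], of "p s"] assms(2) show ?thesis by simp
qed

text \<open>Simple roots span extreme rays: coordinates of positive roots are nonnegative, so a
  summand with positive coefficient is supported at \<open>s\<close> alone.\<close>

lemma simple_extremal:
  assumes s: "s \<in> S" and p: "p \<in> PR" and q: "q \<in> PR" and "0 \<le> a" "0 \<le> b"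
    and e: "simple_root s = lin a p b q"
  shows "simple_root s = p \<or> simple_root s = q"
proof (cases "a = 0")
  case True
  then show ?thesis using e lin_PR_0(2)[OF q, of p b] PR_simple[OF s] by simp
next
  case False
  have "p r = 0" if "r \<noteq> s" for r
  proof -
    have "a * p r + b * q r = 0" using fun_cong[OF e, of r] that by (simp add: lin_def)
    moreover have "0 \<le> a * p r" "0 \<le> b * q r" using assms PR_nonneg by auto
    ultimately have "a * p r = 0" by linarith
    then show ?thesis using False by simp
  qed
  then show ?thesis using PR_only_simple[OF s p] by metis
qed

lemma simple_cone: "s \<in> S \<Longrightarrow> p \<in> PR \<Longrightarrow> q \<in> PR \<Longrightarrow> simple_root s \<in> cone p q \<Longrightarrow>
    simple_root s = p \<or> simple_root s = q"
  using simple_extremal unfolding cone_def by blast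

lemma cone_comm: "cone p q = cone q p"
  unfolding cone_def by (metis lin_comm)

lemma cone_self: "p \<in> PR \<Longrightarrow> p \<in> cone p q" "q \<in> PR \<Longrightarrow> q \<in> cone p q"
proof -
  assume "p \<in> PR"
  moreover have "p = lin 1 p 0 q" by (simp add: lin_def)
  ultimately show "p \<in> cone p q" unfolding cone_def by (intro CollectI conjI exI[of _ 1] exI[of _ 0]) auto
next
  assume "q \<in> PR"
  moreover have "q = lin 0 p 1 q" by (simp add: lin_def)
  ultimately show "q \<in> cone p q" unfolding cone_def by (intro CollectI conjI exI[of _ 0] exI[of _ 1]) auto
qed

lemma convex_cone: "R \<in> W \<Longrightarrow> p \<in> R \<Longrightarrow> q \<in> R \<Longrightarrow> cone p q \<subseteq> R"
  using W_convex by (auto simp: cone_def)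

lemma coconvex_cone: "R \<in> W \<Longrightarrow> p \<in> PR \<Longrightarrow> q \<in> PR \<Longrightarrow> r \<in> cone p q \<Longrightarrow> r \<in> R \<Longrightarrow> p \<in> R \<or> q \<in> R"
  using W_coconvex unfolding cone_def by blast

lemma refl_PR_ne: "s \<in> S \<Longrightarrow> \<beta> \<in> PR \<Longrightarrow> refl s \<beta> \<noteq> simple_root s"
proof
  assume s: "s \<in> S" and b: "\<beta> \<in> PR" and e: "refl s \<beta> = simple_root s"
  have "\<beta> = refl s (refl s \<beta>)" using s by simp
  also have "\<dots> = (\<lambda>r. - simple_root s r)" by (simp only: e refl_simple[OF s])
  finally have "\<beta> s = - simple_root s s" by metis
  then have "\<beta> s = -1" by simp
  with PR_nonneg[OF b, of s] show False by simp
qed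

lemma tog_mem_simple: "s \<in> S \<Longrightarrow> R \<subseteq> PR \<Longrightarrow> simple_root s \<in> tog s R \<longleftrightarrow> simple_root s \<notin> R"
  unfolding tog_def using refl_PR_ne[of s] by (auto simp: eq_commute[of "simple_root s"])

lemma tog_mem: "s \<in> S \<Longrightarrow> \<beta> \<in> PR \<Longrightarrow> \<beta> \<noteq> simple_root s \<Longrightarrow> \<beta> \<in> tog s R \<longleftrightarrow> refl s \<beta> \<in> R"
  unfolding tog_def using refl_PR_ne[of s \<beta>] by (simp add: refl_image_iff)

lemma tog_W: "R \<in> W \<Longrightarrow> s \<in> S \<Longrightarrow> tog s R \<in> W"
  unfolding tog_def using W_above W_below by auto

lemma set_eq_PR:
  assumes "X \<subseteq> PR" "Y \<subseteq> PR" "simple_root s \<in> X \<longleftrightarrow> simple_root s \<in> Y"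
    "\<And>\<beta>. \<beta> \<in> PR \<Longrightarrow> \<beta> \<noteq> simple_root s \<Longrightarrow> \<beta> \<in> X \<longleftrightarrow> \<beta> \<in> Y"
  shows "X = Y"
  using assms by blast

lemma tog_PR: "R \<subseteq> PR \<Longrightarrow> s \<in> S \<Longrightarrow> tog s R \<subseteq> PR"
  unfolding tog_def using PR_refl PR_simple by (auto split: if_splits)

lemma tog_tog [simp]: "R \<subseteq> PR \<Longrightarrow> s \<in> S \<Longrightarrow> tog s (tog s R) = R"
  apply (rule set_eq_PR[of _ _ s])
     apply (simp_all add: tog_PR tog_mem_simple)
  apply (simp add: tog_mem PR_refl refl_PR_ne)
  done

lemma tog_mono:
  assumes "s \<in> S" "R \<subseteq> R'" "R' \<subseteq> PR" "simple_root s \<in> R \<longleftrightarrow> simple_root s \<in> R'"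
  shows "tog s R \<subseteq> tog s R'"
  using assms unfolding tog_def by auto

lemma tog_Wp: "R \<in> Wp J \<Longrightarrow> s \<in> J \<Longrightarrow> J \<subseteq> S \<Longrightarrow> tog s R \<in> Wp J"
  using tog_W[of R s] unfolding Wp_def
  by (auto simp: tog_def supp_in_refl split: if_splits)

lemma tog_insert:
  assumes "s \<in> S" "simple_root s \<in> R" "p \<noteq> simple_root s"
  shows "tog s (insert p R) = insert (refl s p) (tog s R)"
  using assms unfolding tog_def by auto

lemma card_tog_less: "finite R \<Longrightarrow> simple_root s \<in> R \<Longrightarrow> card (tog s R) < card R"
  unfolding tog_def using card_image_le[of "R - {simple_root s}" "refl s"]
  by (simp add: card_Diff_singleton) (metis Suc_pred card_gt_0_iff empty_iff le_imp_less_Suc)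

text \<open>In the group, left multiplication by \<open>s\<close> goes up the same edge as right
  multiplication by some \<open>r\<close>, so \<open>s w = w r\<close> and \<open>s\<close> permutes
  the inversions of \<open>w\<close>. For sets, split on the sign of
  \<open>coroot s \<beta>\<close>: either the image lies between \<open>\<beta>\<close> and
  \<open>simple_root s\<close>, inside the convex upper set, or \<open>\<beta>\<close> lies between
  the image and \<open>simple_root s\<close>, and coconvexity of \<open>R\<close> applies.\<close>

lemma refl_invariant:
  assumes s: "s \<in> S" and R: "R \<in> W" and R': "insert (simple_root s) R \<in> W" and a: "simple_root s \<notin> R"
  shows "refl s ` R = R"
proof -
  have sub: "refl s \<beta> \<in> R" if b: "\<beta> \<in> R" for \<beta>
  proof -
    have bP: "\<beta> \<in> PR" and ne: "\<beta> \<noteq> simple_root s" using b a W_PR[OF R] by auto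
    have rP: "refl s \<beta> \<in> PR" and rne: "refl s \<beta> \<noteq> simple_root s"
      using PR_refl[OF s bP ne] refl_PR_ne[OF s bP] by auto
    show ?thesis
    proof (cases "coroot s \<beta> \<le> 0")
      case True
      then show ?thesis
        using W_convex[OF R', of \<beta> "simple_root s" 1 "- coroot s \<beta>"] b rP rne by (auto simp: refl_eq_lin)
    next
      case False
      have "\<beta> = lin 1 (refl s \<beta>) (coroot s \<beta>) (simple_root s)"
        by (auto simp: refl_eq_lin lin_def)
      then show ?thesis
        using W_coconvex[OF R rP PR_simple[OF s], of 1 "coroot s \<beta>"] False b a by auto
    qed
  qed
  show ?thesis
  proof
    show "refl s ` R \<subseteq> R" using sub by auto
    show "R \<subseteq> refl s ` R" using sub s by (auto simp: refl_image_iff)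
  qed
qed

lemma tog_insert_simple:
  assumes s: "s \<in> S" and R: "R \<in> W" and R': "insert (simple_root s) R \<in> W" and a: "simple_root s \<notin> R"
  shows "tog s (insert (simple_root s) R) = R"
  using refl_invariant[OF assms] a unfolding tog_def by (simp add: insert_Diff_if)

text \<open>The roots \<open>p\<close> and \<open>q\<close> are the simple roots of the rank-two
  system in their plane. If, say, the coefficient of \<open>q\<close> were negative,
  \<open>p\<close> would lie between \<open>lin x p y q\<close> and \<open>q\<close>, against
  convexity of \<open>insert q R\<close> or coconvexity of \<open>insert p R\<close>.\<close>

lemma plane_cone:
  assumes R: "R \<in> W" "insert p R \<in> W" "insert q R \<in> W" and n: "p \<notin> R" "q \<notin> R" "p \<noteq> q"
    and r: "lin x p y q \<in> PR"
  shows "0 \<le> x \<and> 0 \<le> y"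
proof -
  have main: "0 \<le> y" if R: "R \<in> W" "insert p R \<in> W" "insert q R \<in> W" and n: "p \<notin> R" "q \<notin> R" "p \<noteq> q"
    and r: "lin x p y q \<in> PR" for p q x y
  proof (rule ccontr)
    assume "\<not> 0 \<le> y"
    then have y: "y < 0" by simp
    have pq: "p \<in> PR" "q \<in> PR" using R W_PR by blast+
    let ?r = "lin x p y q"
    have x: "x > 0"
    proof (rule ccontr)
      assume "\<not> x > 0"
      obtain i where i: "?r i > 0" using PR_nonzero[OF r] by blast
      have "x * p i \<le> 0" "y * q i \<le> 0"
        using \<open>\<not> x > 0\<close> y PR_nonneg pq by (auto simp: mult_le_0_iff)
      with i show False by (simp add: lin_def)
    qed
    have e: "p = lin (1/x) ?r (-y/x) q" using x by (auto simp: lin_def field_simps)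
    have c: "0 \<le> 1/x" "0 \<le> -y/x" using x y by (auto simp: divide_nonpos_pos)
    show False
    proof (cases "?r \<in> R")
      case True
      then have "p \<in> insert q R"
        using W_convex[OF R(3), of ?r q "1/x" "-y/x"] c e pq by auto
      then show False using n by auto
    next
      case False
      have "?r \<noteq> p"
      proof
        assume "?r = p"
        then have "lin (x - 1) p y q = (\<lambda>_. 0)" by (auto simp: lin_def fun_eq_iff algebra_simps)
        then have "\<And>i. (x-1) * p i = (-y) * q i" by (auto simp: lin_def fun_eq_iff algebra_simps)
        then have q': "q = (\<lambda>i. ((x-1)/(-y)) * p i)" using y by (auto simp: fun_eq_iff field_simps)
        then show False using PR_lin_1[OF pq(1), of "(x-1)/(-y)"] pq n(3) by metis
      qed
      moreover have "?r \<in> insert p R \<or> q \<in> insert p R"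
        using W_coconvex[OF R(2) r pq(2) c] e by auto
      ultimately show False using False n by auto
    qed
  qed
  show ?thesis
    using main[OF R n r] main[of q p y x] R n r by (auto simp: lin_comm)
qed

lemma W_down:
  assumes "R \<in> W" "R' \<in> W" "R \<subset> R'"
  shows "\<exists>\<beta>. \<beta> \<in> R' \<and> \<beta> \<notin> R \<and> R' - {\<beta>} \<in> W"
  using assms
proof (induction "card R' - card R" arbitrary: R rule: less_induct)
  case less
  obtain \<beta> where b: "\<beta> \<in> R'" "\<beta> \<notin> R" "insert \<beta> R \<in> W"
    using W_up[OF less.prems] by blast
  show ?case
  proof (cases "insert \<beta> R = R'")
    case True
    then have "R' - {\<beta>} = R" using b by auto
    then show ?thesis using b less.prems by auto
  next
    case False
    then have sub: "insert \<beta> R \<subset> R'" using b less.prems by auto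
    have fin: "finite R'" "finite R" using W_finite less.prems by blast+
    have "card (insert \<beta> R) < card R'" using psubset_card_mono[OF fin(1) sub] .
    moreover have "card (insert \<beta> R) = Suc (card R)" using b fin by simp
    ultimately have "card R' - card (insert \<beta> R) < card R' - card R" by linarith
    from less.hyps[OF this b(3) less.prems(2) sub] show ?thesis by blast
  qed
qed

section \<open>The projection on inversion sets\<close>

text \<open>Dropping the first letter shortens the word; rotating keeps its length but removes a
  root. The test \<open>finite R\<close> makes this count decrease, and it succeeds on all of
  \<open>W\<close>.\<close>

function P :: "'a list \<Rightarrow> ('a \<Rightarrow> real) set \<Rightarrow> ('a \<Rightarrow> real) set" where
  "P [] R = {}"
| "P (s # cs) R = (if finite R \<and> simple_root s \<in> R then tog s (P (cs @ [s]) (tog s R))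
                   else P cs (par (set cs) R))"
  by pat_completeness auto
termination
  by (relation "measures [\<lambda>(cs, R). length cs, \<lambda>(cs, R). card R]") (auto simp: card_tog_less)

declare P.simps(2) [simp del]

lemma P_above: "R \<in> W \<Longrightarrow> simple_root s \<in> R \<Longrightarrow> P (s # cs) R = tog s (P (cs @ [s]) (tog s R))"
  by (simp add: P.simps(2) W_finite)

lemma P_below: "simple_root s \<notin> R \<Longrightarrow> P (s # cs) R = P cs (par (set cs) R)"
  by (simp add: P.simps(2))

lemma P_induct [consumes 2, case_names Nil above below]:
  assumes "R \<in> Wp (set cs)" and "distinct cs \<and> set cs \<subseteq> S"
    and nil: "\<And>R. R \<in> Wp {} \<Longrightarrow> Q [] R"
    and above: "\<And>s cs R. \<lbrakk>s \<notin> set cs; s \<in> S; distinct cs; set cs \<subseteq> S; R \<in> Wp (insert s (set cs)); simple_root s \<in> R;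
        tog s R \<in> Wp (insert s (set cs)); simple_root s \<notin> tog s R; Q (cs @ [s]) (tog s R)\<rbrakk> \<Longrightarrow> Q (s # cs) R"
    and below: "\<And>s cs R. \<lbrakk>s \<notin> set cs; s \<in> S; distinct cs; set cs \<subseteq> S; R \<in> Wp (insert s (set cs)); simple_root s \<notin> R;
        par (set cs) R \<in> Wp (set cs); Q cs (par (set cs) R)\<rbrakk> \<Longrightarrow> Q (s # cs) R"
  shows "Q cs R"
  using assms(1,2)
proof (induction cs R rule: P.induct)
  case (1 R)
  then show ?case using nil by simp
next
  case (2 s cs R)
  have pre: "s \<notin> set cs" "s \<in> S" "distinct cs" "set cs \<subseteq> S" "R \<in> Wp (insert s (set cs))" "R \<in> W"
    using 2(3,4) WpD by auto
  show ?case
  proof (cases "simple_root s \<in> R")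
    case True
    have t: "tog s R \<in> Wp (insert s (set cs))" using tog_Wp[OF pre(5)] pre by auto
    show ?thesis
      by (rule above) (use pre True t 2(1) in \<open>auto simp: W_finite tog_mem_simple W_PR\<close>)
  next
    case False
    show ?thesis
      by (rule below) (use pre False 2(2) par_Wp in auto)
  qed
qed

text \<open>The claims are proved together because \<open>P cs R \<subseteq> R\<close> tells which
  branch the recursion takes on \<open>P cs R\<close>, which is what idempotence needs.\<close>

lemma P_props:
  assumes "R \<in> Wp (set cs)" and "distinct cs \<and> set cs \<subseteq> S"
  shows "P cs R \<in> Wp (set cs) \<and> P cs R \<subseteq> R \<and> P cs (P cs R) = P cs R"
  using assms
proof (induction cs R rule: P_induct)
  case (Nil R)
  then show ?case by (simp add: Wp_empty)
next
  case (above s cs R)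
  let ?X = "P (cs @ [s]) (tog s R)"
  have X: "?X \<in> Wp (insert s (set cs))" "?X \<subseteq> tog s R" "P (cs @ [s]) ?X = ?X"
    using above.IH by auto
  have XP: "?X \<subseteq> PR" using X Wp_PR by blast
  have R: "R \<in> W" "R \<subseteq> PR" using above WpD Wp_PR by blast+
  have n: "simple_root s \<notin> ?X" using X above by blast
  have T: "tog s ?X \<in> Wp (insert s (set cs))" using tog_Wp X above by auto
  have m: "simple_root s \<in> tog s ?X" using n XP above tog_mem_simple by blast
  have eq: "P (s # cs) R = tog s ?X" using P_above above R by blast
  have "tog s ?X \<subseteq> tog s (tog s R)"
    by (rule tog_mono) (use above X n R tog_PR in auto)
  then have sub: "tog s ?X \<subseteq> R" using R above by simp
  have "P (s # cs) (tog s ?X) = tog s ?X"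
    using P_above[of "tog s ?X" s cs] T m WpD X XP above by simp
  then show ?case using T sub eq by auto
next
  case (below s cs R)
  let ?X = "P cs (par (set cs) R)"
  have X: "?X \<in> Wp (set cs)" "?X \<subseteq> par (set cs) R" "P cs ?X = ?X" using below.IH by auto
  have n: "simple_root s \<notin> ?X" using Wp_simple[OF X(1)] below(1) by auto
  show ?case using X n Wp_mono[OF X(1), of "insert s (set cs)"] below par_subset[of "set cs" R]
    by (auto simp: P_below par_id)
qed

lemma P_Wp: "R \<in> Wp (set cs) \<Longrightarrow> distinct cs \<Longrightarrow> set cs \<subseteq> S \<Longrightarrow> P cs R \<in> Wp (set cs)"
  and P_le: "R \<in> Wp (set cs) \<Longrightarrow> distinct cs \<Longrightarrow> set cs \<subseteq> S \<Longrightarrow> P cs R \<subseteq> R"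
  and P_idem: "R \<in> Wp (set cs) \<Longrightarrow> distinct cs \<Longrightarrow> set cs \<subseteq> S \<Longrightarrow> P cs (P cs R) = P cs R"
  using P_props by blast+

lemma P_mem_iff:
  assumes "R \<in> Wp (set (s # cs))" "distinct (s # cs)" "set (s # cs) \<subseteq> S"
  shows "simple_root s \<in> P (s # cs) R \<longleftrightarrow> simple_root s \<in> R"
proof
  show "simple_root s \<in> P (s # cs) R \<Longrightarrow> simple_root s \<in> R" using P_le[OF assms] by blast
next
  assume m: "simple_root s \<in> R"
  have t: "tog s R \<in> Wp (set (cs @ [s]))" using tog_Wp assms by auto
  have n: "simple_root s \<notin> tog s R" using m Wp_PR[OF assms(1)] assms tog_mem_simple by auto
  have c: "distinct (cs @ [s])" "set (cs @ [s]) \<subseteq> S" using assms by auto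
  have "simple_root s \<notin> P (cs @ [s]) (tog s R)" using P_le[OF t c] n by blast
  then show "simple_root s \<in> P (s # cs) R"
    using P_above[OF WpD(1)[OF assms(1)] m, of cs] Wp_PR[OF P_Wp[OF t c]] assms tog_mem_simple by auto
qed

text \<open>\<open>simple_root t\<close> has coordinate 1 at \<open>t\<close>, so the recursion
  never takes the upper branch at \<open>t\<close>, and the other reflections leave that coordinate
  zero. The lower branch at \<open>t\<close> merely drops the letter.\<close>

lemma P_remove:
  assumes "R \<in> Wp (set cs)" and "distinct cs \<and> set cs \<subseteq> S" and "\<And>\<beta>. \<beta> \<in> R \<Longrightarrow> \<beta> t = 0"
  shows "P cs R = P (removeAll t cs) R"
  using assms
proof (induction cs R rule: P_induct)
  case (Nil R)
  then show ?case by simp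
next
  case (above s cs R)
  have "simple_root s t = 0" using above.prems above.hyps by blast
  then have st: "s \<noteq> t" by auto
  have "\<beta> t = 0" if "\<beta> \<in> tog s R" for \<beta>
    using that above.prems above st by (auto simp: tog_def)
  then have "P (cs @ [s]) (tog s R) = P (removeAll t (cs @ [s])) (tog s R)" using above.IH by simp
  moreover have "removeAll t (s # cs) = s # removeAll t cs"
    "removeAll t (cs @ [s]) = removeAll t cs @ [s]" using st by auto
  ultimately show ?case
    using P_above[OF WpD(1)[OF above.hyps(5)] above.hyps(6), of cs]
      P_above[OF WpD(1)[OF above.hyps(5)] above.hyps(6), of "removeAll t cs"] by simp
next
  case (below s cs R)
  have IH: "P cs (par (set cs) R) = P (removeAll t cs) (par (set cs) R)"
    using below.IH below.prems by (auto simp: par_def)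
  show ?case
  proof (cases "s = t")
    case True
    have "par (set cs) R = R"
    proof -
      have "supp_in (set cs) \<beta>" if b: "\<beta> \<in> R" for \<beta>
        using supp_in_insert[of t "set cs" \<beta>] below.prems[OF b] WpD(2)[OF below.hyps(5) b] below.hyps(1) True
        by simp
      then show ?thesis by (auto simp: par_def)
    qed
    moreover have "removeAll t (s # cs) = cs" using True below.hyps(1) by (simp add: removeAll_id)
    ultimately show ?thesis using P_below[OF below.hyps(6), of cs] by simp
  next
    case False
    have "par (set (removeAll t cs)) R = par (set cs) R"
    proof -
      have "supp_in (set (removeAll t cs)) \<beta> \<longleftrightarrow> supp_in (set cs) \<beta>" if b: "\<beta> \<in> R" for \<beta>
        using below.prems[OF b] unfolding supp_in_def by auto
      then show ?thesis by (auto simp: par_def)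
    qed
    moreover have "removeAll t (s # cs) = s # removeAll t cs" using False by simp
    ultimately show ?thesis
      using P_below[OF below.hyps(6), of cs] P_below[OF below.hyps(6), of "removeAll t cs"] IH by simp
  qed
qed

text \<open>Links the two words of the recursion: a set fixed by \<open>P cs\<close>, as produced by
  the lower branch, is also fixed by the rotated word \<open>cs @ [t]\<close> of the upper
  branch.\<close>

lemma P_snoc:
  assumes "R \<in> Wp (set cs)" "distinct cs" "set cs \<subseteq> S" "t \<notin> set cs" "t \<in> S"
  shows "P (cs @ [t]) R = P cs R"
proof -
  have "R \<in> Wp (set (cs @ [t]))" using Wp_mono[OF assms(1)] by auto
  moreover have "\<beta> t = 0" if "\<beta> \<in> R" for \<beta>
    using WpD(2)[OF assms(1) that] assms(4) by (auto simp: supp_in_def)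
  ultimately have "P (cs @ [t]) R = P (removeAll t (cs @ [t])) R"
    by (intro P_remove) (use assms in auto)
  then show ?thesis using assms by (simp add: removeAll_id)
qed

lemma P_empty: "P cs {} = {}"
  by (induction cs) (auto simp: P_below par_def)

lemma tog_empty: "tog s {} = {simple_root s}"
  by (simp add: tog_def)

lemma P_simple:
  assumes "s \<in> set cs" "distinct cs" "set cs \<subseteq> S"
  shows "P cs {simple_root s} = {simple_root s}"
  using assms
proof (induction cs)
  case (Cons t cs)
  have W: "{simple_root s} \<in> W" using tog_W[OF W_empty, of s] Cons by (auto simp: tog_empty)
  show ?case
  proof (cases "s = t")
    case True
    have "tog s {simple_root s} = {}" by (simp add: tog_def)
    then show ?thesis using P_above[OF W] True by (simp add: P_empty tog_empty)
  next
    case False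
    then have "par (set cs) {simple_root s} = {simple_root s}" using Cons by (auto simp: par_def)
    then show ?thesis using Cons False by (simp add: P_below)
  qed
qed simp

lemma simple_W: "s \<in> S \<Longrightarrow> {simple_root s} \<in> W"
  using tog_W[OF W_empty, of s] by (auto simp: tog_empty)

lemma tog_inj: "X \<subseteq> PR \<Longrightarrow> Y \<subseteq> PR \<Longrightarrow> s \<in> S \<Longrightarrow> tog s X = tog s Y \<Longrightarrow> X = Y"
  using tog_tog by metis

lemma P_above_eq_iff:
  assumes "R \<in> Wp (insert s (set cs))" "R' \<in> Wp (insert s (set cs))" "simple_root s \<in> R" "simple_root s \<in> R'"
    and "s \<notin> set cs" "s \<in> S" "distinct cs" "set cs \<subseteq> S"
  shows "P (s # cs) R = P (s # cs) R' \<longleftrightarrow> P (cs @ [s]) (tog s R) = P (cs @ [s]) (tog s R')"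
proof -
  have w: "P (cs @ [s]) (tog s X) \<subseteq> PR" if "X \<in> Wp (insert s (set cs))" for X
  proof -
    have "tog s X \<in> Wp (set (cs @ [s]))" using tog_Wp[OF that] assms by auto
    then have "P (cs @ [s]) (tog s X) \<in> Wp (set (cs @ [s]))" by (rule P_Wp) (use assms in auto)
    then show ?thesis by (rule Wp_PR)
  qed
  have e: "P (s # cs) R = tog s (P (cs @ [s]) (tog s R))" "P (s # cs) R' = tog s (P (cs @ [s]) (tog s R'))"
    using P_above[OF WpD(1)[OF assms(1)] assms(3)] P_above[OF WpD(1)[OF assms(2)] assms(4)] by auto
  show ?thesis unfolding e
  proof
    assume "tog s (P (cs @ [s]) (tog s R)) = tog s (P (cs @ [s]) (tog s R'))"
    then show "P (cs @ [s]) (tog s R) = P (cs @ [s]) (tog s R')"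
      by (rule tog_inj[OF w[OF assms(1)] w[OF assms(2)] assms(6)])
  qed simp
qed

section \<open>Polygons followed through the recursion\<close>

lemma tog_cone:
  assumes s: "s \<in> S" and a: "simple_root s \<in> R0" and sub: "R0 \<subseteq> R" "R \<subseteq> R0 \<union> cone p q"
  shows "tog s R0 \<subseteq> tog s R \<and> tog s R \<subseteq> tog s R0 \<union> cone (refl s p) (refl s q)"
proof
  show "tog s R0 \<subseteq> tog s R" using a sub unfolding tog_def by auto
  show "tog s R \<subseteq> tog s R0 \<union> cone (refl s p) (refl s q)"
  proof
    fix \<beta> assume "\<beta> \<in> tog s R"
    then obtain \<gamma> where g: "\<gamma> \<in> R" "\<gamma> \<noteq> simple_root s" "\<beta> = refl s \<gamma>"
      using a sub unfolding tog_def by (auto split: if_splits)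
    show "\<beta> \<in> tog s R0 \<union> cone (refl s p) (refl s q)"
    proof (cases "\<gamma> \<in> R0")
      case True
      then show ?thesis using g a unfolding tog_def by auto
    next
      case False
      then obtain x y where c: "\<gamma> \<in> PR" "0 \<le> x" "0 \<le> y" "\<gamma> = lin x p y q"
        using g sub unfolding cone_def by auto
      have "\<beta> \<in> PR" using PR_refl[OF s c(1) g(2)] g by simp
      then show ?thesis using c g refl_lin unfolding cone_def by auto
    qed
  qed
qed

lemma coneI: "\<beta> \<in> PR \<Longrightarrow> 0 \<le> a \<Longrightarrow> 0 \<le> b \<Longrightarrow> \<beta> = lin a p b q \<Longrightarrow> \<beta> \<in> cone p q"
  unfolding cone_def by blast

lemma cone_zero_left:
  assumes "p \<in> PR" "q \<in> PR" "\<beta> \<in> cone p q" "p t \<noteq> 0" "\<beta> t = 0"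
  shows "\<beta> = q"
proof -
  obtain a b where ab: "0 \<le> a" "0 \<le> b" "\<beta> = lin a p b q" "\<beta> \<in> PR"
    using assms(3) unfolding cone_def by auto
  have "a * p t + b * q t = 0" using ab(3) assms(5) by (simp add: lin_def)
  moreover have "0 \<le> a * p t" "0 \<le> b * q t" using ab PR_nonneg assms by auto
  ultimately have "a * p t = 0" by linarith
  then have "a = 0" using assms by simp
  then show ?thesis using lin_PR_0(2)[OF assms(2), of p b] ab by simp
qed

lemma cone_zero_right:
  assumes "p \<in> PR" "q \<in> PR" "\<beta> \<in> cone p q" "q t \<noteq> 0" "\<beta> t = 0"
  shows "\<beta> = p"
  using cone_zero_left[of q p \<beta> t] assms cone_comm by blast

lemma cone_zero_both:
  assumes "p t = 0" "q t = 0" "\<beta> \<in> cone p q"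
  shows "\<beta> t = 0"
  using assms unfolding cone_def by (auto simp: lin_def)

lemma par_insert: "par J (insert p R) = (if supp_in J p then insert p (par J R) else par J R)"
  by (auto simp: par_def)

lemma Wp_supp_iff: "R \<in> Wp (insert t J) \<Longrightarrow> t \<notin> J \<Longrightarrow> \<beta> \<in> R \<Longrightarrow> supp_in J \<beta> \<longleftrightarrow> \<beta> t = 0"
  using supp_in_insert WpD(2) by metis

text \<open>The upper branch reflects the polygon with bottom \<open>R0\<close>, the lower one cuts
  it with the hyperplane where the coordinate at \<open>t\<close> vanishes. Unless that hyperplane
  contains the whole plane, at most one boundary ray of the cone survives, so at most the bottom
  edge at \<open>p\<close> is left, which is contracted by assumption. \<open>R\<close> runs over
  the chain through \<open>insert p R0\<close> up to its last set without \<open>q\<close>.\<close>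

lemma poly_contract:
  assumes "R0 \<in> Wp (set cs)" "distinct cs \<and> set cs \<subseteq> S"
    and "insert p R0 \<in> Wp (set cs)" "q \<in> PR" "supp_in (set cs) q" "p \<notin> R0" "q \<notin> R0" "p \<noteq> q"
    and "R \<in> Wp (set cs)" "R0 \<subseteq> R" "R \<subseteq> R0 \<union> cone p q" "q \<notin> R"
    and "P cs R0 = P cs (insert p R0)"
  shows "P cs R = P cs R0"
  using assms
proof (induction cs R0 arbitrary: p q R rule: P_induct)
  case (Nil R0)
  then show ?case by simp
next
  case (above t cs R0)
  let ?a = "simple_root t"
  have p: "p \<in> PR" "p \<noteq> ?a" "q \<noteq> ?a"
    using above.prems above.hyps Wp_PR[OF above.prems(1)] by auto
  have aR: "?a \<in> R" "?a \<in> insert p R0" using above.prems above.hyps by auto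
  have W: "insert p R0 \<in> Wp (insert t (set cs))" "R \<in> Wp (insert t (set cs))"
    using above.prems by auto
  have J: "t \<in> insert t (set cs)" "insert t (set cs) \<subseteq> S" using above.hyps by auto
  have ins: "tog t (insert p R0) = insert (refl t p) (tog t R0)"
    using tog_insert above.hyps p by blast
  have c: "tog t R0 \<subseteq> tog t R \<and> tog t R \<subseteq> tog t R0 \<union> cone (refl t p) (refl t q)"
    by (rule tog_cone) (use above.prems above.hyps in auto)
  have ne: "refl t p \<noteq> refl t q" using above.prems(6) refl_refl[OF above.hyps(2)] by metis
  have "P (cs @ [t]) (tog t R) = P (cs @ [t]) (tog t R0)"
  proof (rule above.IH[of "refl t p" "refl t q"])
    show "insert (refl t p) (tog t R0) \<in> Wp (set (cs @ [t]))"
      using tog_Wp[OF W(1) J] ins by simp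
    show "refl t q \<in> PR" using PR_refl above.hyps above.prems p by blast
    show "supp_in (set (cs @ [t])) (refl t q)" using above.prems supp_in_refl by simp
    show "refl t p \<notin> tog t R0" "refl t q \<notin> tog t R0" "refl t q \<notin> tog t R"
      using above.prems above.hyps p aR PR_refl refl_PR_ne tog_mem[of t "refl t p"] tog_mem[of t "refl t q"] by auto
    show "tog t R \<in> Wp (set (cs @ [t]))" using tog_Wp[OF W(2) J] by simp
    show "P (cs @ [t]) (tog t R0) = P (cs @ [t]) (insert (refl t p) (tog t R0))"
      using P_above_eq_iff[OF above.hyps(5) W(1)] above.hyps aR above.prems(11) ins by auto
  qed (use c ne in auto)
  then show ?case
    using P_above_eq_iff[OF W(2) above.hyps(5) aR(1) above.hyps(6)] above.hyps by simp
next
  case (below t cs R0)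
  let ?a = "simple_root t"
  have pPR: "p \<in> PR" using Wp_PR[OF below.prems(1)] by auto
  have qPR: "q \<in> PR" using below.prems by auto
  have W: "insert p R0 \<in> Wp (insert t (set cs))" "R \<in> Wp (insert t (set cs))"
    using below.prems by auto
  \<comment> \<open>An initial simple root is never lost (\<open>P_mem_iff\<close>), so its edge
    could not be contracted.\<close>
  have pa: "p \<noteq> ?a"
  proof
    assume "p = ?a"
    then show False
      using P_mem_iff[of R0 t cs] P_mem_iff[of "insert p R0" t cs] below.hyps below.prems by auto
  qed
  have aR: "?a \<notin> R"
  proof
    assume "?a \<in> R"
    moreover from this have "?a \<in> cone p q" using below.hyps below.prems by auto
    ultimately show False using simple_cone[OF below.hyps(2) pPR qPR] pa below.prems by auto
  qed
  have e: "P (t # cs) R = P cs (par (set cs) R)" "P (t # cs) R0 = P cs (par (set cs) R0)"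
    "P (t # cs) (insert p R0) = P cs (par (set cs) (insert p R0))"
    using P_below aR pa below.hyps by auto
  have z: "supp_in (set cs) \<beta> \<longleftrightarrow> \<beta> t = 0" if "\<beta> \<in> R \<or> \<beta> = p \<or> \<beta> = q" for \<beta>
    using that Wp_supp_iff[OF W(2) below.hyps(1)] Wp_supp_iff[OF W(1) below.hyps(1), of p]
      supp_in_insert[OF below.hyps(1), of q] below.prems(3) by auto
  have sub: "par (set cs) R0 \<subseteq> par (set cs) R" using below.prems par_mono by blast
  show ?case
  proof (cases "p t = 0")
    case False
    \<comment> \<open>Only the ray of \<open>q\<close> can meet the hyperplane, and \<open>q\<close>
      is not in \<open>R\<close>.\<close>
    have "\<beta> \<in> R0" if b: "\<beta> \<in> par (set cs) R" for \<beta>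
    proof (rule ccontr)
      assume n: "\<beta> \<notin> R0"
      have bR: "\<beta> \<in> R" "\<beta> t = 0" using b z by (auto simp: par_def)
      then have "\<beta> \<in> cone p q" using n below.prems by auto
      then have "\<beta> = q" using cone_zero_left[OF pPR qPR _ False] bR by auto
      then show False using bR below.prems by auto
    qed
    then have "par (set cs) R = par (set cs) R0" using sub by (auto simp: par_def)
    then show ?thesis using e by simp
  next
    case pz: True
    have ip: "par (set cs) (insert p R0) = insert p (par (set cs) R0)" using z[of p] pz by (simp add: par_insert)
    show ?thesis
    proof (cases "q t = 0")
      case False
      have "\<beta> \<in> insert p R0" if b: "\<beta> \<in> par (set cs) R" for \<beta>
      proof (rule ccontr)
        assume n: "\<beta> \<notin> insert p R0"
        have bR: "\<beta> \<in> R" "\<beta> t = 0" using b z by (auto simp: par_def)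
        then have "\<beta> \<in> cone p q" using n below.prems by auto
        then have "\<beta> = p" using cone_zero_right[OF pPR qPR _ False] bR by auto
        then show False using n by auto
      qed
      then have "par (set cs) R \<subseteq> insert p (par (set cs) R0)" by (auto simp: par_def)
      then have "par (set cs) R = par (set cs) R0 \<or> par (set cs) R = insert p (par (set cs) R0)"
        using sub by auto
      then show ?thesis using e below.prems(11) ip by auto
    next
      case True
      have "P cs (par (set cs) R) = P cs (par (set cs) R0)"
      proof (rule below.IH[of p q])
        show "insert p (par (set cs) R0) \<in> Wp (set cs)"
          using par_Wp[OF WpD(1)[OF W(1)] below.hyps(4)] ip by simp
        show "supp_in (set cs) q" using z True by auto
        show "par (set cs) R \<in> Wp (set cs)" by (rule par_Wp[OF WpD(1)[OF W(2)] below.hyps(4)])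
        show "par (set cs) R \<subseteq> par (set cs) R0 \<union> cone p q" using below.prems by (auto simp: par_def)
        show "P cs (par (set cs) R0) = P cs (insert p (par (set cs) R0))"
          using e below.prems(11) ip by simp
      qed (use below.prems sub in \<open>auto simp: par_def\<close>)
      then show ?thesis using e by simp
    qed
  qed
qed

text \<open>The sign of \<open>euler cs \<tau> \<sigma>\<close> is carried unchanged to the first
  letter \<open>t\<close> of a lower branch that meets one of the roots. There
  \<open>\<tau> = simple_root t\<close> would give \<open>\<sigma> t > 0\<close>, so restriction
  would lose \<open>\<sigma>\<close> and contract its edge; and
  \<open>\<sigma> = simple_root t\<close> with \<open>\<tau> t = 0\<close> would make the form
  nonpositive. What remains is that restriction loses one root, and it cannot be
  \<open>\<sigma>\<close> alone.\<close>

lemma poly_bottom: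
  assumes "R0 \<in> Wp (set cs)" "distinct cs \<and> set cs \<subseteq> S"
    and "insert \<sigma> R0 \<in> Wp (set cs)" "insert \<tau> R0 \<in> Wp (set cs)" "\<sigma> \<notin> R0" "\<tau> \<notin> R0" "\<sigma> \<noteq> \<tau>"
    and "euler cs \<tau> \<sigma> > 0" and "P cs R0 \<noteq> P cs (insert \<sigma> R0)"
  shows "P cs R0 = P cs (insert \<tau> R0)"
  using assms
proof (induction cs R0 arbitrary: \<sigma> \<tau> rule: P_induct)
  case (Nil R0)
  then show ?case by simp
next
  case (above t cs R0)
  let ?a = "simple_root t"
  have p: "\<sigma> \<in> PR" "\<sigma> \<noteq> ?a" "\<tau> \<in> PR" "\<tau> \<noteq> ?a"
    using above.prems above.hyps Wp_PR[OF above.prems(1)] Wp_PR[OF above.prems(2)] by auto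
  have W: "insert \<sigma> R0 \<in> Wp (insert t (set cs))" "insert \<tau> R0 \<in> Wp (insert t (set cs))"
    using above.prems by auto
  have J: "t \<in> insert t (set cs)" "insert t (set cs) \<subseteq> S" using above.hyps by auto
  have ins: "tog t (insert \<sigma> R0) = insert (refl t \<sigma>) (tog t R0)" "tog t (insert \<tau> R0) = insert (refl t \<tau>) (tog t R0)"
    using tog_insert above.hyps p by blast+
  have ne: "refl t \<sigma> \<noteq> refl t \<tau>" using above.prems(5) refl_refl[OF above.hyps(2)] by metis
  have "P (cs @ [t]) (tog t R0) = P (cs @ [t]) (insert (refl t \<tau>) (tog t R0))"
  proof (rule above.IH[of "refl t \<sigma>" "refl t \<tau>"])
    show "insert (refl t \<sigma>) (tog t R0) \<in> Wp (set (cs @ [t]))" "insert (refl t \<tau>) (tog t R0) \<in> Wp (set (cs @ [t]))"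
      using tog_Wp[OF W(1) J] tog_Wp[OF W(2) J] ins by simp_all
    show "refl t \<sigma> \<notin> tog t R0" "refl t \<tau> \<notin> tog t R0"
      using above.prems above.hyps p PR_refl refl_PR_ne tog_mem[of t "refl t \<sigma>"] tog_mem[of t "refl t \<tau>"] by auto
    show "P (cs @ [t]) (tog t R0) \<noteq> P (cs @ [t]) (insert (refl t \<sigma>) (tog t R0))"
      using P_above_eq_iff[OF above.hyps(5) W(1)] above.hyps above.prems(7) ins by auto
    have "euler (cs @ [t]) (refl t \<tau>) (refl t \<sigma>) = euler (t # cs) \<tau> \<sigma>"
      by (rule euler_rotate) (use above.hyps W WpD(2) in auto)
    then show "0 < euler (cs @ [t]) (refl t \<tau>) (refl t \<sigma>)" using above.prems by simp
  qed (use ne in auto)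
  then show ?case
    using P_above_eq_iff[OF above.hyps(5) W(2) above.hyps(6)] above.hyps ins by simp
next
  case (below t cs R0)
  let ?a = "simple_root t"
  have p: "\<sigma> \<in> PR" "\<tau> \<in> PR" using Wp_PR[OF below.prems(1)] Wp_PR[OF below.prems(2)] by auto
  have W: "insert \<sigma> R0 \<in> Wp (insert t (set cs))" "insert \<tau> R0 \<in> Wp (insert t (set cs))"
    using below.prems by auto
  have z: "supp_in (set cs) \<sigma> \<longleftrightarrow> \<sigma> t = 0" "supp_in (set cs) \<tau> \<longleftrightarrow> \<tau> t = 0"
    using Wp_supp_iff[OF W(1) below.hyps(1)] Wp_supp_iff[OF W(2) below.hyps(1)] by auto
  have e0: "P (t # cs) R0 = P cs (par (set cs) R0)" using P_below below.hyps by auto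
  have es: "\<sigma> \<noteq> ?a \<Longrightarrow> P (t # cs) (insert \<sigma> R0) = P cs (if \<sigma> t = 0 then insert \<sigma> (par (set cs) R0) else par (set cs) R0)"
    using P_below[of t "insert \<sigma> R0" cs] below.hyps z by (auto simp: par_insert)
  have et: "\<tau> \<noteq> ?a \<Longrightarrow> P (t # cs) (insert \<tau> R0) = P cs (if \<tau> t = 0 then insert \<tau> (par (set cs) R0) else par (set cs) R0)"
    using P_below[of t "insert \<tau> R0" cs] below.hyps z by (auto simp: par_insert)
  have \<tau>a: "\<tau> \<noteq> ?a"
  proof
    assume t: "\<tau> = ?a"
    then have "\<sigma> t > 0" using below.prems(6) euler_initial[OF below.hyps(1)] by (simp del: euler.simps)
    then show False using es e0 below.prems t by auto
  qed
  show ?case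
  proof (cases "\<tau> t = 0")
    case False
    then show ?thesis using et e0 \<tau>a by simp
  next
    case True
    have \<sigma>a: "\<sigma> \<noteq> ?a"
    proof
      assume "\<sigma> = ?a"
      then show False
        using euler_initial_nonpos[of t cs \<tau>] below.hyps below.prems True PR_vpos[OF p(2)] by auto
    qed
    then have sz: "\<sigma> t = 0" using es e0 below.prems by (auto split: if_splits)
    have "P cs (par (set cs) R0) = P cs (insert \<tau> (par (set cs) R0))"
    proof (rule below.IH[of \<sigma> \<tau>])
      show "insert \<sigma> (par (set cs) R0) \<in> Wp (set cs)" "insert \<tau> (par (set cs) R0) \<in> Wp (set cs)"
        using par_Wp[OF WpD(1)[OF W(1)] below.hyps(4)] par_Wp[OF WpD(1)[OF W(2)] below.hyps(4)] z sz True
        by (auto simp: par_insert)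
      show "0 < euler cs \<tau> \<sigma>" using below.prems(6) True sz by simp
      show "P cs (par (set cs) R0) \<noteq> P cs (insert \<sigma> (par (set cs) R0))"
        using es e0 \<sigma>a sz below.prems by simp
    qed (use below.prems in \<open>auto simp: par_def\<close>)
    then show ?thesis using et e0 \<tau>a True by simp
  qed
qed

section \<open>Monotonicity of the projection\<close>

text \<open>All words are quantified because toggling rotates the word. The bound counts the larger
  set, which loses a root in the upper branch.\<close>

definition mono_upto :: "nat \<Rightarrow> bool" where
  "mono_upto n \<longleftrightarrow> (\<forall>cs R R'. distinct cs \<longrightarrow> set cs \<subseteq> S \<longrightarrow> R \<in> Wp (set cs) \<longrightarrow> R' \<in> Wp (set cs) \<longrightarrow>
     R \<subseteq> R' \<longrightarrow> card R' < n \<longrightarrow> P cs R \<subseteq> P cs R')"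

lemma mono_uptoD: "mono_upto n \<Longrightarrow> distinct cs \<Longrightarrow> set cs \<subseteq> S \<Longrightarrow> R \<in> Wp (set cs) \<Longrightarrow> R' \<in> Wp (set cs) \<Longrightarrow>
     R \<subseteq> R' \<Longrightarrow> card R' < n \<Longrightarrow> P cs R \<subseteq> P cs R'"
  unfolding mono_upto_def by blast

text \<open>The singleton \<open>{simple_root s}\<close> is fixed by \<open>P cs\<close>, so
  monotonicity places it inside the image of the upper end.\<close>

lemma simple_keep:
  assumes m: "mono_upto n" and s: "s \<in> set cs" and cs: "distinct cs" "set cs \<subseteq> S"
    and R: "R0 \<in> Wp (set cs)" "insert (simple_root s) R0 \<in> Wp (set cs)" "simple_root s \<notin> R0"
    and n: "card (insert (simple_root s) R0) < n"
  shows "P cs R0 \<noteq> P cs (insert (simple_root s) R0)"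
proof -
  have "{simple_root s} \<in> Wp (set cs)" by (rule Wp_sub[OF R(2)]) (use simple_W s cs in auto)
  then have "P cs {simple_root s} \<subseteq> P cs (insert (simple_root s) R0)"
    using mono_uptoD[OF m cs _ R(2) _ n] by blast
  then have "simple_root s \<in> P cs (insert (simple_root s) R0)" using P_simple[OF s cs] by auto
  moreover have "simple_root s \<notin> P cs R0" using P_le[OF R(1) cs] R(3) by blast
  ultimately show ?thesis by auto
qed

text \<open>The lower-branch value \<open>?X\<close> at \<open>R1\<close> is fixed by the rotated
  word too. If the rotated word contracted the edge, \<open>?X\<close> would lie in its value at
  \<open>R0\<close>, hence in \<open>R0\<close>, and then in the lower-branch value at
  \<open>R0\<close>.\<close>

lemma rot_keep:
  assumes m: "mono_upto n" and t: "t \<notin> set cs" "t \<in> S" and cs: "distinct cs" "set cs \<subseteq> S"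
    and R: "R0 \<in> Wp (insert t (set cs))" "R1 \<in> Wp (insert t (set cs))" "R0 \<subseteq> R1" "simple_root t \<notin> R1"
    and n: "card R1 < n" and ne: "P (t # cs) R0 \<noteq> P (t # cs) R1"
  shows "P (cs @ [t]) R0 \<noteq> P (cs @ [t]) R1"
proof
  assume eq: "P (cs @ [t]) R0 = P (cs @ [t]) R1"
  let ?p = "par (set cs)"
  have Wp: "?p R0 \<in> Wp (set cs)" "?p R1 \<in> Wp (set cs)" using par_Wp WpD(1) R cs by blast+
  let ?X = "P cs (?p R1)"
  have X: "?X \<in> Wp (set cs)" "?X \<subseteq> ?p R1" "P cs ?X = ?X"
    using P_Wp[OF Wp(2) cs] P_le[OF Wp(2) cs] P_idem[OF Wp(2) cs] by auto
  have fin: "finite R1" by (rule W_finite[OF WpD(1)[OF R(2)]])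
  have c: "card (?p R0) < n" "card (?p R1) < n"
    using card_mono[OF fin, of "?p R1"] card_mono[OF fin, of "?p R0"] par_subset[of "set cs"] R(3) n by (meson le_less_trans order_trans)+
  have d: "distinct (cs @ [t])" "set (cs @ [t]) \<subseteq> S" using t cs by auto
  have R': "R0 \<in> Wp (set (cs @ [t]))" "R1 \<in> Wp (set (cs @ [t]))" using R by auto
  have "P (cs @ [t]) ?X \<subseteq> P (cs @ [t]) R1"
    by (rule mono_uptoD[OF m d _ R'(2) _ n])
      (use X par_subset[of "set cs" R1] Wp_mono[OF X(1), of "set (cs @ [t])"] in auto)
  moreover have "P (cs @ [t]) ?X = ?X" using P_snoc[OF X(1) cs t] X(3) by simp
  ultimately have "?X \<subseteq> R0" using eq P_le[OF R'(1) d] by auto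
  then have "?X \<subseteq> ?p R0" using X(2) by (auto simp: par_def)
  then have "P cs ?X \<subseteq> P cs (?p R0)" by (rule mono_uptoD[OF m cs X(1) Wp(1) _ c(1)])
  then have "?X \<subseteq> P cs (?p R0)" using X(3) by simp
  moreover have "P cs (?p R0) \<subseteq> ?X"
    by (rule mono_uptoD[OF m cs Wp par_mono[OF R(3)] c(2)])
  ultimately show False using ne R P_below[of t R0 cs] P_below[of t R1 cs] by auto
qed

lemma euler_initial_orth:
  assumes t: "t \<notin> set cs" "set (t # cs) \<subseteq> S" and p: "p \<in> PR" "supp_in (set (t # cs)) p" "p t = 0"
    and e: "0 \<le> euler (t # cs) p (simple_root t)"
  shows "refl t p = p"
proof -
  have "euler (t # cs) p (simple_root t) = 0"
    using euler_initial_nonpos[OF t PR_vpos[OF p(1)] p(3)] e by linarith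
  then have "(\<Sum>r\<in>set cs. A r t * p r) = 0" using p(3) by (simp add: euler_initial_right[OF t(1)] del: euler.simps)
  then have "coroot t p = 0" using coroot_supp[OF t p(2)] p(3) sum_A_sym[OF t(2), of p] by simp
  then show ?thesis by (simp add: refl_def)
qed

text \<open>If both bottom edges of a polygon are kept and \<open>euler p q \<ge> 0\<close>, the edges of the chain through
  \<open>insert p R0\<close> are kept. When the recursion reaches \<open>simple_root t = p\<close>, reflecting turns this chain into
  the one starting with \<open>q\<close>, shortened by one edge.\<close>

lemma poly_keep:
  assumes "R \<in> Wp (set cs)" "distinct cs \<and> set cs \<subseteq> S" and m: "mono_upto n"
    and "R0 \<in> Wp (set cs)" "insert p R0 \<in> Wp (set cs)" "insert q R0 \<in> Wp (set cs)" "p \<notin> R0" "q \<notin> R0" "p \<noteq> q"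
    and "insert r R \<in> Wp (set cs)" "R0 \<subseteq> R" "insert r R \<subseteq> R0 \<union> cone p q" "r \<notin> R" "q \<notin> insert r R"
    and "card (insert r R) < n" "0 \<le> euler cs p q" "\<exists>a>0. \<exists>b>0. lin a p b q \<in> PR"
    and "P cs R0 \<noteq> P cs (insert p R0)" "P cs R0 \<noteq> P cs (insert q R0)"
  shows "P cs R \<noteq> P cs (insert r R)"
  using assms
proof (induction cs R arbitrary: R0 p q r rule: P_induct)
  case (Nil R)
  then show ?case by simp
next
  case (above t cs R)
  let ?a = "simple_root t"
  let ?J = "insert t (set cs)"
  note pr = above.prems(2-)
  have W: "R0 \<in> Wp ?J" "insert p R0 \<in> Wp ?J" "insert q R0 \<in> Wp ?J" "insert r R \<in> Wp ?J"
    using pr by auto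
  have J: "t \<in> ?J" "?J \<subseteq> S" using above.hyps by auto
  have PRs: "p \<in> PR" "q \<in> PR" "r \<in> PR" using Wp_PR[OF W(2)] Wp_PR[OF W(3)] Wp_PR[OF W(4)] by auto
  have ra: "r \<noteq> ?a" using pr above.hyps by auto
  have insr: "tog t (insert r R) = insert (refl t r) (tog t R)" using tog_insert above.hyps ra by blast
  have rn: "refl t r \<notin> tog t R"
    using tog_mem[of t "refl t r" R] above.hyps PRs ra PR_refl refl_PR_ne pr by auto
  have Wr: "insert (refl t r) (tog t R) \<in> Wp (set (cs @ [t]))"
    using tog_Wp[OF W(4) J] insr by simp
  have fin: "finite (insert r R)" by (rule W_finite[OF WpD(1)[OF W(4)]])
  have cn: "card (tog t (insert r R)) < card (insert r R)"
    by (rule card_tog_less) (use fin above.hyps in auto)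
  have goal: "P (cs @ [t]) (tog t R) \<noteq> P (cs @ [t]) (insert (refl t r) (tog t R)) \<Longrightarrow> ?case"
    using P_above_eq_iff[OF above.hyps(5) W(4) above.hyps(6)] above.hyps insr by auto
  show ?case
  proof (cases "?a \<in> R0")
    case True
    have ne: "p \<noteq> ?a" "q \<noteq> ?a" using True pr by auto
    have ins: "tog t (insert p R0) = insert (refl t p) (tog t R0)" "tog t (insert q R0) = insert (refl t q) (tog t R0)"
      using tog_insert above.hyps ne True by blast+
    have c: "tog t R0 \<subseteq> tog t R" "tog t (insert r R) \<subseteq> tog t R0 \<union> cone (refl t p) (refl t q)"
      using tog_cone[OF above.hyps(2) True, of "insert r R" p q] tog_cone[OF above.hyps(2) True, of R p q] pr by auto
    have ni: "refl t p \<notin> tog t R0" "refl t q \<notin> tog t R0" "refl t q \<notin> tog t (insert r R)"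
      using pr above.hyps PRs ne PR_refl refl_PR_ne tog_mem[of t "refl t p"] tog_mem[of t "refl t q"] by auto
    show ?thesis
    proof (rule goal, rule above.IH[of "tog t R0" "refl t p" "refl t q" "refl t r"])
      show "mono_upto n" by fact
      show "tog t R0 \<in> Wp (set (cs @ [t]))" using tog_Wp[OF W(1) J] by simp
      show "insert (refl t p) (tog t R0) \<in> Wp (set (cs @ [t]))" "insert (refl t q) (tog t R0) \<in> Wp (set (cs @ [t]))"
        using tog_Wp[OF W(2) J] tog_Wp[OF W(3) J] ins by simp_all
      show "refl t p \<noteq> refl t q" using pr(6) refl_refl[OF above.hyps(2)] by metis
      show "0 \<le> euler (cs @ [t]) (refl t p) (refl t q)"
      proof -
        have "euler (cs @ [t]) (refl t p) (refl t q) = euler (t # cs) p q"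
          by (rule euler_rotate) (use above.hyps W WpD(2) in auto)
        then show ?thesis using pr by simp
      qed
      show "\<exists>a>0. \<exists>b>0. lin a (refl t p) b (refl t q) \<in> PR"
      proof -
        obtain a b where ab: "a > 0" "b > 0" "lin a p b q \<in> PR" using pr(14) by auto
        have "?a \<noteq> lin a p b q"
          using simple_extremal[OF above.hyps(2) PRs(1,2), of a b] ab ne by auto
        then have "refl t (lin a p b q) \<in> PR" using PR_refl[OF above.hyps(2) ab(3)] by auto
        then show ?thesis using ab by (auto simp: refl_lin)
      qed
      show "P (cs @ [t]) (tog t R0) \<noteq> P (cs @ [t]) (insert (refl t p) (tog t R0))"
        using P_above_eq_iff[OF W(1) W(2)] above.hyps True pr ins by auto
      show "P (cs @ [t]) (tog t R0) \<noteq> P (cs @ [t]) (insert (refl t q) (tog t R0))"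
        using P_above_eq_iff[OF W(1) W(3)] above.hyps True pr ins by auto
      show "card (insert (refl t r) (tog t R)) < n" using cn insr pr by simp
      show "insert (refl t r) (tog t R) \<in> Wp (set (cs @ [t]))" by (rule Wr)
      show "refl t q \<notin> insert (refl t r) (tog t R)" using ni(3) insr by simp
      show "insert (refl t r) (tog t R) \<subseteq> tog t R0 \<union> cone (refl t p) (refl t q)" using c insr by simp
    qed (use ni rn c in auto)
  next
    case False
    \<comment> \<open>The recursion has reached a root of the polygon: \<open>?a\<close> is extreme
      in the cone, and \<open>q\<close> is not on this chain.\<close>
    have "?a \<in> cone p q" using False above.hyps(6) pr(9) by auto
    then have pa: "p = ?a" using simple_cone[OF above.hyps(2) PRs(1,2)] above.hyps(6) pr by auto
    have Ws: "R0 \<in> W" "insert ?a R0 \<in> W" "insert q R0 \<in> W" using W WpD(1) pa by auto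
    have inv: "refl t ` R0 = R0" by (rule refl_invariant[OF above.hyps(2) Ws(1,2) False])
    have tR: "tog t R = refl t ` (R - {?a})" using above.hyps by (simp add: tog_def)
    have sub0: "R0 \<subseteq> tog t R"
    proof -
      have "refl t ` R0 \<subseteq> refl t ` (R - {?a})" using pr False by auto
      then show ?thesis using inv tR by simp
    qed
    have qn: "q \<notin> insert r R" "q \<noteq> ?a" using pr pa by auto
    have cone: "insert (refl t r) (tog t R) \<subseteq> R0 \<union> cone q ?a"
    proof
      fix \<beta> assume "\<beta> \<in> insert (refl t r) (tog t R)"
      then obtain \<gamma> where g: "\<gamma> \<in> insert r R" "\<gamma> \<noteq> ?a" "\<beta> = refl t \<gamma>" using tR ra by auto
      show "\<beta> \<in> R0 \<union> cone q ?a"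
      proof (cases "\<gamma> \<in> R0")
        case True
        then show ?thesis using g inv by auto
      next
        case False
        then obtain x y where c: "\<gamma> \<in> PR" "0 \<le> x" "0 \<le> y" "\<gamma> = lin x ?a y q"
          using g pr(9) pa unfolding cone_def by auto
        have bP: "\<beta> \<in> PR" using PR_refl[OF above.hyps(2) c(1) g(2)] g by simp
        have e: "\<beta> = lin (- x - y * coroot t q) ?a y q"
          unfolding g(3) c(4) refl_lin refl_simple[OF above.hyps(2)]
          by (auto simp: lin_def refl_eq_lin[of t q] algebra_simps)
        \<comment> \<open>The reflected root is positive and lies in the plane of \<open>?a\<close>
          and \<open>q\<close>, so its coefficients cannot be negative.\<close>
        have "0 \<le> - x - y * coroot t q \<and> 0 \<le> y"
          by (rule plane_cone[OF Ws]) (use False pr pa bP e \<open>simple_root t \<notin> R0\<close> in auto)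
        then have "\<beta> \<in> cone q ?a"
          using coneI[OF bP, of y "- x - y * coroot t q" q ?a] e lin_comm by metis
        then show ?thesis by simp
      qed
    qed
    have pn: "?a \<notin> insert (refl t r) (tog t R)"
      using tog_mem_simple[of t "insert r R"] above.hyps Wp_PR[OF W(4)] insr by auto
    \<comment> \<open>The edge at \<open>q\<close> avoids \<open>?a\<close>, so it is kept in the
      lower branch; this is transferred to the rotated word.\<close>
    have qa: "P (cs @ [t]) R0 \<noteq> P (cs @ [t]) (insert q R0)"
    proof (rule rot_keep[OF m above.hyps(1-4) W(1) W(3)])
      have "card (insert q R0) \<le> card (insert r R)"
      proof -
        have "card (insert q R0) = Suc (card R0)" using pr W_finite[OF Ws(1)] by simp
        moreover have "card R0 < card (insert r R)"
          by (rule psubset_card_mono) (use fin pr in auto)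
        ultimately show ?thesis by simp
      qed
      then show "card (insert q R0) < n" using pr by simp
      show "?a \<notin> insert q R0" using False qn by auto
    qed (use pr in auto)
    show ?thesis
    proof (rule goal, rule above.IH[of R0 q ?a "refl t r"])
      show "mono_upto n" by fact
      show "R0 \<in> Wp (set (cs @ [t]))" "insert q R0 \<in> Wp (set (cs @ [t]))" "insert ?a R0 \<in> Wp (set (cs @ [t]))"
        using W pa by auto
      show "insert (refl t r) (tog t R) \<in> Wp (set (cs @ [t]))" by (rule Wr)
      show "card (insert (refl t r) (tog t R)) < n" using cn insr pr by simp
      \<comment> \<open>For the swapped pair the form against the last letter is the coordinate of
        \<open>q\<close> at \<open>t\<close>, so the sign condition renews itself.\<close>
      show "0 \<le> euler (cs @ [t]) q ?a" using euler_final[of t cs q] above.hyps PR_nonneg[OF PRs(2)] by simp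
      show "\<exists>a>0. \<exists>b>0. lin a q b ?a \<in> PR" using pr(14) pa lin_comm by metis
      show "P (cs @ [t]) R0 \<noteq> P (cs @ [t]) (insert ?a R0)"
      proof (rule simple_keep[OF m])
        have "card (insert ?a R0) \<le> card (insert r R)"
          by (rule card_mono) (use fin pr above.hyps in auto)
        then show "card (insert ?a R0) < n" using pr by simp
      qed (use W pa False above.hyps in auto)
    qed (use pr False rn sub0 cone pn qa qn in auto)
  qed
next
  case (below t cs R)
  let ?a = "simple_root t"
  let ?J = "insert t (set cs)"
  note pr = below.prems(2-)
  have W: "R0 \<in> Wp ?J" "insert p R0 \<in> Wp ?J" "insert q R0 \<in> Wp ?J" "insert r R \<in> Wp ?J" "R \<in> Wp ?J"
    using pr below.hyps by auto
  have PRs: "p \<in> PR" "q \<in> PR" "r \<in> PR" using Wp_PR[OF W(2)] Wp_PR[OF W(3)] Wp_PR[OF W(4)] by auto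
  have c: "distinct (t # cs)" "set (t # cs) \<subseteq> S" using below.hyps by auto
  show ?case
  proof (cases "r = ?a")
    case True
    then show ?thesis using P_mem_iff[of R t cs] P_mem_iff[of "insert r R" t cs] W below.hyps by auto
  next
    case ra: False
    have aR0: "?a \<notin> R0" using below.hyps pr by auto
    have z: "supp_in (set cs) p \<longleftrightarrow> p t = 0" "supp_in (set cs) q \<longleftrightarrow> q t = 0" "supp_in (set cs) r \<longleftrightarrow> r t = 0"
      using Wp_supp_iff[OF W(2) below.hyps(1), of p] Wp_supp_iff[OF W(3) below.hyps(1), of q]
        Wp_supp_iff[OF W(4) below.hyps(1), of r] by auto
    have e: "P (t # cs) R0 = P cs (par (set cs) R0)" "P (t # cs) R = P cs (par (set cs) R)"
      "P (t # cs) (insert r R) = P cs (par (set cs) (insert r R))"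
      using P_below aR0 ra below.hyps by auto
    \<comment> \<open>Coconvexity puts one of \<open>p\<close>, \<open>q\<close> into
      \<open>insert r R\<close>; \<open>q\<close> is excluded there, and so is
      \<open>?a\<close>.\<close>
    have pa: "p \<noteq> ?a"
    proof
      assume p: "p = ?a"
      show False
      proof (cases "r \<in> R0")
        case True
        then show False using pr by auto
      next
        case False
        then have "r \<in> cone p q" using pr by auto
        then have "p \<in> insert r R \<or> q \<in> insert r R"
          using coconvex_cone[OF WpD(1)[OF W(4)] PRs(1,2)] by auto
        then show False using p ra below.hyps pr by auto
      qed
    qed
    have ep: "P (t # cs) (insert p R0) = P cs (par (set cs) (insert p R0))"
      using P_below[of t "insert p R0"] aR0 pa by auto
    \<comment> \<open>A nonzero coordinate would make restriction drop \<open>p\<close> and contract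
      its bottom edge.\<close>
    have pz: "p t = 0" using ep e pr z by (auto simp: par_insert split: if_splits)
    \<comment> \<open>This is where the interior root enters: the sign condition makes
      \<open>p\<close> orthogonal to \<open>?a\<close>, so reflecting \<open>lin a p b ?a\<close>
      would give a positive root with coordinate \<open>- b\<close> at \<open>t\<close>.\<close>
    have qa: "q \<noteq> ?a"
    proof
      assume q: "q = ?a"
      have "refl t p = p"
        by (rule euler_initial_orth[OF below.hyps(1) c(2) PRs(1)]) (use pz pr q W WpD(2) in auto)
      moreover obtain a b where ab: "a > 0" "b > 0" "lin a p b ?a \<in> PR" using pr(14) q by auto
      moreover have "lin a p b ?a \<noteq> ?a"
      proof
        assume eq: "lin a p b ?a = ?a"
        have "p i = 0" if "i \<noteq> t" for i using fun_cong[OF eq, of i] that ab by (simp add: lin_def)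
        then have "p = ?a" by (rule PR_only_simple[OF below.hyps(2) PRs(1)])
        then show False using pa by simp
      qed
      ultimately have "refl t (lin a p b ?a) \<in> PR" using PR_refl[OF below.hyps(2)] by blast
      then have "0 \<le> refl t (lin a p b ?a) t" by (rule PR_nonneg)
      moreover have "refl t (lin a p b ?a) = lin a p b (\<lambda>r. - ?a r)"
        by (simp only: refl_lin refl_simple[OF below.hyps(2)] \<open>refl t p = p\<close>)
      ultimately have "0 \<le> a * p t - b" by (simp add: lin_def)
      then show False using pz ab by simp
    qed
    have eq: "P (t # cs) (insert q R0) = P cs (par (set cs) (insert q R0))"
      using P_below[of t "insert q R0"] aR0 qa by auto
    have qz: "q t = 0" using eq e pr z by (auto simp: par_insert split: if_splits)
    have rz: "r t = 0"
    proof (cases "r \<in> R0")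
      case True
      then show ?thesis using pr by auto
    next
      case False
      then show ?thesis using cone_zero_both[of p t q r] pz qz pr by auto
    qed
    have ins: "par (set cs) (insert p R0) = insert p (par (set cs) R0)" "par (set cs) (insert q R0) = insert q (par (set cs) R0)"
      "par (set cs) (insert r R) = insert r (par (set cs) R)"
      using pz qz rz z by (auto simp: par_insert)
    note pw = par_Wp[OF WpD(1) below.hyps(4)]
    have fin: "finite (insert r R)" by (rule W_finite[OF WpD(1)[OF W(4)]])
    show ?thesis unfolding e ins
    proof (rule below.IH[of "par (set cs) R0" p q r])
      show "mono_upto n" by fact
      show "par (set cs) R0 \<in> Wp (set cs)" "insert p (par (set cs) R0) \<in> Wp (set cs)"
        "insert q (par (set cs) R0) \<in> Wp (set cs)" "insert r (par (set cs) R) \<in> Wp (set cs)"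
        using pw[OF W(1)] pw[OF W(2)] pw[OF W(3)] pw[OF W(4)] ins by auto
      have "card (insert r (par (set cs) R)) \<le> card (insert r R)"
        by (rule card_mono) (use fin par_subset in auto)
      then show "card (insert r (par (set cs) R)) < n" using pr by simp
      show "0 \<le> euler cs p q" using pr(13) pz qz by simp
    qed (use pr e ep eq ins in \<open>auto simp: par_def\<close>)
  qed
qed


section \<open>Extremal sets below a bound\<close>

lemma maximal_W:
  assumes "finite U" "\<And>X. Q X \<Longrightarrow> X \<subseteq> U" "Q X0"
  obtains M where "Q M" "\<And>X. Q X \<Longrightarrow> M \<subseteq> X \<Longrightarrow> X = M"
proof -
  have "finite {X. Q X}" by (rule finite_subset[of _ "Pow U"]) (use assms in auto)
  from finite_has_maximal2[OF this, of X0] assms(3)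
  obtain M where M: "Q M" "\<forall>X\<in>{X. Q X}. M \<subseteq> X \<longrightarrow> M = X" by auto
  show thesis by (rule that[of M]) (use M in auto)
qed

lemma minimal_W:
  assumes "finite U" "\<And>X. Q X \<Longrightarrow> X \<subseteq> U" "Q X0"
  obtains M where "Q M" "\<And>X. Q X \<Longrightarrow> X \<subseteq> M \<Longrightarrow> X = M"
proof -
  have "finite {X. Q X}" by (rule finite_subset[of _ "Pow U"]) (use assms in auto)
  from finite_has_minimal2[OF this, of X0] assms(3)
  obtain M where M: "Q M" "\<forall>X\<in>{X. Q X}. X \<subseteq> M \<longrightarrow> M = X" by auto
  show thesis by (rule that[of M]) (use M in auto)
qed

text \<open>A maximal member avoiding \<open>p\<close> still has a cover below \<open>U\<close>, and
  by maximality the root added there is \<open>p\<close>.\<close>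

lemma maximal_avoiding:
  assumes R: "R \<in> W" "R \<subseteq> U" "p \<notin> R" and U: "U \<in> W" "p \<in> U"
  obtains H where "H \<in> W" "R \<subseteq> H" "p \<notin> H" "insert p H \<in> W" "insert p H \<subseteq> U"
proof -
  obtain H where H: "H \<in> W \<and> R \<subseteq> H \<and> H \<subseteq> U \<and> p \<notin> H"
    and max: "\<And>X. X \<in> W \<and> R \<subseteq> X \<and> X \<subseteq> U \<and> p \<notin> X \<Longrightarrow> H \<subseteq> X \<Longrightarrow> X = H"
    by (rule maximal_W[OF W_finite[OF U(1)], of "\<lambda>X. X \<in> W \<and> R \<subseteq> X \<and> X \<subseteq> U \<and> p \<notin> X" R]) (use R in auto)
  have "H \<subset> U" using H U by auto
  then obtain \<beta> where b: "\<beta> \<in> U - H" "insert \<beta> H \<in> W" using W_up[OF _ U(1)] H by blast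
  have "\<beta> = p"
  proof (rule ccontr)
    assume "\<beta> \<noteq> p"
    then have "insert \<beta> H = H" using max[of "insert \<beta> H"] H b by auto
    then show False using b by auto
  qed
  then show thesis using that H b U by auto
qed

text \<open>Minimality of \<open>insert (simple_root s) Rb\<close> above \<open>Y\<close> forces \<open>Y = Rb\<close>: otherwise a contracted edge
  below \<open>Rb\<close> lies on the chain of a polygon with canonical root \<open>simple_root s\<close>.\<close>

lemma saturated:
  assumes m: "mono_upto n" and s: "s \<notin> set cs" "s \<in> S" and cs: "distinct cs" "set cs \<subseteq> S"
    and Rb: "Rb \<in> Wp (insert s (set cs))" and a: "simple_root s \<notin> Rb"
    and Rw: "insert (simple_root s) Rb \<in> Wp (insert s (set cs))"
    and n: "card (insert (simple_root s) Rb) \<le> n"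
    and Y: "Y = P (cs @ [s]) Rb"
    and min: "\<And>R. R \<in> W \<Longrightarrow> Y \<subseteq> R \<Longrightarrow> simple_root s \<in> R \<Longrightarrow> R \<subseteq> insert (simple_root s) Rb \<Longrightarrow> R = insert (simple_root s) Rb"
  shows "Y = Rb"
proof (rule ccontr)
  let ?a = "simple_root s" and ?c = "cs @ [s]"
  let ?Rw = "insert ?a Rb"
  assume ne: "Y \<noteq> Rb"
  have c: "distinct ?c" "set ?c \<subseteq> S" and J: "set ?c = insert s (set cs)" using s cs by auto
  have Rb': "Rb \<in> Wp (set ?c)" and Rw': "?Rw \<in> Wp (set ?c)" using Rb Rw by auto
  have RbW: "Rb \<in> W" and RwW: "?Rw \<in> W" using Rb Rw WpD(1) by auto
  have YWp: "Y \<in> Wp (set ?c)" and YRb: "Y \<subseteq> Rb" and YY: "P ?c Y = Y"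
    unfolding Y by (rule P_Wp[OF Rb' c], rule P_le[OF Rb' c], rule P_idem[OF Rb' c])
  obtain k where k: "k \<in> Rb" "k \<notin> Y" "Rb - {k} \<in> W"
    using W_down[OF WpD(1)[OF YWp] RbW] YRb ne by auto
  define R1 where "R1 = Rb - {k}"
  have R1: "R1 \<in> W" "Y \<subseteq> R1" "k \<notin> R1" "insert k R1 = Rb" "R1 \<subseteq> Rb"
    using k YRb by (auto simp: R1_def)
  \<comment> \<open>The polygon contains the edge at \<open>k\<close> below \<open>Rb\<close> and
    the edge at \<open>?a\<close> above it. As an extreme ray, \<open>?a\<close> must be one of its
    two bottom roots.\<close>
  have "\<exists>R0 p q. R0 \<in> W \<and> insert p R0 \<in> W \<and> insert q R0 \<in> W \<and> p \<notin> R0 \<and> q \<notin> R0 \<and> p \<noteq> q \<and>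
          R0 \<subseteq> Rb \<inter> R1 \<inter> ?Rw \<and> Rb \<union> R1 \<union> ?Rw \<subseteq> R0 \<union> {\<beta> \<in> PR. \<exists>a\<ge>0. \<exists>b\<ge>0. \<beta> = lin a p b q}"
  proof (rule W_polygon[OF RbW R1(1) RwW])
    show "R1 \<noteq> ?Rw" using R1 a by auto
    show "\<exists>\<beta>. \<beta> \<notin> Rb \<inter> R1 \<and> (R1 = insert \<beta> Rb \<or> Rb = insert \<beta> R1) \<and> R1 \<noteq> Rb"
      by (rule exI[of _ k]) (use R1 k in auto)
    show "\<exists>\<beta>. \<beta> \<notin> Rb \<inter> ?Rw \<and> (?Rw = insert \<beta> Rb \<or> Rb = insert \<beta> ?Rw) \<and> ?Rw \<noteq> Rb"
      by (rule exI[of _ ?a]) (use a in auto)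
  qed
  then obtain R0 p' q' where pq: "R0 \<in> W" "insert p' R0 \<in> W" "insert q' R0 \<in> W" "p' \<notin> R0" "q' \<notin> R0" "p' \<noteq> q'"
    "R0 \<subseteq> R1" "?Rw \<subseteq> R0 \<union> cone p' q'" unfolding cone_def[symmetric] by blast
  have pq': "p' \<in> PR" "q' \<in> PR" using W_PR[OF pq(2)] W_PR[OF pq(3)] by auto
  have "?a \<in> cone p' q'" using pq a R1 by auto
  then have "?a = p' \<or> ?a = q'" using simple_cone[OF s(2) pq'] by simp
  then obtain p where p: "insert p R0 \<in> W" "insert ?a R0 \<in> W" "p \<notin> R0" "?a \<notin> R0" "p \<noteq> ?a" "?Rw \<subseteq> R0 \<union> cone p ?a"
    using pq cone_comm[of p' q'] by auto
  have pPR: "p \<in> PR" "?a \<in> PR" using W_PR[OF p(1)] PR_simple[OF s(2)] by auto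
  have kc: "k \<in> cone p ?a" using k p pq R1 by auto
  then have pRb: "p \<in> Rb" using coconvex_cone[OF RbW pPR] k a by auto
  have "cone p ?a \<subseteq> ?Rw" by (rule convex_cone[OF RwW]) (use pRb in auto)
  \<comment> \<open>If \<open>Y\<close> missed \<open>p\<close>, a maximal set containing
    \<open>?a\<close> and avoiding \<open>p\<close> would still contain \<open>Y\<close>, against
    the minimality of \<open>?Rw\<close>.\<close>
  have pY: "p \<in> Y"
  proof (rule ccontr)
    assume pY: "p \<notin> Y"
    obtain H where H: "H \<in> W" "insert ?a R0 \<subseteq> H" "p \<notin> H" "insert p H \<in> W" "insert p H \<subseteq> ?Rw"
      by (rule maximal_avoiding[OF p(2) _ _ RwW, of p]) (use p pRb pq R1 in auto)
    have "cone p ?a \<subseteq> insert p H" by (rule convex_cone[OF H(4)]) (use H in auto)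
    then have "?Rw \<subseteq> insert p H" using p H by auto
    then have "Y \<subseteq> H" using YRb pY by auto
    then have "H = ?Rw" using min H by auto
    then show False using H pRb by auto
  qed
  have kp: "k \<noteq> p" using pY k by auto
  have pR1: "p \<in> R1" using pRb kp by (auto simp: R1_def)
  have ka: "k \<noteq> ?a" using k a by auto
  obtain x y where xy: "0 \<le> x" "0 \<le> y" "k = lin x p y ?a" "k \<in> PR" using kc unfolding cone_def by auto
  have "x \<noteq> 0" using lin_PR_0(2)[OF pPR(2), of p y] xy ka by auto
  moreover have "y \<noteq> 0" using lin_PR_0(1)[OF pPR(1), of x ?a] xy kp by auto
  ultimately have interior: "\<exists>a>0. \<exists>b>0. lin a p b ?a \<in> PR"
    using xy by (intro exI[of _ x] conjI exI[of _ y]) auto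
  have finRw: "finite ?Rw" by (rule W_finite[OF RwW])
  note sub = Wp_sub[OF Rw']
  have Wps: "R0 \<in> Wp (set ?c)" "insert p R0 \<in> Wp (set ?c)" "insert ?a R0 \<in> Wp (set ?c)" "R1 \<in> Wp (set ?c)"
    using sub[OF pq(1)] sub[OF p(1)] sub[OF p(2)] sub[OF R1(1)] pq(7) R1(5) pRb by auto
  have cRb: "card Rb < n" using n finRw a by simp
  have cR1: "card R1 < n" using card_mono[OF _ R1(5)] cRb finRw by auto
  \<comment> \<open>\<open>R1\<close> lies between \<open>Y\<close> and \<open>Rb\<close>, so the
    edge at \<open>k\<close> is contracted.\<close>
  have e: "P ?c R1 = Y"
  proof
    have "P ?c Y \<subseteq> P ?c R1" by (rule mono_uptoD[OF m c YWp Wps(4) R1(2) cR1])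
    then show "Y \<subseteq> P ?c R1" using YY by simp
    show "P ?c R1 \<subseteq> Y" unfolding Y by (rule mono_uptoD[OF m c Wps(4) Rb' R1(5) cRb])
  qed
  \<comment> \<open>Otherwise \<open>poly_contract\<close> pushes the value \<open>Y\<close> at
    \<open>R1\<close> down into \<open>R0\<close>, which misses \<open>p\<close>.\<close>
  have pn: "P ?c R0 \<noteq> P ?c (insert p R0)"
  proof
    assume eq: "P ?c R0 = P ?c (insert p R0)"
    have "P ?c R1 = P ?c R0"
      by (rule poly_contract[where p = p and q = ?a])
        (use Wps c eq p pq(7) pPR R1 a s in auto)
    then have "Y \<subseteq> R0" using e P_le[OF Wps(1) c] by simp
    then show False using pY p by auto
  qed
  have qn: "P ?c R0 \<noteq> P ?c (insert ?a R0)"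
  proof (rule simple_keep[OF m _ c Wps(1,3) p(4)])
    have "insert ?a R0 \<subset> ?Rw" using pq(7) R1(5) pRb p by auto
    from psubset_card_mono[OF finRw this] show "card (insert ?a R0) < n" using n by linarith
  qed simp
  \<comment> \<open>\<open>?a\<close> plays the role of \<open>q\<close>: its letter is last in the
    word, so the form is a coordinate and the sign condition holds.\<close>
  have "P ?c R1 \<noteq> P ?c (insert k R1)"
  proof (rule poly_keep[OF Wps(4) _ m Wps(1,2,3) p(3,4,5), where r = k])
    show "0 \<le> euler ?c p ?a" using euler_final[of s cs p] s cs PR_nonneg[OF pPR(1)] by simp
  qed (use c R1 Rb' pq p a ka cRb interior pn qn in auto)
  then show False using e R1 Y by simp
qed

text \<open>Since \<open>refl s\<close> permutes \<open>Rb\<close>, the upper branch on the cover is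
  \<open>tog s Y\<close> with \<open>Y = P (cs @ [s]) Rb\<close>. It remains to see that
  \<open>insert (simple_root s) Y\<close> is an inversion set. A minimal set that contains
  \<open>Y\<close> and \<open>simple_root s\<close> covers some \<open>H\<close> with the same image
  \<open>Y\<close>, and \<open>saturated\<close> forces \<open>Y = H\<close>.\<close>

lemma cover_proj:
  assumes m: "mono_upto n" and s: "s \<notin> set cs" "s \<in> S" and cs: "distinct cs" "set cs \<subseteq> S"
    and Rb: "Rb \<in> Wp (insert s (set cs))" and a: "simple_root s \<notin> Rb"
    and Rw: "insert (simple_root s) Rb \<in> Wp (insert s (set cs))"
    and n: "card (insert (simple_root s) Rb) \<le> n"
  shows "insert (simple_root s) (P (cs @ [s]) Rb) \<in> W \<and>
    P (s # cs) (insert (simple_root s) Rb) = insert (simple_root s) (P (cs @ [s]) Rb)"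
proof -
  let ?a = "simple_root s" and ?c = "cs @ [s]"
  let ?Rw = "insert ?a Rb"
  define Y where "Y = P ?c Rb"
  have c: "distinct ?c" "set ?c \<subseteq> S" and J: "set ?c = insert s (set cs)" using s cs by auto
  have Rb': "Rb \<in> Wp (set ?c)" and Rw': "?Rw \<in> Wp (set ?c)" using Rb Rw by auto
  have RbW: "Rb \<in> W" and RwW: "?Rw \<in> W" using Rb Rw WpD(1) by auto
  have YWp: "Y \<in> Wp (set ?c)" and YRb: "Y \<subseteq> Rb" and YY: "P ?c Y = Y"
    unfolding Y_def by (rule P_Wp[OF Rb' c], rule P_le[OF Rb' c], rule P_idem[OF Rb' c])
  have finRw: "finite ?Rw" by (rule W_finite[OF RwW])
  obtain g where g: "g \<in> W \<and> Y \<subseteq> g \<and> ?a \<in> g \<and> g \<subseteq> ?Rw"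
    and min: "\<And>X. X \<in> W \<and> Y \<subseteq> X \<and> ?a \<in> X \<and> X \<subseteq> ?Rw \<Longrightarrow> X \<subseteq> g \<Longrightarrow> X = g"
    by (rule minimal_W[OF finRw, of "\<lambda>X. X \<in> W \<and> Y \<subseteq> X \<and> ?a \<in> X \<and> X \<subseteq> ?Rw" ?Rw]) (use RwW YRb in auto)
  obtain H where H: "H \<in> W" "Y \<subseteq> H" "?a \<notin> H" "insert ?a H \<in> W" "insert ?a H \<subseteq> g"
    by (rule maximal_avoiding[OF WpD(1)[OF YWp], of g ?a]) (use g a YRb in auto)
  have gH: "g = insert ?a H" using min[of "insert ?a H"] H g by auto
  have HRb: "H \<subseteq> Rb" using H g by auto
  have HWp: "H \<in> Wp (set ?c)" by (rule Wp_sub[OF Rb' H(1) HRb])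
  have cRb: "card Rb < n" using n finRw a by simp
  have cH: "card H < n" using card_mono[OF _ HRb] cRb finRw by auto
  have YH: "Y = P ?c H"
  proof
    have "P ?c Y \<subseteq> P ?c H" by (rule mono_uptoD[OF m c YWp HWp H(2) cH])
    then show "Y \<subseteq> P ?c H" using YY by simp
    show "P ?c H \<subseteq> Y" unfolding Y_def by (rule mono_uptoD[OF m c HWp Rb' HRb cRb])
  qed
  have "Y = H"
  proof (rule saturated[OF m s cs _ H(3) _ _ YH])
    show "H \<in> Wp (insert s (set cs))" "insert ?a H \<in> Wp (insert s (set cs))"
      using HWp Wp_sub[OF Rw H(4)] H g by auto
    have "insert ?a H \<subseteq> ?Rw" using HRb by auto
    from card_mono[OF finRw this] show "card (insert ?a H) \<le> n" using n by linarith
    show "R = insert ?a H" if "R \<in> W" "Y \<subseteq> R" "?a \<in> R" "R \<subseteq> insert ?a H" for R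
      using min[of R] that gH g by auto
  qed
  then have YW: "insert ?a Y \<in> W" using H by simp
  have aY: "?a \<notin> Y" using YRb a by auto
  have "refl s ` Y = Y" by (rule refl_invariant[OF s(2) WpD(1)[OF YWp] YW aY])
  moreover have "P (s # cs) ?Rw = tog s Y"
    using P_above[OF RwW, of s cs] tog_insert_simple[OF s(2) RbW RwW a] Y_def by simp
  ultimately show ?thesis using YW aY Y_def by (simp add: tog_def)
qed

text \<open>The upper branch loses a root, so \<open>mono_upto n\<close> applies. The lower branch
  need not lose one, so there the induction runs on the word.\<close>

lemma mono_step:
  assumes m: "mono_upto n"
  shows "distinct cs \<Longrightarrow> set cs \<subseteq> S \<Longrightarrow> R \<in> Wp (set cs) \<Longrightarrow> R' \<in> Wp (set cs) \<Longrightarrow> R \<subseteq> R' \<Longrightarrow> card R' \<le> n \<Longrightarrow>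
    P cs R \<subseteq> P cs R'"
proof (induction cs arbitrary: R R')
  case Nil
  then show ?case by simp
next
  case (Cons s cs)
  let ?a = "simple_root s" and ?J = "insert s (set cs)"
  have s: "s \<notin> set cs" "s \<in> S" and cs: "distinct cs" "set cs \<subseteq> S" using Cons.prems by auto
  have c: "distinct (cs @ [s])" "set (cs @ [s]) \<subseteq> S" using s cs by auto
  have J: "s \<in> ?J" "?J \<subseteq> S" using s cs by auto
  have below: "P (s # cs) X \<subseteq> P (s # cs) X'"
    if X: "X \<in> Wp ?J" "X' \<in> Wp ?J" "X \<subseteq> X'" "card X' \<le> n" "?a \<notin> X'" for X X'
  proof -
    have "card (par (set cs) X') \<le> n"
      using card_mono[OF W_finite[OF WpD(1)[OF X(2)]] par_subset[of "set cs"]] X(4) by (meson order_trans)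
    then have "P cs (par (set cs) X) \<subseteq> P cs (par (set cs) X')"
      using Cons.IH[OF cs par_Wp[OF WpD(1)[OF X(1)] cs(2)] par_Wp[OF WpD(1)[OF X(2)] cs(2)] par_mono[OF X(3)]] by simp
    moreover have "P (s # cs) X = P cs (par (set cs) X)" "P (s # cs) X' = P cs (par (set cs) X')"
      using P_below[of s X cs] P_below[of s X' cs] X by auto
    ultimately show ?thesis by simp
  qed
  have above: "P (s # cs) X \<subseteq> P (s # cs) X'"
    if X: "X \<in> Wp ?J" "X' \<in> Wp ?J" "X \<subseteq> X'" "card X' \<le> n" "?a \<in> X" for X X'
  proof -
    have aX': "?a \<in> X'" using X by auto
    have t: "tog s X \<in> Wp (set (cs @ [s]))" "tog s X' \<in> Wp (set (cs @ [s]))"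
      using tog_Wp[OF X(1) J] tog_Wp[OF X(2) J] by auto
    have "tog s X \<subseteq> tog s X'"
      by (rule tog_mono[OF s(2) X(3) Wp_PR[OF X(2)]]) (use X aX' in auto)
    moreover have "card (tog s X') < n"
      using card_tog_less[OF W_finite[OF WpD(1)[OF X(2)]] aX'] X(4) by simp
    ultimately have le: "P (cs @ [s]) (tog s X) \<subseteq> P (cs @ [s]) (tog s X')"
      using mono_uptoD[OF m c t] by blast
    have n: "?a \<notin> tog s X'" using tog_mem_simple[OF s(2) Wp_PR[OF X(2)]] aX' by simp
    then have n': "?a \<notin> P (cs @ [s]) (tog s X')" using P_le[OF t(2) c] by auto
    have "tog s (P (cs @ [s]) (tog s X)) \<subseteq> tog s (P (cs @ [s]) (tog s X'))"
      by (rule tog_mono[OF s(2) le Wp_PR[OF P_Wp[OF t(2) c]]]) (use le n' in auto)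
    then show ?thesis using P_above[OF WpD(1)[OF X(1)] X(5)] P_above[OF WpD(1)[OF X(2)] aX'] by simp
  qed
  have R: "R \<in> Wp ?J" "R' \<in> Wp ?J" using Cons.prems by auto
  consider "?a \<in> R" | "?a \<notin> R'" | "?a \<notin> R" "?a \<in> R'" by blast
  then show ?case
  proof cases
    case 1
    then show ?thesis using above[OF R] Cons.prems by simp
  next
    case 2
    then show ?thesis using below[OF R] Cons.prems by simp
  next
    case 3
    \<comment> \<open>The inclusion is split at one cover: from \<open>R\<close> to \<open>H\<close>
      both values use the lower branch, from \<open>insert ?a H\<close> to \<open>R'\<close> both
      use the upper one.\<close>
    obtain H where H: "H \<in> W" "R \<subseteq> H" "?a \<notin> H" "insert ?a H \<in> W" "insert ?a H \<subseteq> R'"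
      by (rule maximal_avoiding[OF WpD(1)[OF R(1)] Cons.prems(5) 3(1) WpD(1)[OF R(2)] 3(2)])
    have HWp: "H \<in> Wp ?J" "insert ?a H \<in> Wp ?J" using Wp_sub[OF R(2)] H by auto
    have fin: "finite R'" by (rule W_finite[OF WpD(1)[OF R(2)]])
    have cH: "card (insert ?a H) \<le> n" using card_mono[OF fin H(5)] Cons.prems by simp
    then have cH': "card H \<le> n" using H W_finite[OF H(1)] by simp
    have Hc: "H \<in> Wp (set (cs @ [s]))" using HWp by simp
    define X where "X = P cs (par (set cs) H)"
    have pH: "par (set cs) H \<in> Wp (set cs)" by (rule par_Wp[OF H(1) cs(2)])
    have X: "X \<in> Wp (set cs)" "X \<subseteq> H" "P cs X = X" unfolding X_def
      using P_Wp[OF pH cs] P_le[OF pH cs] P_idem[OF pH cs] par_subset[of "set cs" H] by auto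
    \<comment> \<open>The lower-branch value \<open>X\<close> is fixed by the rotated word, hence
      lies below the rotated value at \<open>H\<close>, to which \<open>cover_proj\<close> only adds
      \<open>?a\<close>.\<close>
    have "P (cs @ [s]) X \<subseteq> P (cs @ [s]) H"
      by (rule mono_uptoD[OF m c _ Hc X(2)])
        (use cH H W_finite[OF H(1)] Wp_mono[OF X(1), of "set (cs @ [s])"] in auto)
    then have "X \<subseteq> P (cs @ [s]) H" using P_snoc[OF X(1) cs s] X(3) by simp
    then have "P (s # cs) H \<subseteq> P (s # cs) (insert ?a H)"
      using cover_proj[OF m s cs HWp(1) H(3) HWp(2) cH] P_below[OF H(3), of cs] X_def by auto
    moreover have "P (s # cs) R \<subseteq> P (s # cs) H" by (rule below[OF R(1) HWp(1) H(2) cH' H(3)])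
    moreover have "P (s # cs) (insert ?a H) \<subseteq> P (s # cs) R'"
      by (rule above[OF HWp(2) R(2) H(5)]) (use Cons.prems in auto)
    ultimately show ?thesis by simp
  qed
qed

lemma mono_upto_all: "mono_upto n"
proof (induction n)
  case 0
  show ?case by (simp add: mono_upto_def)
next
  case (Suc n)
  show ?case unfolding mono_upto_def using mono_step[OF Suc] by (auto simp: less_Suc_eq_le)
qed

theorem P_mono:
  assumes "distinct cs" "set cs \<subseteq> S" "R \<in> Wp (set cs)" "R' \<in> Wp (set cs)" "R \<subseteq> R'"
  shows "P cs R \<subseteq> P cs R'"
  using mono_uptoD[OF mono_upto_all assms lessI] .

section \<open>Meets and joins of inversion sets\<close>

definition is_meet :: "('a \<Rightarrow> real) set \<Rightarrow> ('a \<Rightarrow> real) set set \<Rightarrow> bool" where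
  "is_meet M X \<longleftrightarrow> M \<in> W \<and> (\<forall>R\<in>X. M \<subseteq> R) \<and> (\<forall>Z\<in>W. (\<forall>R\<in>X. Z \<subseteq> R) \<longrightarrow> Z \<subseteq> M)"

definition is_join :: "('a \<Rightarrow> real) set \<Rightarrow> ('a \<Rightarrow> real) set set \<Rightarrow> bool" where
  "is_join M X \<longleftrightarrow> M \<in> W \<and> (\<forall>R\<in>X. R \<subseteq> M) \<and> (\<forall>Z\<in>W. (\<forall>R\<in>X. R \<subseteq> Z) \<longrightarrow> M \<subseteq> Z)"

lemma is_meetD: "is_meet M X \<Longrightarrow> M \<in> W" "is_meet M X \<Longrightarrow> R \<in> X \<Longrightarrow> M \<subseteq> R"
    "is_meet M X \<Longrightarrow> Z \<in> W \<Longrightarrow> (\<And>R. R \<in> X \<Longrightarrow> Z \<subseteq> R) \<Longrightarrow> Z \<subseteq> M"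
  unfolding is_meet_def by auto

lemma is_joinD: "is_join M X \<Longrightarrow> M \<in> W" "is_join M X \<Longrightarrow> R \<in> X \<Longrightarrow> R \<subseteq> M"
    "is_join M X \<Longrightarrow> Z \<in> W \<Longrightarrow> (\<And>R. R \<in> X \<Longrightarrow> R \<subseteq> Z) \<Longrightarrow> M \<subseteq> Z"
  unfolding is_join_def by auto

text \<open>Confluence: local joins make a bounded down-closed family directed.\<close>

lemma directed_max:
  assumes U: "U \<in> W" and Q: "\<And>X. Q X \<Longrightarrow> X \<in> W \<and> X \<subseteq> U" and Q0: "Q {}"
    and down: "\<And>X X'. Q X \<Longrightarrow> X' \<in> W \<Longrightarrow> X' \<subseteq> X \<Longrightarrow> Q X'"
    and loc: "\<And>X p q. X \<in> W \<Longrightarrow> Q (insert p X) \<Longrightarrow> Q (insert q X) \<Longrightarrow> p \<notin> X \<Longrightarrow> q \<notin> X \<Longrightarrow> p \<noteq> q \<Longrightarrow>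
      X \<union> cone p q \<in> W \<Longrightarrow> X \<union> cone p q \<subseteq> U \<Longrightarrow> Q (X \<union> cone p q)"
  obtains M where "Q M" "\<And>X. Q X \<Longrightarrow> X \<subseteq> M"
proof -
  have fin: "finite U" by (rule W_finite[OF U])
  have "\<exists>M. Q M \<and> (\<forall>Z. Q Z \<longrightarrow> X \<subseteq> Z \<longrightarrow> Z \<subseteq> M)" if "Q X" for X
    using that
  proof (induction "card U - card X" arbitrary: X rule: less_induct)
    case less
    have XW: "X \<in> W" "X \<subseteq> U" using Q less.prems by auto
    have IH: "\<exists>M. Q M \<and> (\<forall>Z. Q Z \<longrightarrow> insert p X \<subseteq> Z \<longrightarrow> Z \<subseteq> M)" if p: "p \<notin> X" "Q (insert p X)" for p
    proof -
      have "insert p X \<subseteq> U" using Q p by auto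
      then have "card (insert p X) \<le> card U" using card_mono fin by blast
      moreover have "card (insert p X) = Suc (card X)" using W_finite[OF XW(1)] p by simp
      ultimately show ?thesis using less.hyps[of "insert p X"] p by auto
    qed
    show ?case
    proof (cases "\<exists>p. p \<notin> X \<and> Q (insert p X)")
      case False
      have "Z \<subseteq> X" if Z: "Q Z" "X \<subseteq> Z" for Z
      proof (rule ccontr)
        assume "\<not> Z \<subseteq> X"
        then have "X \<subset> Z" using Z by auto
        then obtain \<beta> where b: "\<beta> \<in> Z - X" "insert \<beta> X \<in> W" using W_up[OF XW(1)] Q Z by blast
        then have "Q (insert \<beta> X)" using down[OF Z(1), of "insert \<beta> X"] Z by auto
        then show False using False b by auto
      qed
      then show ?thesis using less.prems by auto
    next
      case True
      then obtain p where p: "p \<notin> X" "Q (insert p X)" by auto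
      obtain M where M: "Q M" "\<And>Z. Q Z \<Longrightarrow> insert p X \<subseteq> Z \<Longrightarrow> Z \<subseteq> M" using IH[OF p] by blast
      have "Z \<subseteq> M" if Z: "Q Z" "X \<subseteq> Z" for Z
      proof (cases "Z = X")
        case True
        have "insert p X \<subseteq> M" using M(2)[OF p(2)] by simp
        then show ?thesis using True by auto
      next
        case False
        then have "X \<subset> Z" using Z by auto
        then obtain q where q: "q \<in> Z - X" "insert q X \<in> W" using W_up[OF XW(1)] Q Z by blast
        have Qq: "Q (insert q X)" using down[OF Z(1) q(2)] q Z by auto
        show ?thesis
        proof (cases "q = p")
          case True
          then show ?thesis using M(2)[OF Z(1)] q Z by auto
        next
          case qp: False
          obtain N where N: "Q N" "\<And>Z. Q Z \<Longrightarrow> insert q X \<subseteq> Z \<Longrightarrow> Z \<subseteq> N" using IH[of q] q Qq by blast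
          have pW: "insert p X \<in> W" "insert p X \<subseteq> U" "insert q X \<subseteq> U" using Q[OF p(2)] Q[OF Qq] by auto
          have pqU: "insert p (insert q X) \<subseteq> U" using pW by auto
          have TW: "X \<union> cone p q \<in> W" unfolding cone_def
            by (rule W_local_join[OF XW(1) pW(1) q(2) p(1) _ _ U pqU]) (use q qp in auto)
          have "X \<union> cone p q \<subseteq> U" using convex_cone[OF U, of p q] pqU XW by auto
          then have QT: "Q (X \<union> cone p q)" using loc[OF XW(1) p(2) Qq p(1) _ _ TW] q qp by auto
          have pq: "p \<in> cone p q" "q \<in> cone p q"
            using cone_self[of p q] cone_self[of q p] W_PR[OF pW(1)] W_PR[OF q(2)] by auto
          \<comment> \<open>The local join contains \<open>p\<close> and \<open>q\<close>, so it
            lies below both the greatest element \<open>M\<close> above \<open>insert p X\<close>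
            and the greatest element \<open>N\<close> above \<open>insert q X\<close>; hence each of
            them contains the other.\<close>
          have "X \<union> cone p q \<subseteq> M" using M(2)[OF QT] pq by auto
          then have "M \<subseteq> N" using N(2)[OF M(1)] pq by auto
          moreover have "X \<union> cone p q \<subseteq> N" using N(2)[OF QT] pq by auto
          then have "N \<subseteq> M" using M(2)[OF N(1)] pq by auto
          moreover have "Z \<subseteq> N" using N(2)[OF Z(1)] q Z by auto
          ultimately show ?thesis by auto
        qed
      qed
      then show ?thesis using M by auto
    qed
  qed
  from this[OF Q0] obtain M where "Q M" "\<And>Z. Q Z \<Longrightarrow> Z \<subseteq> M" by auto
  then show thesis by (rule that)
qed

text \<open>Common lower bounds lie inside any one member, a finite set, and convexity of the
  members closes them under local joins.\<close>

lemma meet_exists: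
  assumes "X \<subseteq> W" "X \<noteq> {}"
  shows "\<exists>M. is_meet M X"
proof -
  obtain U where U: "U \<in> X" using assms by auto
  obtain M where M: "M \<in> W \<and> (\<forall>R\<in>X. M \<subseteq> R)" "\<And>Z. Z \<in> W \<and> (\<forall>R\<in>X. Z \<subseteq> R) \<Longrightarrow> Z \<subseteq> M"
  proof (rule directed_max[of U "\<lambda>Z. Z \<in> W \<and> (\<forall>R\<in>X. Z \<subseteq> R)"])
    show "Y \<union> cone p q \<in> W \<and> (\<forall>R\<in>X. Y \<union> cone p q \<subseteq> R)"
      if "Y \<union> cone p q \<in> W" "insert p Y \<in> W \<and> (\<forall>R\<in>X. insert p Y \<subseteq> R)"
        "insert q Y \<in> W \<and> (\<forall>R\<in>X. insert q Y \<subseteq> R)" for Y p q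
    proof -
      have "Y \<union> cone p q \<subseteq> R" if R: "R \<in> X" for R
      proof -
        have "R \<in> W" "p \<in> R" "q \<in> R" "Y \<subseteq> R" using R assms that \<open>insert p Y \<in> W \<and> _\<close> \<open>insert q Y \<in> W \<and> _\<close> by auto
        then show ?thesis using convex_cone by auto
      qed
      then show ?thesis using that by auto
    qed
    show "X' \<in> W \<and> (\<forall>R\<in>X. X' \<subseteq> R)" if "Z \<in> W \<and> (\<forall>R\<in>X. Z \<subseteq> R)" "X' \<in> W" "X' \<subseteq> Z" for Z X'
      using that by blast
  qed (use U assms W_empty in auto)
  have "is_meet M X" unfolding is_meet_def using M by auto
  then show ?thesis by auto
qed

lemma join_exists:
  assumes "X \<subseteq> W" "U \<in> W" "\<And>R. R \<in> X \<Longrightarrow> R \<subseteq> U"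
  shows "\<exists>M. is_join M X"
proof -
  let ?U = "{Z \<in> W. \<forall>R\<in>X. R \<subseteq> Z}"
  have "?U \<noteq> {}" using assms(2,3) by blast
  then obtain M where M: "is_meet M ?U" using meet_exists[of ?U] by blast
  have "R \<subseteq> M" if "R \<in> X" for R
    by (rule is_meetD(3)[OF M]) (use that assms in auto)
  then have "is_join M X" unfolding is_join_def using is_meetD(1,2)[OF M] by auto
  then show ?thesis by auto
qed

text \<open>Sets below \<open>M\<close> that avoid \<open>simple_root s\<close> are closed under
  local joins, because an extreme ray arises in a cone only as a generator. Their greatest element
  bounds \<open>X\<close>, so it is \<open>M\<close>.\<close>

lemma join_avoid:
  assumes M: "is_join M X" and X: "X \<subseteq> W" and s: "s \<in> S" and a: "\<And>R. R \<in> X \<Longrightarrow> simple_root s \<notin> R"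
  shows "simple_root s \<notin> M"
proof -
  have MW: "M \<in> W" by (rule is_joinD(1)[OF M])
  obtain H where H: "H \<in> W \<and> H \<subseteq> M \<and> simple_root s \<notin> H"
    "\<And>Z. Z \<in> W \<and> Z \<subseteq> M \<and> simple_root s \<notin> Z \<Longrightarrow> Z \<subseteq> H"
  proof (rule directed_max[of M "\<lambda>Z. Z \<in> W \<and> Z \<subseteq> M \<and> simple_root s \<notin> Z"])
    fix Y p q
    assume A: "Y \<union> cone p q \<in> W" "Y \<union> cone p q \<subseteq> M"
      "insert p Y \<in> W \<and> insert p Y \<subseteq> M \<and> simple_root s \<notin> insert p Y"
      "insert q Y \<in> W \<and> insert q Y \<subseteq> M \<and> simple_root s \<notin> insert q Y"
    have "p \<in> PR" "q \<in> PR" using W_PR[of "insert p Y"] W_PR[of "insert q Y"] A by auto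
    then have "simple_root s \<notin> cone p q" using simple_cone[OF s] A by auto
    then show "Y \<union> cone p q \<in> W \<and> Y \<union> cone p q \<subseteq> M \<and> simple_root s \<notin> Y \<union> cone p q" using A by auto
  qed (use MW W_empty in auto)
  have "M \<subseteq> H"
  proof (rule is_joinD(3)[OF M])
    show "H \<in> W" using H by auto
    show "R \<subseteq> H" if "R \<in> X" for R
      using H(2)[of R] that X a is_joinD(2)[OF M] by auto
  qed
  then show ?thesis using H by auto
qed

text \<open>A root of \<open>cone p q\<close> supported in \<open>J\<close> uses only generators
  supported in \<open>J\<close>, so the condition \<open>par J Z \<subseteq> y\<close> passes to
  local joins. The greatest such \<open>Z\<close> below \<open>M\<close> bounds \<open>X\<close> and
  is therefore \<open>M\<close>: restriction preserves joins.\<close>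

lemma par_join:
  assumes M: "is_join M X" and X: "X \<subseteq> W" and J: "J \<subseteq> S" and y: "y \<in> W" "\<And>R. R \<in> X \<Longrightarrow> par J R \<subseteq> y"
  shows "par J M \<subseteq> y"
proof -
  have MW: "M \<in> W" by (rule is_joinD(1)[OF M])
  obtain H where H: "H \<in> W \<and> H \<subseteq> M \<and> par J H \<subseteq> y"
    "\<And>Z. Z \<in> W \<and> Z \<subseteq> M \<and> par J Z \<subseteq> y \<Longrightarrow> Z \<subseteq> H"
  proof (rule directed_max[of M "\<lambda>Z. Z \<in> W \<and> Z \<subseteq> M \<and> par J Z \<subseteq> y"])
    fix Y p q
    assume A: "Y \<union> cone p q \<in> W" "Y \<union> cone p q \<subseteq> M"
      "insert p Y \<in> W \<and> insert p Y \<subseteq> M \<and> par J (insert p Y) \<subseteq> y"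
      "insert q Y \<in> W \<and> insert q Y \<subseteq> M \<and> par J (insert q Y) \<subseteq> y"
    have pq: "p \<in> PR" "q \<in> PR" using W_PR[of "insert p Y"] W_PR[of "insert q Y"] A by auto
    have "\<beta> \<in> y" if b: "\<beta> \<in> cone p q" "supp_in J \<beta>" for \<beta>
    proof -
      obtain a b where ab: "0 \<le> a" "0 \<le> b" "\<beta> = lin a p b q" "\<beta> \<in> PR" using b unfolding cone_def by auto
      have 1: "p \<in> y" if "a \<noteq> 0"
      proof -
        have "supp_in J p" unfolding supp_in_def
        proof (intro allI impI)
          fix r assume "p r \<noteq> 0"
          then have "0 < a * p r" using ab that PR_nonneg[OF pq(1), of r] by (simp add: order_less_le)
          moreover have "0 \<le> b * q r" using ab PR_nonneg[OF pq(2)] by simp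
          ultimately have "\<beta> r \<noteq> 0" using ab(3) by (simp add: lin_def)
          then show "r \<in> J" using b(2) by (simp add: supp_in_def)
        qed
        then show ?thesis using A by (auto simp: par_insert)
      qed
      have 2: "q \<in> y" if "b \<noteq> 0"
      proof -
        have "supp_in J q" unfolding supp_in_def
        proof (intro allI impI)
          fix r assume "q r \<noteq> 0"
          then have "0 < b * q r" using ab that PR_nonneg[OF pq(2), of r] by (simp add: order_less_le)
          moreover have "0 \<le> a * p r" using ab PR_nonneg[OF pq(1)] by simp
          ultimately have "\<beta> r \<noteq> 0" using ab(3) by (simp add: lin_def)
          then show "r \<in> J" using b(2) by (simp add: supp_in_def)
        qed
        then show ?thesis using A by (auto simp: par_insert)
      qed
      show ?thesis
      proof (cases "a = 0")
        case True
        then have "\<beta> = q" using ab lin_PR_0(2)[OF pq(2), of p b] by simp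
        moreover have "b \<noteq> 0"
        proof
          assume "b = 0"
          then have "\<beta> = (\<lambda>r. 0)" using ab True by (simp add: lin_def)
          then show False using PR_nonzero[OF ab(4)] by auto
        qed
        ultimately show ?thesis using 2 by simp
      next
        case a: False
        show ?thesis
        proof (cases "b = 0")
          case True
          then have "\<beta> = p" using ab lin_PR_0(1)[OF pq(1), of a q] by simp
          then show ?thesis using 1 a by simp
        next
          case False
          then show ?thesis using W_convex[OF y(1) 1[OF a] 2[OF False] ab(1,2)] ab by simp
        qed
      qed
    qed
    then have "par J (Y \<union> cone p q) \<subseteq> y" using A by (auto simp: par_def)
    then show "Y \<union> cone p q \<in> W \<and> Y \<union> cone p q \<subseteq> M \<and> par J (Y \<union> cone p q) \<subseteq> y" using A by auto
  next
    show "X' \<in> W \<and> X' \<subseteq> M \<and> par J X' \<subseteq> y" if "Z \<in> W \<and> Z \<subseteq> M \<and> par J Z \<subseteq> y" "X' \<in> W" "X' \<subseteq> Z" for Z X'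
      using that par_mono[of X' Z J] by auto
  qed (use MW W_empty in \<open>auto simp: par_def\<close>)
  have "M \<subseteq> H"
  proof (rule is_joinD(3)[OF M])
    show "H \<in> W" using H by auto
    show "R \<subseteq> H" if "R \<in> X" for R
      using H(2)[of R] that X y is_joinD(2)[OF M] by auto
  qed
  then show ?thesis using H par_mono[of M H J] by auto
qed

section \<open>Aligned inversion sets\<close>

definition omega :: "'a list \<Rightarrow> ('a \<Rightarrow> real) \<Rightarrow> ('a \<Rightarrow> real) \<Rightarrow> real" where
  "omega cs u v = euler cs u v - euler cs v u"

text \<open>This is the rank-two condition of Reading and Speyer.\<close>

definition aligned :: "'a list \<Rightarrow> ('a \<Rightarrow> real) set \<Rightarrow> bool" where
  "aligned cs R \<longleftrightarrow> (\<forall>\<beta>\<in>PR. \<forall>\<gamma>\<in>PR. \<forall>a>0. \<forall>b>0. lin a \<beta> b \<gamma> \<in> R \<longrightarrow> 0 < omega cs \<beta> \<gamma> \<longrightarrow> \<beta> \<in> R)"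

lemma alignedD: "aligned cs R \<Longrightarrow> \<beta> \<in> PR \<Longrightarrow> \<gamma> \<in> PR \<Longrightarrow> 0 < a \<Longrightarrow> 0 < b \<Longrightarrow> lin a \<beta> b \<gamma> \<in> R \<Longrightarrow>
    0 < omega cs \<beta> \<gamma> \<Longrightarrow> \<beta> \<in> R"
  unfolding aligned_def by blast

lemma omega_initial:
  assumes "s \<notin> set cs" "set (s # cs) \<subseteq> S" "\<beta> \<in> PR"
  shows "0 \<le> omega (s # cs) (simple_root s) \<beta>"
    and "omega (s # cs) (simple_root s) \<beta> = - (\<Sum>r\<in>set cs. A r s * \<beta> r)"
proof -
  show e: "omega (s # cs) (simple_root s) \<beta> = - (\<Sum>r\<in>set cs. A r s * \<beta> r)"
    unfolding omega_def euler_initial[OF assms(1)] euler_initial_right[OF assms(1)] by simp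
  have "(\<Sum>r\<in>set cs. A r s * \<beta> r) \<le> 0"
    by (rule sum_nonpos) (use assms A_nonpos PR_nonneg[OF assms(3)] in \<open>auto intro!: mult_nonpos_nonneg\<close>)
  then show "0 \<le> omega (s # cs) (simple_root s) \<beta>" using e by simp
qed

lemma omega_final:
  assumes "s \<notin> set cs" "distinct cs" "set (s # cs) \<subseteq> S" "\<beta> \<in> PR"
  shows "omega (cs @ [s]) (simple_root s) \<beta> \<le> 0"
proof -
  have d: "distinct (s # cs)" using assms by simp
  have "euler (cs @ [s]) (simple_root s) \<beta> = (\<Sum>r\<in>set cs. A s r * \<beta> r) + \<beta> s"
    unfolding euler_snoc[OF d]
    using euler_zero_left[of cs "simple_root s" \<beta>] assms(1) by (force simp: simple_root_def)
  moreover have "(\<Sum>r\<in>set cs. A s r * \<beta> r) \<le> 0"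
    by (rule sum_nonpos) (use assms A_nonpos PR_nonneg[OF assms(4)] in \<open>auto intro!: mult_nonpos_nonneg\<close>)
  ultimately show ?thesis
    unfolding omega_def euler_final[OF d] by simp
qed

lemma omega_rotate:
  assumes "distinct (s # cs)" "set (s # cs) \<subseteq> S" "supp_in (set (s # cs)) u" "supp_in (set (s # cs)) v"
  shows "omega (cs @ [s]) (refl s u) (refl s v) = omega (s # cs) u v"
  unfolding omega_def using euler_rotate assms by metis

lemma omega_restrict: "u s = 0 \<Longrightarrow> v s = 0 \<Longrightarrow> omega (s # cs) u v = omega cs u v"
  by (simp add: omega_def)

lemma supp_lin_pos:
  assumes "\<beta> \<in> PR" "\<gamma> \<in> PR" "0 < a" "0 < b" "supp_in J (lin a \<beta> b \<gamma>)"
  shows "supp_in J \<beta>" "supp_in J \<gamma>"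
proof -
  have "r \<in> J" if "\<beta> r \<noteq> 0 \<or> \<gamma> r \<noteq> 0" for r
  proof -
    have "0 \<le> a * \<beta> r" "0 \<le> b * \<gamma> r" "\<beta> r \<noteq> 0 \<longrightarrow> 0 < a * \<beta> r" "\<gamma> r \<noteq> 0 \<longrightarrow> 0 < b * \<gamma> r"
      using assms PR_nonneg[OF assms(1), of r] PR_nonneg[OF assms(2), of r] by (auto simp: order_less_le)
    then have "lin a \<beta> b \<gamma> r \<noteq> 0" using that unfolding lin_def by linarith
    then show ?thesis using assms(5) unfolding supp_in_def by blast
  qed
  then show "supp_in J \<beta>" "supp_in J \<gamma>" unfolding supp_in_def by blast+
qed

text \<open>A positive combination supported in \<open>set cs\<close> has both summands supported
  there, and on such roots dropping \<open>s\<close> does not change \<open>omega\<close>.\<close>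

lemma aligned_par:
  assumes R: "R \<in> Wp (insert s (set cs))" and s: "s \<notin> set cs" and al: "aligned (s # cs) R"
  shows "aligned cs (par (set cs) R)"
  unfolding aligned_def
proof (intro ballI allI impI)
  fix \<beta> \<gamma> and a b :: real
  assume A: "\<beta> \<in> PR" "\<gamma> \<in> PR" "0 < a" "0 < b" "lin a \<beta> b \<gamma> \<in> par (set cs) R" "0 < omega cs \<beta> \<gamma>"
  have l: "lin a \<beta> b \<gamma> \<in> R" "supp_in (set cs) (lin a \<beta> b \<gamma>)" using A by (auto simp: par_def)
  note sup = supp_lin_pos[OF A(1-4) l(2)]
  have "\<beta> s = 0" "\<gamma> s = 0" using sup s by (auto simp: supp_in_def)
  then have "0 < omega (s # cs) \<beta> \<gamma>" using A omega_restrict by simp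
  then have "\<beta> \<in> R" using alignedD[OF al A(1-4) l(1)] by simp
  then show "\<beta> \<in> par (set cs) R" using sup by (simp add: par_def)
qed

text \<open>Sets fixed by \<open>P cs\<close> belong to the c-sortable elements. In the upper branch
  a triple \<open>\<beta>\<close>, \<open>\<gamma>\<close>, \<open>lin a \<beta> b \<gamma>\<close>
  is reflected to a triple for the rotated word. The exceptions involve
  \<open>simple_root s\<close>: as \<open>\<beta>\<close> it lies in \<open>R\<close>, as
  \<open>\<gamma>\<close> it makes \<open>omega\<close> nonpositive, and it is no combination of
  other roots.\<close>

lemma sortable_aligned:
  assumes "R \<in> Wp (set cs)" "distinct cs \<and> set cs \<subseteq> S" "P cs R = R"
  shows "aligned cs R"
  using assms
proof (induction cs R rule: P_induct)
  case (Nil R)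
  then show ?case by (simp add: aligned_def)
next
  case (above s cs R)
  let ?a = "simple_root s"
  have RW: "R \<in> W" "R \<subseteq> PR" using WpD(1) Wp_PR above.hyps by blast+
  have c: "distinct (cs @ [s])" "set (cs @ [s]) \<subseteq> S" "distinct (s # cs)" "set (s # cs) \<subseteq> S" using above.hyps by auto
  have tW: "tog s R \<in> Wp (set (cs @ [s]))" using above.hyps by simp
  have "tog s (P (cs @ [s]) (tog s R)) = R" using above.prems P_above[OF RW(1) above.hyps(6)] by simp
  then have "P (cs @ [s]) (tog s R) = tog s R"
    using tog_tog[OF Wp_PR[OF P_Wp[OF tW c(1,2)]] above.hyps(2)] by simp
  then have al: "aligned (cs @ [s]) (tog s R)" by (rule above.IH)
  show ?case unfolding aligned_def
  proof (intro ballI allI impI)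
    fix \<beta> \<gamma> and a b :: real
    assume A: "\<beta> \<in> PR" "\<gamma> \<in> PR" "0 < a" "0 < b" "lin a \<beta> b \<gamma> \<in> R" "0 < omega (s # cs) \<beta> \<gamma>"
    show "\<beta> \<in> R"
    proof (cases "\<beta> = ?a")
      case True
      then show ?thesis using above.hyps by simp
    next
      case b: False
      have g: "\<gamma> \<noteq> ?a"
      proof
        assume "\<gamma> = ?a"
        then have "omega (s # cs) \<beta> \<gamma> \<le> 0"
          using omega_initial(1)[OF above.hyps(1) c(4) A(1)] unfolding omega_def by simp
        then show False using A by simp
      qed
      have l: "lin a \<beta> b \<gamma> \<noteq> ?a" using simple_extremal[OF above.hyps(2) A(1,2), of a b] A b g by auto
      have lPR: "lin a \<beta> b \<gamma> \<in> PR" using A RW by auto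
      have sup: "supp_in (set (s # cs)) \<beta>" "supp_in (set (s # cs)) \<gamma>"
        using supp_lin_pos[OF A(1-4), of "set (s # cs)"] WpD(2)[OF above.hyps(5) A(5)] by auto
      have "refl s \<beta> \<in> tog s R"
      proof (rule alignedD[OF al])
        show "refl s \<beta> \<in> PR" "refl s \<gamma> \<in> PR" using PR_refl[OF above.hyps(2)] A b g by auto
        show "lin a (refl s \<beta>) b (refl s \<gamma>) \<in> tog s R"
          using tog_mem[OF above.hyps(2) PR_refl[OF above.hyps(2) lPR l] refl_PR_ne[OF above.hyps(2) lPR]] A above.hyps(2)
          by (simp add: refl_lin[symmetric])
        show "0 < omega (cs @ [s]) (refl s \<beta>) (refl s \<gamma>)" using omega_rotate[OF c(3,4) sup] A by simp
      qed (use A in auto)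
      then show ?thesis
        using tog_mem[OF above.hyps(2) PR_refl[OF above.hyps(2) A(1) b] refl_PR_ne[OF above.hyps(2) A(1)]] above.hyps(2) by simp
    qed
  qed
next
  case (below s cs R)
  have "P cs (par (set cs) R) = R" using below.prems P_below[OF below.hyps(6)] by simp
  then have "R \<in> Wp (set cs)" using P_Wp[OF below.hyps(7,3,4)] by simp
  then have p: "par (set cs) R = R" by (rule par_id)
  then have al: "aligned cs R" using below.IH \<open>P cs (par (set cs) R) = R\<close> by simp
  show ?case unfolding aligned_def
  proof (intro ballI allI impI)
    fix \<beta> \<gamma> and a b :: real
    assume A: "\<beta> \<in> PR" "\<gamma> \<in> PR" "0 < a" "0 < b" "lin a \<beta> b \<gamma> \<in> R" "0 < omega (s # cs) \<beta> \<gamma>"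
    note sup = supp_lin_pos[OF A(1-4) WpD(2)[OF \<open>R \<in> Wp (set cs)\<close> A(5)]]
    have "\<beta> s = 0" "\<gamma> s = 0" using sup below.hyps(1) by (auto simp: supp_in_def)
    then show "\<beta> \<in> R" using alignedD[OF al A(1-5)] A(6) omega_restrict by simp
  qed
qed

lemma omega_sum_right:
  assumes "finite I"
  shows "omega cs u (\<lambda>r. v r + (\<Sum>i\<in>I. a i * \<delta> i r)) = omega cs u v + (\<Sum>i\<in>I. a i * omega cs u (\<delta> i))"
  using assms
proof (induction I)
  case empty
  then show ?case by simp
next
  case (insert i I)
  have "(\<lambda>r. v r + (\<Sum>j\<in>insert i I. a j * \<delta> j r)) = lin 1 (\<lambda>r. v r + (\<Sum>j\<in>I. a j * \<delta> j r)) (a i) (\<delta> i)"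
    using insert.hyps by (auto simp: lin_def)
  then have "omega cs u (\<lambda>r. v r + (\<Sum>j\<in>insert i I. a j * \<delta> j r))
      = omega cs u (\<lambda>r. v r + (\<Sum>j\<in>I. a j * \<delta> j r)) + a i * omega cs u (\<delta> i)"
    by (simp add: omega_def euler_lin_left euler_lin_right algebra_simps)
  then show ?case using insert by simp
qed

text \<open>The difficulty is the lower branch, where alignment must force all roots of
  \<open>R\<close> to vanish at \<open>s\<close>. Otherwise \<open>W_descend\<close> gives a root
  \<open>t\<close> of \<open>R\<close> that exceeds \<open>simple_root s\<close> by multiples of
  roots \<open>\<delta> i\<close>, where subtracting a positive multiple of any
  \<open>\<delta> i\<close> from \<open>t\<close> leads out of \<open>R\<close>. Alignment forbids
  this for one of them.\<close>

lemma aligned_sortable: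
  assumes "R \<in> Wp (set cs)" "distinct cs \<and> set cs \<subseteq> S" "aligned cs R"
  shows "P cs R = R"
  using assms
proof (induction cs R rule: P_induct)
  case (Nil R)
  have "R = {}"
  proof (rule ccontr)
    assume "R \<noteq> {}"
    then obtain \<beta> where b: "\<beta> \<in> R" by auto
    then show False using PR_nonzero[of \<beta>] Wp_PR[OF Nil(1)] WpD(2)[OF Nil(1) b] by (auto simp: supp_in_def)
  qed
  then show ?case by simp
next
  case (above s cs R)
  let ?a = "simple_root s"
  have RW: "R \<in> W" "R \<subseteq> PR" using WpD(1) Wp_PR above.hyps by blast+
  have c: "distinct (cs @ [s])" "set (cs @ [s]) \<subseteq> S" "distinct (s # cs)" "set (s # cs) \<subseteq> S" using above.hyps by auto
  have tPR: "tog s R \<subseteq> PR" using tog_PR[OF RW(2) above.hyps(2)] .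
  have "aligned (cs @ [s]) (tog s R)" unfolding aligned_def
  proof (intro ballI allI impI)
    fix \<beta> \<gamma> and a b :: real
    assume A: "\<beta> \<in> PR" "\<gamma> \<in> PR" "0 < a" "0 < b" "lin a \<beta> b \<gamma> \<in> tog s R" "0 < omega (cs @ [s]) \<beta> \<gamma>"
    have lPR: "lin a \<beta> b \<gamma> \<in> PR" using A tPR by auto
    have l: "lin a \<beta> b \<gamma> \<noteq> ?a" using A above.hyps by auto
    have rl: "refl s (lin a \<beta> b \<gamma>) \<in> R" using tog_mem[OF above.hyps(2) lPR l] A by simp
    have b: "\<beta> \<noteq> ?a"
      using omega_final[OF above.hyps(1,3) c(4) A(2)] A by auto
    have rb: "refl s \<beta> \<in> PR" by (rule PR_refl[OF above.hyps(2) A(1) b])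
    have sup: "supp_in (set (s # cs)) \<beta>" "supp_in (set (s # cs)) \<gamma>"
      using supp_lin_pos[OF A(1-4), of "set (s # cs)"] WpD(2)[OF above.hyps(7) A(5)] by auto
    have "refl s \<beta> \<in> R"
    proof (cases "\<gamma> = ?a")
      case True
      \<comment> \<open>A triple with \<open>\<gamma> = ?a\<close> does not reflect to positive
        roots; convexity of \<open>R\<close>, which contains \<open>?a\<close>, takes the place of
        alignment.\<close>
      have "refl s \<beta> = lin (1/a) (refl s (lin a \<beta> b ?a)) (b/a) ?a"
        unfolding refl_lin refl_simple[OF above.hyps(2)] using A by (auto simp: lin_def field_simps)
      then show ?thesis using W_convex[OF RW(1) rl above.hyps(6), of "1/a" "b/a"] A rb True by auto
    next
      case False
      show ?thesis
      proof (rule alignedD[OF above.prems rb PR_refl[OF above.hyps(2) A(2) False] A(3,4)])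
        show "lin a (refl s \<beta>) b (refl s \<gamma>) \<in> R" using rl by (simp add: refl_lin)
        have "omega (cs @ [s]) (refl s (refl s \<beta>)) (refl s (refl s \<gamma>)) = omega (s # cs) (refl s \<beta>) (refl s \<gamma>)"
          by (rule omega_rotate[OF c(3,4)]) (use sup supp_in_refl in auto)
        then show "0 < omega (s # cs) (refl s \<beta>) (refl s \<gamma>)" using A above.hyps(2) by simp
      qed
    qed
    then show "\<beta> \<in> tog s R" using tog_mem[OF above.hyps(2) A(1) b] by simp
  qed
  then have "P (cs @ [s]) (tog s R) = tog s R" by (rule above.IH)
  then show ?case using P_above[OF RW(1) above.hyps(6)] RW above.hyps(2) by simp
next
  case (below s cs R)
  let ?a = "simple_root s"
  have c: "distinct (s # cs)" "set (s # cs) \<subseteq> S" using below.hyps by auto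
  have RW: "R \<in> W" by (rule WpD(1)[OF below.hyps(5)])
  have p: "R = par (set cs) R"
  proof (rule ccontr)
    assume ne: "R \<noteq> par (set cs) R"
    have "\<exists>t\<in>R. \<exists>(I::nat set) a a' \<delta>. finite I \<and> t s = 1 \<and>
          t = (\<lambda>r. ?a r + (\<Sum>i\<in>I. a i * \<delta> i r)) \<and>
          (\<forall>i\<in>I. 0 \<le> a i \<and> 0 < a' i \<and> \<delta> i \<in> PR \<and> lin 1 t (- a' i) (\<delta> i) \<in> PR - R)"
      by (rule W_descend[OF RW below.hyps(2,4,1) _ below.hyps(6) ne]) (simp add: par_id[OF below.hyps(5)])
    then obtain t and I :: "nat set" and a a' \<delta> where t: "t \<in> R" "finite I" "t s = 1"
      "t = (\<lambda>r. ?a r + (\<Sum>i\<in>I. a i * \<delta> i r))"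
      and I: "\<And>i. i \<in> I \<Longrightarrow> 0 \<le> a i \<and> 0 < a' i \<and> \<delta> i \<in> PR \<and> lin 1 t (- a' i) (\<delta> i) \<in> PR - R"
      by blast
    have tPR: "t \<in> PR" using W_PR[OF RW] t by auto
    \<comment> \<open>If it vanished, \<open>coroot s t\<close> would be \<open>2 * t s = 2\<close>,
      and the positive root \<open>refl s t\<close> would have coordinate -1 at
      \<open>s\<close>.\<close>
    have "omega (s # cs) ?a t \<noteq> 0"
    proof
      assume "omega (s # cs) ?a t = 0"
      then have "(\<Sum>r\<in>set cs. A s r * t r) = 0"
        using omega_initial(2)[OF below.hyps(1) c(2) tPR] sum_A_sym[OF c(2), of t] by simp
      then have "coroot s t = 2"
        using coroot_supp[OF below.hyps(1) c(2)] WpD(2)[OF below.hyps(5) t(1)] t(3) by simp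
      then have "refl s t s = -1" using t(3) by (simp add: refl_same)
      moreover have "t \<noteq> ?a" using t(1) below.hyps(6) by auto
      then have "0 \<le> refl s t s" by (rule PR_nonneg[OF PR_refl[OF below.hyps(2) tPR]])
      ultimately show False by simp
    qed
    then have "omega (s # cs) ?a t > 0" using omega_initial(1)[OF below.hyps(1) c(2) tPR] by simp
    then have "omega (s # cs) t ?a < 0" by (simp add: omega_def)
    \<comment> \<open>In the expansion of \<open>omega (s # cs) t t = 0\<close> the term of
      \<open>?a\<close> is negative, so some \<open>\<delta> i\<close> pairs positively with
      \<open>t\<close>.\<close>
    moreover have "omega (s # cs) t t = omega (s # cs) t ?a + (\<Sum>i\<in>I. a i * omega (s # cs) t (\<delta> i))"
      using omega_sum_right[OF t(2), of "s # cs" t ?a a \<delta>] t(4) by simp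
    moreover have "omega (s # cs) t t = 0" by (simp add: omega_def)
    ultimately have "\<not> (\<Sum>i\<in>I. a i * omega (s # cs) t (\<delta> i)) \<le> 0" by linarith
    then obtain i where i: "i \<in> I" "a i * omega (s # cs) t (\<delta> i) > 0"
      using sum_nonpos[of I "\<lambda>i. a i * omega (s # cs) t (\<delta> i)"] by force
    then have om: "omega (s # cs) t (\<delta> i) > 0" using I[OF i(1)] by (simp add: zero_less_mult_iff)
    let ?b = "lin 1 t (- a' i) (\<delta> i)"
    have "?b \<in> R"
    proof (rule alignedD[OF below.prems, of ?b "\<delta> i" 1 "a' i"])
      have "lin 1 ?b (a' i) (\<delta> i) = t" by (simp add: lin_def)
      then show "lin 1 ?b (a' i) (\<delta> i) \<in> R" using t by simp
      show "0 < omega (s # cs) ?b (\<delta> i)"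
        using om unfolding omega_def euler_lin_left euler_lin_right by simp
    qed (use I[OF i(1)] in auto)
    then show False using I[OF i(1)] by auto
  qed
  have "aligned cs (par (set cs) R)" by (rule aligned_par[OF below.hyps(5,1) below.prems])
  then have "P cs (par (set cs) R) = par (set cs) R" by (rule below.IH)
  then show ?case using P_below[OF below.hyps(6)] p by simp
qed

text \<open>The restriction of an image is again aligned, hence fixed by \<open>P cs\<close>, and
  monotonicity compares it with \<open>par (set cs) R\<close>.\<close>

lemma par_P_le:
  assumes "R \<in> Wp (insert s (set cs))" "s \<notin> set cs" "s \<in> S" "distinct cs" "set cs \<subseteq> S"
  shows "par (set cs) (P (s # cs) R) \<subseteq> P cs (par (set cs) R)"
proof -
  let ?V = "P (s # cs) R"
  have R: "R \<in> Wp (set (s # cs))" and c: "distinct (s # cs)" "set (s # cs) \<subseteq> S" using assms by auto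
  have V: "?V \<in> Wp (insert s (set cs))" using P_Wp[OF R c] by simp
  have pV: "par (set cs) ?V \<in> Wp (set cs)" by (rule par_Wp[OF WpD(1)[OF V] assms(5)])
  have "aligned (s # cs) ?V"
    by (rule sortable_aligned) (use P_Wp[OF R c] P_idem[OF R c] c in auto)
  then have "aligned cs (par (set cs) ?V)" by (rule aligned_par[OF V assms(2)])
  then have "P cs (par (set cs) ?V) = par (set cs) ?V"
    by (intro aligned_sortable) (use pV assms in auto)
  moreover have "P cs (par (set cs) ?V) \<subseteq> P cs (par (set cs) R)"
    by (rule P_mono[OF assms(4,5) pV par_Wp[OF WpD(1)[OF R] assms(5)] par_mono[OF P_le[OF R c]]])
  ultimately show ?thesis by simp
qed

section \<open>Compatibility of the projection with meets and joins\<close>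

text \<open>Otherwise a root \<open>k\<close> with \<open>k s > 0\<close> can be removed from
  \<open>V\<close>. In the polygon below \<open>V\<close> this \<open>k\<close> is the bottom root
  opposite to \<open>?a\<close>, and the Euler form is positive at the pair, so the edge at
  \<open>k\<close> is contracted, which contradicts \<open>P (cs @ [s]) Y = Y\<close>. Thus
  \<open>V\<close> is the join of \<open>{simple_root s}\<close> and its restriction.\<close>

lemma join_bound:
  assumes s: "s \<notin> set cs" "s \<in> S" and cs: "distinct cs" "set cs \<subseteq> S"
    and V: "V \<in> Wp (insert s (set cs))" "P (s # cs) V = V" "V = insert (simple_root s) Y" "Y \<in> W" "simple_root s \<notin> Y"
    and z: "z \<in> W" "simple_root s \<in> z" "par (set cs) V \<subseteq> z" "z \<subseteq> V"
  shows "z = V"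
proof (rule ccontr)
  let ?a = "simple_root s" and ?c = "cs @ [s]"
  assume "z \<noteq> V"
  then have "z \<subset> V" using z by auto
  have VW: "V \<in> W" by (rule WpD(1)[OF V(1)])
  obtain k where k: "k \<in> V" "k \<notin> z" "V - {k} \<in> W" using W_down[OF z(1) VW \<open>z \<subset> V\<close>] by auto
  have ka: "k \<noteq> ?a" using k z by auto
  have kY: "k \<in> Y" using k V ka by auto
  have kPR: "k \<in> PR" using W_PR[OF VW] k by auto
  have ks: "k s > 0"
  proof -
    have "\<not> supp_in (set cs) k" using k z by (auto simp: par_def)
    then have "k s \<noteq> 0" using Wp_supp_iff[OF V(1) s(1) k(1)] by simp
    then show ?thesis using PR_nonneg[OF kPR, of s] by simp
  qed
  have c: "distinct ?c" "set ?c \<subseteq> S" using s cs by auto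
  have VWp: "V \<in> Wp (set ?c)" using V by simp
  have "\<exists>R0 p q. R0 \<in> W \<and> insert p R0 \<in> W \<and> insert q R0 \<in> W \<and> p \<notin> R0 \<and> q \<notin> R0 \<and> p \<noteq> q \<and>
          R0 \<subseteq> V \<inter> Y \<inter> (V - {k}) \<and> V \<union> Y \<union> (V - {k}) \<subseteq> R0 \<union> {\<beta> \<in> PR. \<exists>a\<ge>0. \<exists>b\<ge>0. \<beta> = lin a p b q}"
  proof (rule W_polygon[OF VW V(4) k(3)])
    show "Y \<noteq> V - {k}" using kY by auto
    show "\<exists>\<beta>. \<beta> \<notin> V \<inter> Y \<and> (Y = insert \<beta> V \<or> V = insert \<beta> Y) \<and> Y \<noteq> V"
      by (rule exI[of _ ?a]) (use V in auto)
    show "\<exists>\<beta>. \<beta> \<notin> V \<inter> (V - {k}) \<and> (V - {k} = insert \<beta> V \<or> V = insert \<beta> (V - {k})) \<and> V - {k} \<noteq> V"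
      by (rule exI[of _ k]) (use k in auto)
  qed
  then obtain R0 p' q' where pq: "R0 \<in> W" "insert p' R0 \<in> W" "insert q' R0 \<in> W" "p' \<notin> R0" "q' \<notin> R0" "p' \<noteq> q'"
    "R0 \<subseteq> Y" "k \<notin> R0" "V \<subseteq> R0 \<union> cone p' q'" unfolding cone_def[symmetric] by blast
  have pq': "p' \<in> PR" "q' \<in> PR" using W_PR[OF pq(2)] W_PR[OF pq(3)] by auto
  have "?a \<in> cone p' q'" using pq V by auto
  then have "?a = p' \<or> ?a = q'" using simple_cone[OF s(2) pq'] by simp
  then obtain p where p: "insert p R0 \<in> W" "insert ?a R0 \<in> W" "p \<notin> R0" "?a \<notin> R0" "p \<noteq> ?a" "V \<subseteq> R0 \<union> cone p ?a"
    using pq cone_comm[of p' q'] by auto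
  have pPR: "p \<in> PR" "?a \<in> PR" using W_PR[OF p(1)] PR_simple[OF s(2)] by auto
  have kc: "k \<in> cone p ?a" using k p pq by auto
  then have pY: "p \<in> Y" using coconvex_cone[OF V(4) pPR kc kY] V by auto
  \<comment> \<open>\<open>V - {k}\<close> is convex and contains \<open>?a\<close>; if it also
    contained \<open>p\<close>, it would contain the whole cone and with it
    \<open>k\<close>.\<close>
  have kp: "k = p"
  proof (rule ccontr)
    assume "k \<noteq> p"
    then have "cone p ?a \<subseteq> V - {k}" by (intro convex_cone[OF k(3)]) (use pY V ka in auto)
    then show False using kc by auto
  qed
  note sub = Wp_sub[OF VWp]
  have Wps: "R0 \<in> Wp (set ?c)" "insert p R0 \<in> Wp (set ?c)" "insert ?a R0 \<in> Wp (set ?c)" "Y \<in> Wp (set ?c)"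
    using sub[OF pq(1)] sub[OF p(1)] sub[OF p(2)] sub[OF V(4)] pq(7) pY V by auto
  have tY: "tog s V = Y" using tog_insert_simple[OF s(2) V(4) _ V(5)] VW V(3) by simp
  have "tog s (P ?c Y) = V" using P_above[OF VW, of s cs] V tY by auto
  then have YY: "P ?c Y = Y" using tY tog_tog[OF Wp_PR[OF P_Wp[OF Wps(4) c]] s(2)] by simp
  have "P ?c R0 \<noteq> P ?c (insert p R0)"
  proof
    assume eq: "P ?c R0 = P ?c (insert p R0)"
    have "P ?c Y = P ?c R0"
      by (rule poly_contract[where p = p and q = ?a])
        (use Wps c eq p pq(7) pPR V s in auto)
    then have "Y \<subseteq> R0" using YY P_le[OF Wps(1) c] by simp
    then show False using pY p by auto
  qed
  \<comment> \<open>The edge at \<open>?a\<close> is kept and the form at \<open>(p, ?a)\<close> is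
    \<open>p s\<close>, which is positive because \<open>p = k\<close>.\<close>
  moreover have "P ?c R0 = P ?c (insert p R0)"
  proof (rule poly_bottom[OF Wps(1) _ Wps(3,2)])
    show "0 < euler ?c p ?a" using euler_final[of s cs p] s cs ks kp by simp
    show "P ?c R0 \<noteq> P ?c (insert ?a R0)"
      by (rule simple_keep[OF mono_upto_all _ c Wps(1,3) p(4) lessI]) simp
  qed (use c p in auto)
  ultimately show False by simp
qed

text \<open>Joining with \<open>simple_root s\<close> does not change the restriction of
  \<open>b\<close>, so the restriction of \<open>?V\<close> lies in \<open>P (s # cs) b\<close> and
  hence in \<open>U\<close>. The meet of \<open>?V\<close> and \<open>U\<close> thus contains this
  restriction and \<open>simple_root s\<close>, and \<open>join_bound\<close> identifies it with
  \<open>?V\<close>.\<close>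

lemma join_simple:
  assumes s: "s \<notin> set cs" "s \<in> S" and cs: "distinct cs" "set cs \<subseteq> S"
    and b: "b \<in> Wp (insert s (set cs))" "simple_root s \<notin> b"
    and g: "is_join g {b, {simple_root s}}" "g \<in> Wp (insert s (set cs))"
    and U: "U \<in> W" "simple_root s \<in> U" "P (s # cs) b \<subseteq> U"
  shows "P (s # cs) g \<subseteq> U"
proof -
  let ?a = "simple_root s"
  let ?V = "P (s # cs) g"
  have gW: "g \<in> W" and ag: "?a \<in> g" "b \<subseteq> g" using is_joinD(1,2)[OF g(1)] by auto
  obtain H where H: "H \<in> W" "b \<subseteq> H" "?a \<notin> H" "insert ?a H \<in> W" "insert ?a H \<subseteq> g"
    by (rule maximal_avoiding[OF WpD(1)[OF b(1)] ag(2) b(2) gW ag(1)])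
  have "g \<subseteq> insert ?a H" by (rule is_joinD(3)[OF g(1) H(4)]) (use H in auto)
  then have gH: "g = insert ?a H" using H by auto
  have HWp: "H \<in> Wp (insert s (set cs))" by (rule Wp_sub[OF g(2) H(1)]) (use gH in auto)
  have g': "g \<in> Wp (set (s # cs))" and c: "distinct (s # cs)" "set (s # cs) \<subseteq> S" using g s cs by auto
  define Y where "Y = P (cs @ [s]) H"
  have V: "?V = insert ?a Y"
    using cover_proj[OF mono_upto_all s cs HWp H(3) _ order_refl] g(2) gH Y_def by simp
  have Hc: "H \<in> Wp (set (cs @ [s]))" using HWp by simp
  have YW: "Y \<in> W" unfolding Y_def by (rule WpD(1)[OF P_Wp[OF Hc]]) (use s cs in auto)
  have aY: "?a \<notin> Y" using P_le[OF Hc] H(3) s cs Y_def by auto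
  have VWp: "?V \<in> Wp (insert s (set cs))" using P_Wp[OF g' c] by simp
  have VW: "?V \<in> W" by (rule WpD(1)[OF VWp])
  have bp: "par (set cs) b \<in> W" by (rule W_par[OF WpD(1)[OF b(1)] cs(2)])
  have "par (set cs) g \<subseteq> par (set cs) b"
  proof (rule par_join[OF g(1) _ cs(2) bp])
    show "{b, {?a}} \<subseteq> W" using WpD(1)[OF b(1)] simple_W[OF s(2)] by auto
    show "par (set cs) R \<subseteq> par (set cs) b" if "R \<in> {b, {?a}}" for R
      using that s by (auto simp: par_def)
  qed
  then have "P cs (par (set cs) g) \<subseteq> P cs (par (set cs) b)"
    by (rule P_mono[OF cs par_Wp[OF gW cs(2)] par_Wp[OF WpD(1)[OF b(1)] cs(2)]])
  then have pVU: "par (set cs) ?V \<subseteq> U"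
    using par_P_le[OF g(2) s cs] P_below[OF b(2), of cs] U(3) by auto
  obtain z where z: "is_meet z {?V, U}" using meet_exists[of "{?V, U}"] VW U by auto
  have "par (set cs) ?V \<subseteq> z"
    by (rule is_meetD(3)[OF z W_par[OF VW cs(2)]]) (use pVU par_subset in auto)
  moreover have "{?a} \<subseteq> z"
    by (rule is_meetD(3)[OF z simple_W[OF s(2)]]) (use V U in auto)
  ultimately have "z = ?V"
    using join_bound[OF s cs VWp P_idem[OF g' c] V YW aY is_meetD(1)[OF z]] is_meetD(2)[OF z, of ?V] by auto
  then show ?thesis using is_meetD(2)[OF z, of U] by auto
qed

lemma tog_mono_above:
  assumes "s \<in> S" "X \<subseteq> Y" "Y \<subseteq> PR" "simple_root s \<in> X"
  shows "tog s X \<subseteq> tog s Y"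
  by (rule tog_mono) (use assms in auto)

lemma tog_mono_below:
  assumes "s \<in> S" "X \<subseteq> Y" "Y \<subseteq> PR" "simple_root s \<notin> Y"
  shows "tog s X \<subseteq> tog s Y"
  by (rule tog_mono) (use assms in auto)

text \<open>In the upper branch the lower bound \<open>R\<close> is first joined with
  \<open>simple_root s\<close>, so that toggling respects inclusions. In the lower branch some
  member omits \<open>simple_root s\<close>, which confines \<open>R\<close> to the support
  \<open>set cs\<close>; \<open>par_P_le\<close> handles the members that contain it.\<close>

lemma P_meet:
  assumes "M \<in> Wp (set cs)" "distinct cs \<and> set cs \<subseteq> S"
    and "is_meet M X" "X \<subseteq> Wp (set cs)" "X \<noteq> {}" "R \<in> W" "\<And>a. a \<in> X \<Longrightarrow> R \<subseteq> P cs a"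
  shows "R \<subseteq> P cs M"
  using assms
proof (induction cs M arbitrary: X R rule: P_induct)
  case (Nil M)
  then show ?case by force
next
  case (above s cs M)
  let ?a = "simple_root s" and ?c = "cs @ [s]"
  note sS = above.hyps(2)
  have c: "distinct ?c" "set ?c \<subseteq> S" using above.hyps by auto
  have J: "s \<in> insert s (set cs)" "insert s (set cs) \<subseteq> S" using above.hyps by auto
  have X: "a \<in> Wp (insert s (set cs))" "a \<in> W" "a \<subseteq> PR" "?a \<in> a" if "a \<in> X" for a
  proof -
    show "a \<in> Wp (insert s (set cs))" using above.prems that by auto
    then show "a \<in> W" "a \<subseteq> PR" by (rule WpD(1), rule Wp_PR)
    show "?a \<in> a" using is_meetD(2)[OF above.prems(1) that] above.hyps by auto
  qed
  have ta: "tog s a \<in> Wp (set ?c)" if "a \<in> X" for a using tog_Wp[OF X(1)[OF that] J] by simp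
  have Pa: "P (s # cs) a = tog s (P ?c (tog s a))" if "a \<in> X" for a by (rule P_above[OF X(2,4)[OF that]])
  have PaW: "P (s # cs) a \<in> W" "?a \<in> P (s # cs) a" "tog s (P (s # cs) a) = P ?c (tog s a)" if "a \<in> X" for a
  proof -
    have aw: "a \<in> Wp (set (s # cs))" "distinct (s # cs)" "set (s # cs) \<subseteq> S" using X(1)[OF that] above.hyps by auto
    show "P (s # cs) a \<in> W" by (rule WpD(1)[OF P_Wp[OF aw]])
    show "?a \<in> P (s # cs) a" using P_mem_iff[OF aw] X(4)[OF that] by simp
    show "tog s (P (s # cs) a) = P ?c (tog s a)"
      using Pa[OF that] tog_tog[OF Wp_PR[OF P_Wp[OF ta[OF that] c]] sS] by simp
  qed
  obtain a0 where a0: "a0 \<in> X" using above.prems by auto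
  obtain R2 where R2: "is_join R2 {R, {?a}}"
    using join_exists[of "{R, {?a}}" "P (s # cs) a0"] above.prems(4,5) PaW[OF a0] simple_W[OF sS] a0 by auto
  have R2W: "R2 \<in> W" and R2a: "?a \<in> R2" "R \<subseteq> R2" using is_joinD(1,2)[OF R2] by auto
  have R2P: "R2 \<subseteq> P (s # cs) a" if "a \<in> X" for a
    by (rule is_joinD(3)[OF R2 PaW(1)[OF that]]) (use above.prems(5)[OF that] PaW[OF that] in auto)
  have mt: "is_meet (tog s M) (tog s ` X)" unfolding is_meet_def
  proof (intro conjI ballI impI)
    show "tog s M \<in> W" using WpD(1) above.hyps by blast
    show "tog s M \<subseteq> Z" if "Z \<in> tog s ` X" for Z
    proof -
      from that obtain a where a: "a \<in> X" "Z = tog s a" by blast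
      show ?thesis unfolding a(2)
        by (rule tog_mono_above[OF sS is_meetD(2)[OF above.prems(1) a(1)] X(3)[OF a(1)] above.hyps(6)])
    qed
    fix Z assume Z: "Z \<in> W" "\<forall>R\<in>tog s ` X. Z \<subseteq> R"
    have aZ: "?a \<notin> Z" using Z(2) a0 tog_mem_simple[OF sS X(3)[OF a0]] X(4)[OF a0] by auto
    have ZPR: "Z \<subseteq> PR" by (rule W_PR[OF Z(1)])
    have "tog s Z \<subseteq> M"
    proof (rule is_meetD(3)[OF above.prems(1) tog_W[OF Z(1) sS]])
      fix a assume a: "a \<in> X"
      have "tog s Z \<subseteq> tog s (tog s a)"
        by (rule tog_mono_below[OF sS _ tog_PR[OF X(3)[OF a] sS]])
          (use Z a tog_mem_simple[OF sS X(3)[OF a]] X(4)[OF a] in auto)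
      then show "tog s Z \<subseteq> a" using X(3)[OF a] sS by simp
    qed
    then have "tog s (tog s Z) \<subseteq> tog s M"
      by (rule tog_mono_above[OF sS _ Wp_PR[OF above.hyps(5)]]) (use tog_mem_simple[OF sS ZPR] aZ in auto)
    then show "Z \<subseteq> tog s M" using ZPR sS by simp
  qed
  have "tog s R2 \<subseteq> P ?c (tog s M)"
  proof (rule above.IH[OF mt])
    show "tog s ` X \<subseteq> Wp (set ?c)" using ta by auto
    show "tog s ` X \<noteq> {}" using a0 by auto
    show "tog s R2 \<in> W" by (rule tog_W[OF R2W sS])
    fix Z assume "Z \<in> tog s ` X"
    then obtain a where a: "a \<in> X" "Z = tog s a" by blast
    have "tog s R2 \<subseteq> tog s (P (s # cs) a)"
      by (rule tog_mono_above[OF sS R2P[OF a(1)] W_PR[OF PaW(1)[OF a(1)]] R2a(1)])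
    then show "tog s R2 \<subseteq> P ?c Z" using PaW(3)[OF a(1)] a by simp
  qed
  then have "tog s (tog s R2) \<subseteq> tog s (P ?c (tog s M))"
    by (rule tog_mono_below[OF sS])
      (use Wp_PR[OF P_Wp[of "tog s M" ?c]] P_le[of "tog s M" ?c] above.hyps c in auto)
  then show ?case
    using R2a W_PR[OF R2W] sS P_above[OF WpD(1)[OF above.hyps(5)] above.hyps(6), of cs] by auto
next
  case (below s cs M)
  let ?a = "simple_root s"
  note sS = below.hyps(2)
  have X: "a \<in> Wp (insert s (set cs))" "a \<in> W" if "a \<in> X" for a
  proof -
    show "a \<in> Wp (insert s (set cs))" using below.prems that by auto
    then show "a \<in> W" by (rule WpD(1))
  qed
  have pa: "par (set cs) a \<in> Wp (set cs)" if "a \<in> X" for a by (rule par_Wp[OF X(2)[OF that] below.hyps(4)])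
  \<comment> \<open>If every member contained \<open>?a\<close>, the meet would contain it
    too.\<close>
  obtain a0 where a0: "a0 \<in> X" "?a \<notin> a0"
  proof (rule ccontr)
    assume "\<not> thesis"
    then have "{?a} \<subseteq> M" by (intro is_meetD(3)[OF below.prems(1) simple_W[OF sS]]) (use that in auto)
    then show False using below.hyps by auto
  qed
  have "R \<subseteq> P cs (par (set cs) a0)" using below.prems(5)[OF a0(1)] P_below[OF a0(2)] by simp
  then have RWp: "R \<in> Wp (set cs)" by (rule Wp_sub[OF P_Wp[OF pa[OF a0(1)] below.hyps(3,4)] below.prems(4)])
  have "R \<subseteq> P cs (par (set cs) M)"
  proof (rule below.IH[of "par (set cs) ` X"])
    show "is_meet (par (set cs) M) (par (set cs) ` X)" unfolding is_meet_def
    proof (intro conjI ballI impI)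
      show "par (set cs) M \<in> W" by (rule WpD(1)[OF below.hyps(7)])
      show "par (set cs) M \<subseteq> Z" if "Z \<in> par (set cs) ` X" for Z
        using that par_mono is_meetD(2)[OF below.prems(1)] by auto
      fix Z assume Z: "Z \<in> W" "\<forall>R\<in>par (set cs) ` X. Z \<subseteq> R"
      have "Z \<subseteq> M" by (rule is_meetD(3)[OF below.prems(1) Z(1)]) (use Z par_subset in blast)
      moreover have "Z \<subseteq> par (set cs) a0" using Z a0 by auto
      ultimately show "Z \<subseteq> par (set cs) M" by (auto simp: par_def)
    qed
    show "par (set cs) ` X \<subseteq> Wp (set cs)" using pa by auto
    show "par (set cs) ` X \<noteq> {}" using a0 by auto
    show "R \<in> W" by fact
    fix Z assume "Z \<in> par (set cs) ` X"
    then obtain a where a: "a \<in> X" "Z = par (set cs) a" by blast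
    have "par (set cs) R \<subseteq> par (set cs) (P (s # cs) a)" by (rule par_mono[OF below.prems(5)[OF a(1)]])
    then show "R \<subseteq> P cs Z"
      using par_id[OF RWp] par_P_le[OF X(1)[OF a(1)] below.hyps(1-4)] a by auto
  qed
  then show ?case using P_below[OF below.hyps(6)] by simp
qed

text \<open>In the upper branch some member contains \<open>simple_root s\<close> by
  \<open>join_avoid\<close>, hence so does \<open>U\<close>. Every member is replaced by its join
  with \<open>simple_root s\<close>: \<open>join_simple\<close> keeps \<open>U\<close> an upper
  bound of the images, and toggling the new family gives one with join
  \<open>tog s M\<close>.\<close>

lemma P_join:
  assumes "M \<in> Wp (set cs)" "distinct cs \<and> set cs \<subseteq> S"
    and "is_join M X" "X \<subseteq> Wp (set cs)" "U \<in> W" "\<And>a. a \<in> X \<Longrightarrow> P cs a \<subseteq> U"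
  shows "P cs M \<subseteq> U"
  using assms
proof (induction cs M arbitrary: X U rule: P_induct)
  case (Nil M)
  then show ?case by simp
next
  case (above s cs M)
  let ?a = "simple_root s" and ?c = "cs @ [s]"
  note sS = above.hyps(2)
  have c: "distinct ?c" "set ?c \<subseteq> S" "distinct (s # cs)" "set (s # cs) \<subseteq> S" using above.hyps by auto
  have J: "s \<in> insert s (set cs)" "insert s (set cs) \<subseteq> S" using above.hyps by auto
  have MW: "M \<in> W" "M \<subseteq> PR" using WpD(1) Wp_PR above.hyps by blast+
  have X: "a \<in> Wp (insert s (set cs))" "a \<in> W" "a \<subseteq> M" if "a \<in> X" for a
  proof -
    show "a \<in> Wp (insert s (set cs))" using above.prems that by auto
    then show "a \<in> W" by (rule WpD(1))
    show "a \<subseteq> M" by (rule is_joinD(2)[OF above.prems(1) that])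
  qed
  have XW: "X \<subseteq> W" using X by auto
  obtain a0 where a0: "a0 \<in> X" "?a \<in> a0"
    using join_avoid[OF above.prems(1) XW sS] above.hyps(6) by auto
  have aU: "?a \<in> U"
    using P_mem_iff[of a0 s cs] X(1)[OF a0(1)] a0 c above.prems(4)[OF a0(1)] by auto
  have UPR: "U \<subseteq> PR" by (rule W_PR[OF above.prems(3)])
  have "\<exists>g. is_join g {a, {?a}}" if "a \<in> X" for a
    by (rule join_exists[OF _ MW(1)]) (use X[OF that] simple_W[OF sS] above.hyps(6) in auto)
  then obtain g where g: "\<And>a. a \<in> X \<Longrightarrow> is_join (g a) {a, {?a}}" by metis
  have gW: "g a \<in> W" "g a \<subseteq> M" "?a \<in> g a" "a \<subseteq> g a" "g a \<in> Wp (insert s (set cs))" "g a \<subseteq> PR" if "a \<in> X" for a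
  proof -
    show w: "g a \<in> W" "?a \<in> g a" "a \<subseteq> g a" using is_joinD(1,2)[OF g[OF that]] by auto
    show m: "g a \<subseteq> M" by (rule is_joinD(3)[OF g[OF that] MW(1)]) (use X(3)[OF that] above.hyps(6) in auto)
    show "g a \<in> Wp (insert s (set cs))" by (rule Wp_sub[OF above.hyps(5) w(1) m])
    show "g a \<subseteq> PR" using m MW by auto
  qed
  have PgU: "P (s # cs) (g a) \<subseteq> U" if a: "a \<in> X" for a
  proof (cases "?a \<in> a")
    case True
    have "g a \<subseteq> a" by (rule is_joinD(3)[OF g[OF a] X(2)[OF a]]) (use True in auto)
    then have "g a = a" using gW(4)[OF a] by auto
    then show ?thesis using above.prems(4)[OF a] by simp
  next
    case False
    show ?thesis
      by (rule join_simple[OF above.hyps(1-4) X(1)[OF a] False g[OF a] gW(5)[OF a] above.prems(3) aU above.prems(4)[OF a]])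
  qed
  have tg: "tog s (g a) \<in> Wp (set ?c)" "?a \<notin> tog s (g a)" if "a \<in> X" for a
    using tog_Wp[OF gW(5)[OF that] J] tog_mem_simple[OF sS gW(6)[OF that]] gW(3)[OF that] by auto
  have jn: "is_join (tog s M) ((\<lambda>a. tog s (g a)) ` X)" unfolding is_join_def
  proof (intro conjI ballI impI)
    show tM: "tog s M \<in> W" by (rule tog_W[OF MW(1) sS])
    show up: "Z \<subseteq> tog s M" if "Z \<in> (\<lambda>a. tog s (g a)) ` X" for Z
    proof -
      from that obtain a where a: "a \<in> X" "Z = tog s (g a)" by blast
      show ?thesis unfolding a(2) by (rule tog_mono_above[OF sS gW(2)[OF a(1)] MW(2) gW(3)[OF a(1)]])
    qed
    fix Z assume Z: "Z \<in> W" "\<forall>R\<in>(\<lambda>a. tog s (g a)) ` X. R \<subseteq> Z"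
    \<comment> \<open>\<open>Z\<close> may contain \<open>?a\<close>; its meet with
      \<open>tog s M\<close> does not, so toggling back respects inclusions.\<close>
    obtain N where N: "is_meet N {Z, tog s M}" using meet_exists[of "{Z, tog s M}"] Z tM by auto
    have NW: "N \<in> W" and NM: "N \<subseteq> tog s M" and NZ: "N \<subseteq> Z" using is_meetD(1,2)[OF N] by auto
    have NPR: "N \<subseteq> PR" by (rule W_PR[OF NW])
    have aN: "?a \<notin> N" using NM above.hyps by auto
    have "M \<subseteq> tog s N"
    proof (rule is_joinD(3)[OF above.prems(1) tog_W[OF NW sS]])
      fix a assume a: "a \<in> X"
      have "tog s (g a) \<subseteq> N"
        by (rule is_meetD(3)[OF N WpD(1)[OF tg(1)[OF a]]]) (use a Z up in auto)
      then have "tog s (tog s (g a)) \<subseteq> tog s N" by (rule tog_mono_below[OF sS _ NPR aN])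
      then show "a \<subseteq> tog s N" using gW(4,6)[OF a] sS by auto
    qed
    then have "tog s M \<subseteq> tog s (tog s N)"
      by (rule tog_mono_above[OF sS _ tog_PR[OF NPR sS] above.hyps(6)])
    then show "tog s M \<subseteq> Z" using NPR sS NZ by auto
  qed
  have "P ?c (tog s M) \<subseteq> tog s U"
  proof (rule above.IH[OF jn])
    show "(\<lambda>a. tog s (g a)) ` X \<subseteq> Wp (set ?c)" using tg by auto
    show "tog s U \<in> W" by (rule tog_W[OF above.prems(3) sS])
    fix Z assume "Z \<in> (\<lambda>a. tog s (g a)) ` X"
    then obtain a where a: "a \<in> X" "Z = tog s (g a)" by blast
    have e: "P (s # cs) (g a) = tog s (P ?c (tog s (g a)))" by (rule P_above[OF gW(1,3)[OF a(1)]])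
    have QPR: "P ?c (tog s (g a)) \<subseteq> PR" by (rule Wp_PR[OF P_Wp[OF tg(1)[OF a(1)] c(1,2)]])
    have "?a \<notin> P ?c (tog s (g a))" using P_le[OF tg(1)[OF a(1)] c(1,2)] tg(2)[OF a(1)] by auto
    then have "?a \<in> P (s # cs) (g a)" using e tog_mem_simple[OF sS QPR] by simp
    then have "tog s (P (s # cs) (g a)) \<subseteq> tog s U" by (rule tog_mono_above[OF sS PgU[OF a(1)] UPR])
    then show "P ?c Z \<subseteq> tog s U" using e a QPR sS by simp
  qed
  then have "tog s (P ?c (tog s M)) \<subseteq> tog s (tog s U)"
    by (rule tog_mono_below[OF sS _ tog_PR[OF UPR sS]]) (use tog_mem_simple[OF sS UPR] aU in auto)
  then show ?case using UPR sS P_above[OF MW(1) above.hyps(6), of cs] by simp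
next
  case (below s cs M)
  have X: "a \<in> W" "simple_root s \<notin> a" if "a \<in> X" for a
    using below.prems(2) that WpD(1) is_joinD(2)[OF below.prems(1) that] below.hyps(6) by auto
  have "P cs (par (set cs) M) \<subseteq> U"
  proof (rule below.IH[of "par (set cs) ` X"])
    show "is_join (par (set cs) M) (par (set cs) ` X)" unfolding is_join_def
    proof (intro conjI ballI impI)
      show "par (set cs) M \<in> W" by (rule WpD(1)[OF below.hyps(7)])
      show "Z \<subseteq> par (set cs) M" if "Z \<in> par (set cs) ` X" for Z
        using that par_mono is_joinD(2)[OF below.prems(1)] by auto
      show "par (set cs) M \<subseteq> Z" if "Z \<in> W" "\<forall>R\<in>par (set cs) ` X. R \<subseteq> Z" for Z
        by (rule par_join[OF below.prems(1) _ below.hyps(4) that(1)]) (use X that in auto)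
    qed
    show "par (set cs) ` X \<subseteq> Wp (set cs)" using X par_Wp below.hyps(4) by auto
    show "U \<in> W" by fact
    fix Z assume "Z \<in> par (set cs) ` X"
    then obtain a where a: "a \<in> X" "Z = par (set cs) a" by blast
    then show "P cs Z \<subseteq> U" using below.prems(4)[OF a(1)] P_below[OF X(2)[OF a(1)], of cs] by simp
  qed
  then show ?case using P_below[OF below.hyps(6)] by simp
qed

theorem is_meet_P:
  assumes cs: "distinct cs" "set cs = S" and M: "is_meet M X" and X: "X \<subseteq> W" "X \<noteq> {}"
  shows "is_meet (P cs M) (P cs ` X)"
proof -
  have MW: "M \<in> Wp (set cs)" and XW: "X \<subseteq> Wp (set cs)"
    using Wp_S is_meetD(1)[OF M] X cs by auto
  have c: "set cs \<subseteq> S" using cs by simp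
  show ?thesis unfolding is_meet_def
  proof (intro conjI ballI impI)
    show "P cs M \<in> W" by (rule WpD(1)[OF P_Wp[OF MW cs(1) c]])
    show "P cs M \<subseteq> Z" if "Z \<in> P cs ` X" for Z
      using that P_mono[OF cs(1) c MW] XW is_meetD(2)[OF M] by auto
    show "Z \<subseteq> P cs M" if "Z \<in> W" "\<forall>R\<in>P cs ` X. Z \<subseteq> R" for Z
      by (rule P_meet[OF MW _ M XW X(2) that(1)]) (use that cs in auto)
  qed
qed

theorem is_join_P:
  assumes cs: "distinct cs" "set cs = S" and M: "is_join M X" and X: "X \<subseteq> W"
  shows "is_join (P cs M) (P cs ` X)"
proof -
  have MW: "M \<in> Wp (set cs)" and XW: "X \<subseteq> Wp (set cs)"
    using Wp_S is_joinD(1)[OF M] X cs by auto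
  have c: "set cs \<subseteq> S" using cs by simp
  show ?thesis unfolding is_join_def
  proof (intro conjI ballI impI)
    show "P cs M \<in> W" by (rule WpD(1)[OF P_Wp[OF MW cs(1) c]])
    show "Z \<subseteq> P cs M" if "Z \<in> P cs ` X" for Z
      using that P_mono[OF cs(1) c _ MW] XW is_joinD(2)[OF M] by auto
    show "P cs M \<subseteq> Z" if "Z \<in> W" "\<forall>R\<in>P cs ` X. R \<subseteq> Z" for Z
      by (rule P_join[OF MW _ M XW that(1)]) (use that cs in auto)
  qed
qed

text \<open>The projection depends on the word only through the Euler form, since it maps to the largest aligned
  inversion set below.\<close>

lemma P_cong_euler:
  assumes cs: "distinct cs" "set cs \<subseteq> S" and ds: "distinct ds" "set ds = set cs"
    and e: "\<And>u v. euler cs u v = euler ds u v" and R: "R \<in> Wp (set cs)"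
  shows "P cs R = P ds R"
proof -
  have le: "P as R \<subseteq> P bs R"
    if A: "distinct as" "distinct bs" "set as = set cs" "set bs = set cs" "\<And>u v. euler as u v = euler bs u v" for as bs
  proof -
    have R': "R \<in> Wp (set as)" "R \<in> Wp (set bs)" "set as \<subseteq> S" "set bs \<subseteq> S" using R A cs by auto
    let ?X = "P as R"
    have X: "?X \<in> Wp (set as)" by (rule P_Wp[OF R'(1) A(1) R'(3)])
    have "aligned as ?X"
      by (rule sortable_aligned[OF X]) (use A R' P_idem[OF R'(1) A(1) R'(3)] in auto)
    then have "aligned bs ?X" unfolding aligned_def omega_def A(5) .
    then have "P bs ?X = ?X" by (intro aligned_sortable) (use X A R' in auto)
    moreover have "P bs ?X \<subseteq> P bs R"
      by (rule P_mono[OF A(2) R'(4) _ R'(2) P_le[OF R'(1) A(1) R'(3)]]) (use X A in simp)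
    ultimately show ?thesis by simp
  qed
  show ?thesis
  proof
    show "P cs R \<subseteq> P ds R" by (rule le) (use assms in auto)
    show "P ds R \<subseteq> P cs R" by (rule le) (use assms in auto)
  qed
qed


end

section \<open>The symmetric form and the action of words\<close>

context cartan_datum begin

definition bil :: "('a \<Rightarrow> real) \<Rightarrow> ('a \<Rightarrow> real) \<Rightarrow> real" where
  "bil u v = (\<Sum>r\<in>S. u r * coroot r v)"

lemma bil_lin_left: "bil (lin a p b q) v = a * bil p v + b * bil q v"
  by (simp add: bil_def lin_def sum.distrib sum_distrib_left algebra_simps)

lemma bil_lin_right: "bil v (lin a p b q) = a * bil v p + b * bil v q"
  by (simp add: bil_def coroot_lin sum.distrib sum_distrib_left algebra_simps)

lemma bil_simple_left: "s \<in> S \<Longrightarrow> bil (simple_root s) v = coroot s v"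
proof -
  assume s: "s \<in> S"
  have "bil (simple_root s) v = (\<Sum>r\<in>S. if r = s then coroot r v else 0)"
    unfolding bil_def simple_root_def by (rule sum.cong) auto
  then show ?thesis using s finite_S by simp
qed

lemma bil_sym: "bil u v = bil v u"
proof -
  have "bil u v = (\<Sum>r\<in>S. \<Sum>t\<in>S. u r * (A r t * v t))" by (simp add: bil_def coroot_def sum_distrib_left)
  also have "\<dots> = (\<Sum>t\<in>S. \<Sum>r\<in>S. u r * (A r t * v t))" by (rule sum.swap)
  also have "\<dots> = (\<Sum>t\<in>S. \<Sum>r\<in>S. v t * (A t r * u r))"
    by (intro sum.cong refl) (simp add: A_sym)
  finally show ?thesis by (simp add: bil_def coroot_def sum_distrib_left)
qed

lemma bil_refl: "s \<in> S \<Longrightarrow> bil (refl s u) (refl s v) = bil u v"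
proof -
  assume s: "s \<in> S"
  then have "bil w (simple_root s) = coroot s w" for w using bil_sym[of w] bil_simple_left by simp
  then show ?thesis using s
    by (simp add: refl_eq_lin bil_lin_left bil_lin_right bil_simple_left coroot_lin coroot_simple A_diag algebra_simps)
qed

definition act :: "'a list \<Rightarrow> ('a \<Rightarrow> real) \<Rightarrow> 'a \<Rightarrow> real" where
  "act ws v = foldr refl ws v"

lemma act_simps [simp]: "act [] v = v" "act (s # ws) v = refl s (act ws v)"
  "act (us @ ws) v = act us (act ws v)"
  by (simp_all add: act_def)

lemma act_lin: "act ws (lin a p b q) = lin a (act ws p) b (act ws q)"
  by (induction ws) (simp_all add: refl_lin)

lemma act_supp: "ws \<in> lists J \<Longrightarrow> supp_in J v \<Longrightarrow> supp_in J (act ws v)"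
  by (induction ws) (auto simp: supp_in_refl)

lemma act_other: "s \<notin> set ws \<Longrightarrow> act ws v s = v s"
  by (induction ws) auto

lemma act_bil: "ws \<in> lists S \<Longrightarrow> bil (act ws u) (act ws v) = bil u v"
  by (induction ws) (simp_all add: bil_refl)

lemma act_rev: "ws \<in> lists S \<Longrightarrow> act (rev ws) (act ws v) = v"
  by (induction ws arbitrary: v) simp_all

lemma act_neg: "act ws (\<lambda>r. - v r) = (\<lambda>r. - act ws v r)"
  using act_lin[of ws "-1" v 0 v] by (simp add: lin_def)

end

text \<open>For \<open>k > 0\<close> this is the Chebyshev polynomial of the second kind of degree
  \<open>k - 1\<close> at \<open>a / 2\<close>. With \<open>a = - A s t\<close> the values are the
  coordinates of roots in the plane of two simple roots.\<close>

fun cheb :: "real \<Rightarrow> nat \<Rightarrow> real" where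
  "cheb a 0 = 0"
| "cheb a (Suc 0) = 1"
| "cheb a (Suc (Suc k)) = a * cheb a (Suc k) - cheb a k"

lemma cheb_sin: "sin x * cheb (2 * cos x) k = sin (real k * x)"
proof (induction "2 * cos x" k rule: cheb.induct)
  case (3 k)
  have "sin x * cheb (2 * cos x) (Suc (Suc k)) = 2 * cos x * sin (real (Suc k) * x) - sin (real k * x)"
    using 3 by (simp add: algebra_simps)
  also have "\<dots> = sin (real (Suc (Suc k)) * x)"
  proof -
    have "sin (real (Suc k) * x + x) + sin (real (Suc k) * x - x) = 2 * cos x * sin (real (Suc k) * x)"
      by (simp only: sin_add sin_diff) (simp add: algebra_simps)
    moreover have "real (Suc k) * x + x = real (Suc (Suc k)) * x" "real (Suc k) * x - x = real k * x"
      by (simp_all add: algebra_simps)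
    ultimately show ?thesis by simp
  qed
  finally show ?case .
qed simp_all

lemma cheb_2: "cheb 2 k = real k"
  by (induction "2::real" k rule: cheb.induct) simp_all

lemma rev_in_lists [simp]: "rev ws \<in> lists J \<longleftrightarrow> ws \<in> lists J"
  by (simp add: in_lists_conv_set)

definition alt :: "'a \<Rightarrow> 'a \<Rightarrow> nat \<Rightarrow> 'a list" where
  "alt a b k = map (\<lambda>i. if even i then a else b) [0..<k]"

lemma alt_Suc: "alt a b (Suc k) = alt a b k @ [if even k then a else b]"
  by (simp add: alt_def)

lemma alt_Suc_left: "alt a b (Suc k) = a # alt b a k"
  by (induction k) (simp_all add: alt_Suc, simp add: alt_def)

lemma alt_add: "alt a b (j + k) = alt a b j @ (if even j then alt a b k else alt b a k)"
  by (induction j arbitrary: a b) (simp_all add: alt_Suc_left, simp add: alt_def)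

lemma rev_alt: "rev (alt a b k) = (if even k then alt b a k else alt a b k)"
  by (induction k arbitrary: a b) (simp_all add: alt_Suc_left[symmetric] alt_Suc, simp add: alt_def)

lemma length_alt [simp]: "length (alt a b k) = k" by (simp add: alt_def)

lemma alt_lists: "a \<in> J \<Longrightarrow> b \<in> J \<Longrightarrow> alt a b k \<in> lists J" by (auto simp: alt_def)

lemma alt_double: "alt a b (2 * k) = concat (replicate k [a, b])"
  by (induction k) (simp_all add: alt_Suc_left, simp add: alt_def)

section \<open>The geometric representation\<close>

locale coxeter_group = coxeter_system G S for G (structure) and S +
  fixes m :: "'a \<Rightarrow> 'a \<Rightarrow> nat"
  assumes matrix: "coxeter_matrix S m"
    and pres: "\<And>us vs. us \<in> lists S \<Longrightarrow> vs \<in> lists S \<Longrightarrow>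
      word_prod G us = word_prod G vs \<longleftrightarrow> equivclp (coxeter_step S m) us vs"
    and fin: "finite S"
begin

text \<open>\<open>m s t = 0\<close> encodes infinite order, and \<open>- 2\<close> is the limit of
  the cosine values.\<close>

definition A :: "'a \<Rightarrow> 'a \<Rightarrow> real" where
  "A s t = (if s = t then 2 else if m s t = 0 then - 2 else - (2 * cos (pi / real (m s t))))"

lemma m_sym: "s \<in> S \<Longrightarrow> t \<in> S \<Longrightarrow> m s t = m t s"
  using matrix unfolding coxeter_matrix_def by metis

lemma m_ge_2: "s \<in> S \<Longrightarrow> t \<in> S \<Longrightarrow> s \<noteq> t \<Longrightarrow> m s t = 0 \<or> 2 \<le> m s t"
proof -
  assume "s \<in> S" "t \<in> S" "s \<noteq> t"
  then have "m s t \<noteq> 1" using matrix unfolding coxeter_matrix_def by metis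
  then show ?thesis by linarith
qed

lemma m_diag: "s \<in> S \<Longrightarrow> m s s = 1"
  using matrix unfolding coxeter_matrix_def by metis

sublocale cartan_datum S A
proof
  show "finite S" by (rule fin)
  show "A s s = 2" for s by (simp add: A_def)
  show "A s t = A t s" if "s \<in> S" "t \<in> S" for s t using m_sym[OF that] by (simp add: A_def)
  show "A s t \<le> 0" if st: "s \<in> S" "t \<in> S" "s \<noteq> t" for s t
  proof (cases "m s t = 0")
    case True
    then show ?thesis using st by (simp add: A_def)
  next
    case False
    then have "2 \<le> m s t" using m_ge_2[OF st] by simp
    then have "pi / real (m s t) \<le> pi / 2" by (intro divide_left_mono) auto
    then have "0 \<le> cos (pi / real (m s t))" by (intro cos_ge_zero) (auto intro: order_trans[of _ 0])
    then show ?thesis using st False by (simp add: A_def)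
  qed
qed

lemma refl_plane:
  assumes "s \<in> S" "t \<in> S"
  shows "refl s (lin x (simple_root s) y (simple_root t)) = lin (- x - A s t * y) (simple_root s) y (simple_root t)"
  unfolding refl_eq_lin coroot_lin coroot_simple[OF assms(1)] coroot_simple[OF assms(2)] A_diag[OF assms(1)]
  by (auto simp: lin_def algebra_simps)

abbreviation U :: "'a \<Rightarrow> 'a \<Rightarrow> nat \<Rightarrow> real" where
  "U s t k \<equiv> cheb (- A s t) k"

text \<open>The Chebyshev recursion is a simple reflection in plane coordinates: each reflection
  raises the lower of the two indices by two.\<close>

lemma refl_U:
  assumes "s \<in> S" "t \<in> S"
  shows "refl t (lin (U s t (Suc k)) (simple_root s) (U s t k) (simple_root t))
      = lin (U s t (Suc k)) (simple_root s) (U s t (Suc (Suc k))) (simple_root t)"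
    and "refl s (lin (U s t k) (simple_root s) (U s t (Suc k)) (simple_root t))
      = lin (U s t (Suc (Suc k))) (simple_root s) (U s t (Suc k)) (simple_root t)"
proof -
  have e: "U s t (Suc (Suc k)) = - U s t k - A s t * U s t (Suc k)" by simp
  have ts: "A t s = A s t" using A_sym assms by simp
  show "refl t (lin (U s t (Suc k)) (simple_root s) (U s t k) (simple_root t))
      = lin (U s t (Suc k)) (simple_root s) (U s t (Suc (Suc k))) (simple_root t)"
    unfolding e lin_comm[of _ "simple_root s"] refl_plane[OF assms(2,1)] ts ..
  show "refl s (lin (U s t k) (simple_root s) (U s t (Suc k)) (simple_root t))
      = lin (U s t (Suc (Suc k))) (simple_root s) (U s t (Suc k)) (simple_root t)"
    unfolding e refl_plane[OF assms] ..
qed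

lemma act_alt_plane:
  assumes "s \<in> S" "t \<in> S"
  shows "act (concat (replicate k [s, t])) (simple_root s)
    = lin (U s t (Suc (2 * k))) (simple_root s) (U s t (2 * k)) (simple_root t)"
proof (induction k)
  case 0
  then show ?case by (simp add: lin_def)
next
  case (Suc k)
  then show ?case using refl_U(1)[OF assms, of "2 * k"] refl_U(2)[OF assms, of "Suc (2 * k)"]
    by (simp del: cheb.simps)
qed

lemma m_sin:
  assumes st: "s \<in> S" "t \<in> S" "s \<noteq> t" and k: "m s t = k" "k \<noteq> 0"
  shows "sin (pi / real k) > 0" "sin (pi / real k) * U s t j = sin (real j * (pi / real k))"
proof -
  have k2: "2 \<le> k" using m_ge_2[OF st] k by simp
  then have "pi / real k < pi" by (simp add: divide_less_eq)
  then show "sin (pi / real k) > 0" using k2 by (intro sin_gt_zero) auto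
  have "- A s t = 2 * cos (pi / real k)" using st k by (simp add: A_def)
  then show "sin (pi / real k) * U s t j = sin (real j * (pi / real k))" by (simp only: cheb_sin)
qed

lemma U_nonneg:
  assumes st: "s \<in> S" "t \<in> S" "s \<noteq> t" and j: "m s t = 0 \<or> j \<le> m s t"
  shows "0 \<le> U s t j"
proof (cases "m s t = 0")
  case True
  then show ?thesis using st by (simp add: A_def cheb_2)
next
  case False
  note s = m_sin[OF st HOL.refl False]
  have "real j * (pi / real (m s t)) \<le> pi" using j False by (simp add: field_simps)
  then have "0 \<le> sin (real j * (pi / real (m s t)))" by (intro sin_ge_zero) auto
  then have "0 \<le> sin (pi / real (m s t)) * U s t j" using s(2) by simp
  then show ?thesis using s(1) by (simp add: zero_le_mult_iff)
qed

lemma act_relator_simple: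
  assumes st: "s \<in> S" "t \<in> S" "s \<noteq> t" and k: "m s t = k" "k \<noteq> 0"
  shows "act (concat (replicate k [s, t])) (simple_root s) = simple_root s"
proof -
  let ?x = "pi / real k"
  note s = m_sin[OF assms]
  have "real (2 * k) * ?x = 2 * pi" using k by simp
  then have "sin ?x * U s t (2 * k) = 0" using s(2)[of "2 * k"] by simp
  then have 1: "U s t (2 * k) = 0" using s(1) by simp
  have "real (Suc (2 * k)) * ?x = ?x + 2 * pi" using k by (simp add: field_simps)
  then have "sin ?x * U s t (Suc (2 * k)) = sin ?x" using s(2)[of "Suc (2 * k)"] by (simp only: sin_periodic)
  then have 2: "U s t (Suc (2 * k)) = 1" using s(1) by simp
  show ?thesis using act_alt_plane[OF st(1,2), of k] 1 2 by (simp add: lin_def)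
qed

text \<open>A vector splits into a part in the plane of the two simple roots and a part on which
  both coroots vanish. Each letter fixes the second part, and the sine identities fix the
  first.\<close>

lemma act_relator:
  assumes st: "s \<in> S" "t \<in> S"
  shows "act (concat (replicate (m s t) [s, t])) v = v"
proof (cases "s = t \<or> m s t = 0")
  case True
  then show ?thesis using m_diag st by auto
next
  case False
  then have ne: "s \<noteq> t" "m s t \<noteq> 0" by auto
  define k where "k = m s t"
  define M where "M = concat (replicate k [s, t])"
  have M: "M \<in> lists S" using alt_lists[OF st, of "2 * k"] by (simp only: M_def alt_double)
  have rM: "rev M = concat (replicate k [t, s])" by (simp add: M_def rev_concat)
  have fs: "act M (simple_root s) = simple_root s"
    unfolding M_def using act_relator_simple[OF st ne(1)] ne by (simp add: k_def)
  \<comment> \<open>That \<open>M\<close> fixes \<open>simple_root t\<close> is read off from the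
    reversed relator, which starts with \<open>t\<close> and inverts \<open>M\<close>.\<close>
  have "act (rev M) (simple_root t) = simple_root t"
    unfolding rM using act_relator_simple[OF st(2,1)] ne m_sym[OF st] by (simp add: k_def)
  then have "act (rev (rev M)) (simple_root t) = simple_root t"
    using act_rev[of "rev M" "simple_root t"] M by simp
  then have ft: "act M (simple_root t) = simple_root t" by simp
  \<comment> \<open>The determinant of the Gram matrix of the two simple roots, equal to four times
    a squared sine; \<open>p\<close> and \<open>q\<close> below come from Cramer's rule.\<close>
  define d where "d = 4 - A s t * A s t"
  have d: "d > 0"
  proof -
    let ?x = "pi / real k"
    have "(sin ?x)\<^sup>2 > 0" using m_sin(1)[OF st ne(1) HOL.refl ne(2)] by (simp add: k_def)
    moreover have "A s t = - (2 * cos ?x)" using ne by (simp add: A_def k_def)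
    ultimately show ?thesis using sin_cos_squared_add[of ?x] by (simp add: d_def power2_eq_square)
  qed
  define p where "p = (2 * coroot s v - A s t * coroot t v) / d"
  define q where "q = (2 * coroot t v - A s t * coroot s v) / d"
  define u where "u = lin p (simple_root s) q (simple_root t)"
  define v0 where "v0 = lin 1 v (-1) u"
  have ts: "A t s = A s t" using A_sym st by simp
  have "coroot s u = coroot s v" "coroot t u = coroot t v"
    using d unfolding u_def coroot_lin coroot_simple[OF st(1)] coroot_simple[OF st(2)] A_diag[OF st(1)] A_diag[OF st(2)] ts p_def q_def
    by (simp_all add: field_simps) (simp_all add: d_def algebra_simps)
  then have "coroot s v0 = 0" "coroot t v0 = 0" by (simp_all add: v0_def coroot_lin)
  then have f0: "refl s v0 = v0" "refl t v0 = v0" by (simp_all add: refl_def)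
  have "act M v0 = v0" unfolding M_def by (induction k) (simp_all add: f0)
  moreover have "act M u = u" unfolding u_def act_lin fs ft ..
  moreover have "v = lin 1 v0 1 u" by (simp add: v0_def lin_def)
  ultimately have "act M v = v" using act_lin by metis
  then show ?thesis by (simp add: M_def k_def)
qed

text \<open>Length parity travels along because it is the sign character; it later excludes that
  multiplying by a generator keeps the length.\<close>

lemma act_step: "coxeter_step S m us vs \<Longrightarrow> act us = act vs \<and> (even (length us) \<longleftrightarrow> even (length vs))"
proof (induction rule: coxeter_step.induct)
  case (1 us vs s t)
  have "even (length (concat (replicate (m s t) [s, t])))" by (simp add: length_concat sum_list_replicate)
  moreover have "act (us @ concat (replicate (m s t) [s, t]) @ vs) = act (us @ vs)"
    by (rule ext) (simp only: act_simps act_relator[OF 1(3,4)])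
  ultimately show ?case by simp
qed

lemma act_equiv: "equivclp (coxeter_step S m) us vs \<Longrightarrow> act us = act vs \<and> (even (length us) \<longleftrightarrow> even (length vs))"
  unfolding equivclp_def
proof (induction rule: rtranclp_induct)
  case (step y z)
  then show ?case using act_step unfolding symclp_def by metis
qed simp

lemma word_act: "us \<in> lists S \<Longrightarrow> vs \<in> lists S \<Longrightarrow> word_prod G us = word_prod G vs \<Longrightarrow>
    act us = act vs \<and> (even (length us) \<longleftrightarrow> even (length vs))"
  using pres act_equiv by blast

section \<open>Group elements and words\<close>

lemma S_carrier: "s \<in> S \<Longrightarrow> s \<in> carrier G" using gens_closed by auto

lemma word_prod_simps [simp]: "word_prod G [] = \<one>" "word_prod G (s # ws) = s \<otimes> word_prod G ws"
  by (simp_all add: word_prod_def)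

lemma word_prod_closed: "ws \<in> lists S \<Longrightarrow> word_prod G ws \<in> carrier G"
  by (induction ws) (auto simp: S_carrier)

lemma word_prod_append: "us \<in> lists S \<Longrightarrow> vs \<in> lists S \<Longrightarrow> word_prod G (us @ vs) = word_prod G us \<otimes> word_prod G vs"
  by (induction us) (auto simp: S_carrier word_prod_closed m_assoc)

lemma S_square: "s \<in> S \<Longrightarrow> s \<otimes> s = \<one>"
proof -
  assume s: "s \<in> S"
  have "coxeter_step S m ([] @ concat (replicate (m s s) [s, s]) @ []) ([] @ [])"
    by (rule coxeter_step.intros) (use s in auto)
  then have "coxeter_step S m [s, s] []" using m_diag[OF s] by simp
  then have "equivclp (coxeter_step S m) [s, s] []" by (rule r_into_equivclp)
  then have "word_prod G [s, s] = word_prod G []" using pres[of "[s, s]" "[]"] s by simp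
  then show ?thesis using S_carrier[OF s] by simp
qed

lemma S_inv: "s \<in> S \<Longrightarrow> inv s = s"
  using S_square S_carrier inv_equality by metis

lemma S_cancel: "s \<in> S \<Longrightarrow> x \<in> carrier G \<Longrightarrow> s \<otimes> (s \<otimes> x) = x"
  using S_square[of s] S_carrier[of s] by (simp add: m_assoc[symmetric])

lemma S_cancel_right: "s \<in> S \<Longrightarrow> x \<in> carrier G \<Longrightarrow> x \<otimes> s \<otimes> s = x"
  using S_square[of s] S_carrier[of s] by (simp add: m_assoc)

lemma inv_word: "ws \<in> lists S \<Longrightarrow> inv (word_prod G ws) = word_prod G (rev ws)"
proof (induction ws)
  case (Cons s ws)
  have "word_prod G (rev (s # ws)) = word_prod G (rev ws) \<otimes> s"
    using Cons.prems word_prod_append[of "rev ws" "[s]"] by (simp add: S_carrier)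
  then show ?case using Cons by (simp add: inv_mult_group S_carrier word_prod_closed S_inv)
qed simp

lemma generate_words:
  assumes J: "J \<subseteq> S"
  shows "generate G J = word_prod G ` lists J"
proof
  show "generate G J \<subseteq> word_prod G ` lists J"
  proof
    fix x assume "x \<in> generate G J"
    then show "x \<in> word_prod G ` lists J"
    proof (induction rule: generate.induct)
      case one
      show ?case by (rule image_eqI[of _ _ "[]"]) auto
    next
      case (incl h)
      then show ?case using J S_carrier by (intro image_eqI[of _ _ "[h]"]) auto
    next
      case (inv h)
      then show ?case using J S_carrier S_inv by (intro image_eqI[of _ _ "[h]"]) auto
    next
      case (eng h1 h2)
      then obtain u v where uv: "u \<in> lists J" "v \<in> lists J" "h1 = word_prod G u" "h2 = word_prod G v" by auto
      then have "u \<in> lists S" "v \<in> lists S" using J by auto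
      then have "h1 \<otimes> h2 = word_prod G (u @ v)" using uv word_prod_append by simp
      then show ?case using uv by (intro image_eqI[of _ _ "u @ v"]) auto
    qed
  qed
  have "word_prod G ws \<in> generate G J" if "ws \<in> lists J" for ws
    using that by (induction ws) (auto intro: generate.intros)
  then show "word_prod G ` lists J \<subseteq> generate G J" by auto
qed

lemma carrier_words: "w \<in> carrier G \<Longrightarrow> \<exists>ws\<in>lists S. w = word_prod G ws"
  using generate_words[of S] gens_generate by auto

text \<open>The choice of a word is harmless: by \<open>word_act\<close> all words for
  \<open>w\<close> act alike.\<close>

definition rep :: "'a \<Rightarrow> ('a \<Rightarrow> real) \<Rightarrow> 'a \<Rightarrow> real" where
  "rep w = act (SOME ws. ws \<in> lists S \<and> word_prod G ws = w)"

lemma rep_word: "ws \<in> lists S \<Longrightarrow> rep (word_prod G ws) = act ws"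
proof -
  assume w: "ws \<in> lists S"
  then have "\<exists>us. us \<in> lists S \<and> word_prod G us = word_prod G ws" by auto
  from someI_ex[OF this] show ?thesis unfolding rep_def using word_act w by blast
qed

lemma rep_mult: "x \<in> carrier G \<Longrightarrow> y \<in> carrier G \<Longrightarrow> rep (x \<otimes> y) v = rep x (rep y v)"
proof -
  assume "x \<in> carrier G" "y \<in> carrier G"
  then obtain u w where u: "u \<in> lists S" "w \<in> lists S" "x = word_prod G u" "y = word_prod G w"
    using carrier_words by metis
  then have "rep (word_prod G (u @ w)) v = act (u @ w) v" using rep_word[of "u @ w"] by simp
  then show ?thesis using u by (simp add: word_prod_append rep_word)
qed

lemma rep_one [simp]: "rep \<one> v = v"
  using rep_word[of "[]"] by simp

lemma rep_simple: "s \<in> S \<Longrightarrow> rep s v = refl s v"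
  using rep_word[of "[s]"] S_carrier by simp

lemma rep_inv [simp]: "x \<in> carrier G \<Longrightarrow> rep (inv x) (rep x v) = v" "x \<in> carrier G \<Longrightarrow> rep x (rep (inv x) v) = v"
  by (simp_all add: rep_mult[symmetric])

lemma rep_lin: "x \<in> carrier G \<Longrightarrow> rep x (lin a p b q) = lin a (rep x p) b (rep x q)"
  using carrier_words[of x] rep_word act_lin by metis

lemma rep_neg: "x \<in> carrier G \<Longrightarrow> rep x (\<lambda>r. - v r) = (\<lambda>r. - rep x v r)"
  using carrier_words[of x] rep_word act_neg by metis

lemma rep_bil: "x \<in> carrier G \<Longrightarrow> bil (rep x u) (rep x v) = bil u v"
  using carrier_words[of x] rep_word act_bil by metis

lemma rep_supp: "x \<in> carrier G \<Longrightarrow> supp_in S v \<Longrightarrow> supp_in S (rep x v)"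
  using carrier_words[of x] rep_word act_supp by metis

lemma rep_supp_J: "J \<subseteq> S \<Longrightarrow> x \<in> generate G J \<Longrightarrow> supp_in J v \<Longrightarrow> supp_in J (rep x v)"
proof -
  assume J: "J \<subseteq> S" "x \<in> generate G J" "supp_in J v"
  then obtain ws where ws: "ws \<in> lists J" "x = word_prod G ws" using generate_words by auto
  then have "ws \<in> lists S" using J by auto
  then show ?thesis using ws rep_word act_supp J by simp
qed

lemma rep_fix_coord: "J \<subseteq> S \<Longrightarrow> x \<in> generate G J \<Longrightarrow> s \<notin> J \<Longrightarrow> rep x v s = v s"
proof -
  assume J: "J \<subseteq> S" "x \<in> generate G J" "s \<notin> J"
  then obtain ws where ws: "ws \<in> lists J" "x = word_prod G ws" using generate_words by auto
  then have "ws \<in> lists S" "s \<notin> set ws" using J by auto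
  then show ?thesis using ws rep_word act_other by simp
qed

section \<open>Length and positivity\<close>

abbreviation len :: "'a \<Rightarrow> nat" where "len w \<equiv> cox_length G S w"

lemma cox_length_le: "ws \<in> lists J \<Longrightarrow> cox_length G J (word_prod G ws) \<le> length ws"
  unfolding cox_length_def by (rule Least_le) auto

lemma cox_length_ex:
  assumes "J \<subseteq> S" "w \<in> generate G J"
  obtains ws where "ws \<in> lists J" "length ws = cox_length G J w" "word_prod G ws = w"
proof -
  have "\<exists>k. \<exists>ws\<in>lists J. length ws = k \<and> word_prod G ws = w" using generate_words[OF assms(1)] assms(2) by auto
  from LeastI_ex[OF this] show thesis using that unfolding cox_length_def by auto
qed

lemma len_ex:
  assumes "w \<in> carrier G"
  obtains ws where "ws \<in> lists S" "length ws = len w" "word_prod G ws = w"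
  using cox_length_ex[of S w] assms gens_generate by auto

lemma len_mult: "x \<in> carrier G \<Longrightarrow> y \<in> carrier G \<Longrightarrow> len (x \<otimes> y) \<le> len x + len y"
proof -
  assume x: "x \<in> carrier G" and y: "y \<in> carrier G"
  obtain u where u: "u \<in> lists S" "length u = len x" "word_prod G u = x" using len_ex[OF x] .
  obtain w where w: "w \<in> lists S" "length w = len y" "word_prod G w = y" using len_ex[OF y] .
  show ?thesis using cox_length_le[of "u @ w" S] u w by (simp add: word_prod_append)
qed

lemma len_inv: "x \<in> carrier G \<Longrightarrow> len (inv x) = len x"
proof -
  have le: "len (inv x) \<le> len x" if x: "x \<in> carrier G" for x
  proof -
    obtain u where u: "u \<in> lists S" "length u = len x" "word_prod G u = x" using len_ex[OF x] .
    have "len (word_prod G (rev u)) \<le> length (rev u)" by (rule cox_length_le) (use u in auto)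
    then show ?thesis using u inv_word[OF u(1)] by simp
  qed
  assume "x \<in> carrier G"
  then show ?thesis using le[of x] le[of "inv x"] by simp
qed

lemma len_simple: "s \<in> S \<Longrightarrow> len s \<le> 1"
  using cox_length_le[of "[s]" S] S_carrier[of s] by simp

lemma len_0: "w \<in> carrier G \<Longrightarrow> len w = 0 \<Longrightarrow> w = \<one>"
proof -
  assume w: "w \<in> carrier G" "len w = 0"
  obtain u where "u \<in> lists S" "length u = len w" "word_prod G u = w" using len_ex[OF w(1)] .
  then show ?thesis using w by auto
qed

lemma len_parity: "ws \<in> lists S \<Longrightarrow> even (len (word_prod G ws)) \<longleftrightarrow> even (length ws)"
proof -
  assume ws: "ws \<in> lists S"
  obtain u where u: "u \<in> lists S" "length u = len (word_prod G ws)" "word_prod G u = word_prod G ws"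
    using len_ex[OF word_prod_closed[OF ws]] .
  then show ?thesis using word_act[OF u(1) ws] by simp
qed

text \<open>Subadditivity bounds the difference by one, and parity excludes equality.\<close>

lemma len_snoc:
  assumes w: "w \<in> carrier G" and s: "s \<in> S"
  shows "len (w \<otimes> s) = Suc (len w) \<or> len w = Suc (len (w \<otimes> s))"
proof -
  obtain u where u: "u \<in> lists S" "w = word_prod G u" using carrier_words[OF w] by auto
  have ws: "w \<otimes> s = word_prod G (u @ [s])" using u s S_carrier by (simp add: word_prod_append)
  have wsc: "w \<otimes> s \<in> carrier G" using w s S_carrier by simp
  have "even (len (w \<otimes> s)) \<longleftrightarrow> \<not> even (len w)"
    using len_parity[of "u @ [s]"] len_parity[OF u(1)] u s ws by simp
  then have ne: "len (w \<otimes> s) \<noteq> len w" by auto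
  have "len (w \<otimes> s) \<le> len w + 1" using len_mult[OF w S_carrier[OF s]] len_simple[OF s] by simp
  moreover have "len w \<le> len (w \<otimes> s) + 1"
    using len_mult[OF wsc S_carrier[OF s]] len_simple[OF s] S_cancel_right[OF s w] by simp
  ultimately show ?thesis using ne by linarith
qed

text \<open>Half of the relator is moved to the other side; inverting the second half reverses it
  into the alternating word that starts with \<open>t\<close>.\<close>

lemma alt_relation:
  assumes st: "s \<in> S" "t \<in> S"
  shows "word_prod G (alt s t (m s t)) = word_prod G (alt t s (m s t))"
proof -
  let ?k = "m s t"
  define second where "second = (if even ?k then alt s t ?k else alt t s ?k)"
  have l: "alt s t ?k \<in> lists S" "second \<in> lists S"
    using alt_lists[OF st] alt_lists[OF st(2,1)] by (cases "even ?k"; simp only: second_def if_True if_False)+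
  have "coxeter_step S m ([] @ concat (replicate ?k [s, t]) @ []) ([] @ [])"
    by (rule coxeter_step.intros) (use st in auto)
  then have "equivclp (coxeter_step S m) (alt s t (2 * ?k)) []" by (simp add: alt_double r_into_equivclp)
  then have "word_prod G (alt s t (2 * ?k)) = \<one>" using pres[of "alt s t (2 * ?k)" "[]"] alt_lists[OF st] by simp
  moreover have "alt s t (2 * ?k) = alt s t ?k @ second"
    using alt_add[of s t ?k ?k] by (simp add: second_def mult_2)
  ultimately have "word_prod G (alt s t ?k) \<otimes> word_prod G second = \<one>" using l by (simp add: word_prod_append)
  then have "word_prod G (alt s t ?k) = inv (word_prod G second)"
    using inv_equality[of "word_prod G (alt s t ?k)" "word_prod G second"] l word_prod_closed by simp
  also have "\<dots> = word_prod G (rev second)" by (rule inv_word[OF l(2)])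
  also have "rev second = alt t s ?k" by (simp add: second_def rev_alt)
  finally show ?thesis .
qed

text \<open>Strip letters \<open>t, s, t, \<dots>\<close> from the right of \<open>w\<close> as long as the length drops; both \<open>simple_root s\<close>
  and \<open>simple_root t\<close> stay positive under what remains, and the stripped part has nonnegative Chebyshev coefficients.\<close>

lemma rep_vpos:
  assumes "w \<in> carrier G" "s \<in> S" "len w < len (w \<otimes> s)"
  shows "vpos (rep w (simple_root s))"
  using assms
proof (induction "len w" arbitrary: w s rule: less_induct)
  case less
  note w = less.prems(1) and s = less.prems(2)
  show ?case
  proof (cases "len w = 0")
    case True
    then show ?thesis using len_0[OF w] by simp
  next
    case False
    obtain ws where ws: "ws \<in> lists S" "length ws = len w" "word_prod G ws = w" using len_ex[OF w] .
    then obtain us t where us: "ws = us @ [t]" using False by (metis length_0_conv rev_exhaust)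
    have t: "t \<in> S" "us \<in> lists S" using ws us by auto
    have wus: "w = word_prod G us \<otimes> t" using ws us t S_carrier by (simp add: word_prod_append)
    then have "w \<otimes> t = word_prod G us" using S_cancel_right[OF t(1) word_prod_closed[OF t(2)]] by simp
    then have down: "len (w \<otimes> t) < len w" using cox_length_le[OF t(2)] us ws by simp
    have st: "s \<noteq> t" using down less.prems by auto
    define v where "v k = w \<otimes> word_prod G (alt t s k)" for k
    define x where "x k = (if even k then t else s)" for k :: nat
    have xS: "x k \<in> S" for k using s t by (simp add: x_def)
    have altS: "alt t s k \<in> lists S" for k by (rule alt_lists[OF t(1) s])
    have vC: "v k \<in> carrier G" for k using w word_prod_closed[OF altS] by (simp add: v_def)
    have v0: "v 0 = w" using w by (simp add: v_def alt_def)
    have vSuc: "v (Suc k) = v k \<otimes> x k" for k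
      using w altS xS[of k] S_carrier[OF xS[of k]] word_prod_closed[OF altS[of k]]
      by (simp add: v_def alt_Suc word_prod_append m_assoc x_def[symmetric])
    have "\<exists>k. \<not> len (v (Suc k)) < len (v k)"
    proof (rule ccontr)
      assume "\<not> ?thesis"
      then have d: "len (v (Suc k)) < len (v k)" for k by auto
      have "len (v k) + k \<le> len w" for k
      proof (induction k)
        case (Suc k)
        then show ?case using d[of k] by simp
      qed (simp add: v0)
      from this[of "Suc (len w)"] show False by simp
    qed
    then obtain k where k: "\<not> len (v (Suc k)) < len (v k)" "\<And>j. j < k \<Longrightarrow> len (v (Suc j)) < len (v j)"
      using exists_least_iff[of "\<lambda>k. \<not> len (v (Suc k)) < len (v k)"] by auto
    have lk: "j \<le> k \<Longrightarrow> len (v j) + j = len w" for j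
    proof (induction j)
      case (Suc j)
      then have "len (v (Suc j)) < len (v j)" using k(2) by simp
      then have "len (v j) = Suc (len (v (Suc j)))" using len_snoc[OF vC[of j] xS[of j]] vSuc by auto
      then show ?case using Suc by simp
    qed (simp add: v0)
    have k0: "k \<noteq> 0"
    proof
      assume "k = 0"
      then show False using k(1) down vSuc[of 0] v0 by (simp add: x_def)
    qed
    have up1: "len (v k) < len (v k \<otimes> x k)"
      using k(1) len_snoc[OF vC[of k] xS[of k]] vSuc[of k] by auto
    have "v k = v (k - 1) \<otimes> x (k - 1)" using vSuc[of "k - 1"] k0 by simp
    then have "v k \<otimes> x (k - 1) = v (k - 1)" using S_cancel_right[OF xS vC] by simp
    moreover have "len (v k) < len (v (k - 1))" using k(2)[of "k - 1"] k0 by simp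
    ultimately have up2: "len (v k) < len (v k \<otimes> x (k - 1))" by simp
    have lt: "len (v k) < len w" using lk[of k] k0 by simp
    have "vpos (rep (v k) (simple_root (x k)))" "vpos (rep (v k) (simple_root (x (k - 1))))"
      using less.hyps[OF lt vC xS up1] less.hyps[OF lt vC xS up2] by auto
    moreover have "{x k, x (k - 1)} = {s, t}" using k0 by (cases "even k") (auto simp: x_def)
    ultimately have pos: "vpos (rep (v k) (simple_root s))" "vpos (rep (v k) (simple_root t))"
      by (metis doubleton_eq_iff)+
    \<comment> \<open>With \<open>m s t \<le> k\<close> the braid relation would let the stripped
      word start with \<open>s\<close>, which makes \<open>w \<otimes> s\<close> shorter than
      \<open>w\<close>.\<close>
    have bound: "m s t = 0 \<or> Suc k \<le> m s t"
    proof (rule ccontr)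
      assume "\<not> ?thesis"
      then have m: "m s t \<noteq> 0" "m s t \<le> k" by auto
      then obtain j where j: "m s t = Suc j" using not0_implies_Suc by blast
      define y where "y = word_prod G (alt t s j)"
      have y: "y \<in> carrier G" "len y \<le> j" using word_prod_closed[OF altS] cox_length_le[OF altS, of j] by (auto simp: y_def)
      have "word_prod G (alt t s (m s t)) = word_prod G (alt s t (Suc j))"
        using alt_relation[OF s t(1)] j by simp
      also have "\<dots> = s \<otimes> y" by (simp add: alt_Suc_left y_def)
      finally have "v (m s t) = w \<otimes> s \<otimes> y" using w s y S_carrier by (simp add: v_def m_assoc)
      then have "w \<otimes> s = v (m s t) \<otimes> inv y" using w s y S_carrier by (simp add: m_assoc)
      then have "len (w \<otimes> s) \<le> len (v (m s t)) + j"
        using len_mult[OF vC[of "m s t"], of "inv y"] y len_inv by simp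
      then show False using lk[OF m(2)] j less.prems(3) by simp
    qed
    have rw: "rep w (simple_root s) = rep (v j) (if even j
        then lin (U s t (Suc j)) (simple_root s) (U s t j) (simple_root t)
        else lin (U s t j) (simple_root s) (U s t (Suc j)) (simple_root t))" for j
    proof (induction j)
      case 0
      then show ?case by (simp add: v0 lin_def)
    next
      case (Suc j)
      have cancel: "rep (v j) z = rep (v (Suc j)) (refl (x j) z)" for z
        using rep_mult[OF vC S_carrier[OF xS]] rep_simple[OF xS] xS vSuc by simp
      show ?case
        using Suc cancel refl_U[OF s t(1), of j] by (cases "even j") (simp_all add: x_def del: cheb.simps)
    qed
    \<comment> \<open>The bound \<open>Suc k \<le> m s t\<close> keeps the angles of both sines
      within a half turn.\<close>
    have Un: "0 \<le> U s t k" "0 \<le> U s t (Suc k)"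
      using U_nonneg[OF s t(1) st, of k] U_nonneg[OF s t(1) st, of "Suc k"] bound by auto
    have nonneg: "0 \<le> rep w (simple_root s) r" for r
      unfolding rw[of k] using Un vpos_nonneg[OF pos(1)] vpos_nonneg[OF pos(2)]
      by (simp add: rep_lin[OF vC]) (auto simp: lin_def)
    have "\<exists>r. rep w (simple_root s) r \<noteq> 0"
    proof (rule ccontr)
      assume "\<not> ?thesis"
      then have "rep w (simple_root s) = (\<lambda>r. 0)" by auto
      then have "rep w (simple_root s) = lin 0 (simple_root s) 0 (simple_root s)" by (simp add: lin_def)
      then have "simple_root s = rep (inv w) (lin 0 (simple_root s) 0 (simple_root s))" using w rep_inv(1) by metis
      also have "\<dots> = (\<lambda>r. 0)" using w by (simp add: rep_lin) (simp add: lin_def)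
      finally have "simple_root s s = 0" by metis
      then show False by simp
    qed
    then show ?thesis using nonneg unfolding vpos_def by blast
  qed
qed

section \<open>Roots and inversion sets\<close>

definition Phi :: "('a \<Rightarrow> real) set" where
  "Phi = {rep w (simple_root s) | w s. w \<in> carrier G \<and> s \<in> S}"

definition pos_roots :: "('a \<Rightarrow> real) set" where
  "pos_roots = {\<beta> \<in> Phi. vpos \<beta>}"

definition N :: "'a \<Rightarrow> ('a \<Rightarrow> real) set" where
  "N w = {\<beta> \<in> pos_roots. \<not> vpos (rep (inv w) \<beta>)}"

lemma PhiI: "w \<in> carrier G \<Longrightarrow> s \<in> S \<Longrightarrow> rep w (simple_root s) \<in> Phi"
  unfolding Phi_def by blast

lemma PhiE:
  assumes "\<beta> \<in> Phi"
  obtains w s where "w \<in> carrier G" "s \<in> S" "\<beta> = rep w (simple_root s)"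
  using assms unfolding Phi_def by blast

lemma not_vpos_both: "vpos v \<Longrightarrow> \<not> vpos (\<lambda>r. - v r)"
  unfolding vpos_def by (metis add.inverse_inverse neg_0_le_iff_le order_antisym)

lemma rep_snoc_simple: "w \<in> carrier G \<Longrightarrow> s \<in> S \<Longrightarrow> rep (w \<otimes> s) (simple_root s) = (\<lambda>r. - rep w (simple_root s) r)"
  by (simp add: rep_mult S_carrier rep_simple refl_simple rep_neg)

lemma rep_vneg:
  assumes "w \<in> carrier G" "s \<in> S" "\<not> len w < len (w \<otimes> s)"
  shows "vpos (\<lambda>r. - rep w (simple_root s) r)"
proof -
  have c: "w \<otimes> s \<in> carrier G" using assms S_carrier by simp
  have "len (w \<otimes> s) < len (w \<otimes> s \<otimes> s)" using assms len_snoc[OF assms(1,2)] S_cancel_right[OF assms(2,1)] by auto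
  from rep_vpos[OF c assms(2) this] show ?thesis using rep_snoc_simple assms by simp
qed

lemma rep_vpos_iff: "w \<in> carrier G \<Longrightarrow> s \<in> S \<Longrightarrow> vpos (rep w (simple_root s)) \<longleftrightarrow> len w < len (w \<otimes> s)"
  using rep_vpos rep_vneg not_vpos_both by metis

lemma Phi_sign: "\<beta> \<in> Phi \<Longrightarrow> vpos (\<lambda>r. - \<beta> r) \<longleftrightarrow> \<not> vpos \<beta>"
proof -
  assume "\<beta> \<in> Phi"
  then obtain w s where w: "w \<in> carrier G" "s \<in> S" "\<beta> = rep w (simple_root s)" by (rule PhiE)
  show ?thesis
  proof
    assume "vpos (\<lambda>r. - \<beta> r)"
    then show "\<not> vpos \<beta>" using not_vpos_both by metis
  next
    assume "\<not> vpos \<beta>"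
    then show "vpos (\<lambda>r. - \<beta> r)" using w rep_vpos rep_vneg by metis
  qed
qed

lemma Phi_rep: "\<beta> \<in> Phi \<Longrightarrow> x \<in> carrier G \<Longrightarrow> rep x \<beta> \<in> Phi"
proof -
  assume b: "\<beta> \<in> Phi" and x: "x \<in> carrier G"
  obtain w s where w: "w \<in> carrier G" "s \<in> S" "\<beta> = rep w (simple_root s)" using b by (rule PhiE)
  then have "rep x \<beta> = rep (x \<otimes> w) (simple_root s)" using x rep_mult by simp
  then show ?thesis using PhiI[of "x \<otimes> w" s] x w by simp
qed

lemma Phi_simple: "s \<in> S \<Longrightarrow> simple_root s \<in> Phi"
  using PhiI[of \<one> s] by simp

lemma Phi_neg: "\<beta> \<in> Phi \<Longrightarrow> (\<lambda>r. - \<beta> r) \<in> Phi"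
proof -
  assume "\<beta> \<in> Phi"
  then obtain w s where w: "w \<in> carrier G" "s \<in> S" "\<beta> = rep w (simple_root s)" by (rule PhiE)
  then show ?thesis using rep_snoc_simple[of w s] PhiI[of "w \<otimes> s" s] S_carrier[of s] by simp
qed

lemma Phi_refl: "\<beta> \<in> Phi \<Longrightarrow> s \<in> S \<Longrightarrow> refl s \<beta> \<in> Phi"
  using Phi_rep[of \<beta> s] rep_simple S_carrier by simp

lemma Phi_nonneg: "\<beta> \<in> Phi \<Longrightarrow> (\<And>r. 0 \<le> \<beta> r) \<Longrightarrow> vpos \<beta>"
proof (rule ccontr)
  assume b: "\<beta> \<in> Phi" and nn: "\<And>r. 0 \<le> \<beta> r" and "\<not> vpos \<beta>"
  then have "vpos (\<lambda>r. - \<beta> r)" using Phi_sign by blast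
  then obtain r where "- \<beta> r \<noteq> 0" "0 \<le> - \<beta> r" unfolding vpos_def by blast
  then show False using nn[of r] by linarith
qed

lemma Phi_supp: "\<beta> \<in> Phi \<Longrightarrow> supp_in S \<beta>"
proof -
  assume "\<beta> \<in> Phi"
  then obtain w s where w: "w \<in> carrier G" "s \<in> S" "\<beta> = rep w (simple_root s)" by (rule PhiE)
  then show ?thesis using rep_supp by simp
qed

lemma Phi_bil: "\<beta> \<in> Phi \<Longrightarrow> bil \<beta> \<beta> = 2"
proof -
  assume "\<beta> \<in> Phi"
  then obtain w s where w: "w \<in> carrier G" "s \<in> S" "\<beta> = rep w (simple_root s)" by (rule PhiE)
  then show ?thesis by (simp add: rep_bil bil_simple_left coroot_simple A_diag)
qed

lemma pos_rootsD: "\<beta> \<in> pos_roots \<Longrightarrow> \<beta> \<in> Phi" "\<beta> \<in> pos_roots \<Longrightarrow> vpos \<beta>"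
  by (auto simp: pos_roots_def)

lemma pos_rootsI: "\<beta> \<in> Phi \<Longrightarrow> vpos \<beta> \<Longrightarrow> \<beta> \<in> pos_roots"
  by (auto simp: pos_roots_def)

lemma pos_roots_simple: "s \<in> S \<Longrightarrow> simple_root s \<in> pos_roots"
  by (simp add: pos_rootsI Phi_simple)

lemma pos_roots_scale:
  assumes b: "\<beta> \<in> pos_roots" and c: "(\<lambda>r. c * \<beta> r) \<in> pos_roots"
  shows "c = 1"
proof -
  have "bil (lin c \<beta> 0 \<beta>) (lin c \<beta> 0 \<beta>) = 2" using Phi_bil[OF pos_rootsD(1)[OF c]] by (simp add: lin_def)
  then have "c * c = 1" using Phi_bil[OF pos_rootsD(1)[OF b]] by (simp add: bil_lin_left bil_lin_right)
  then have "c = 1 \<or> c = -1" by (simp add: square_eq_1_iff)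
  moreover have "c \<noteq> -1" using not_vpos_both[OF pos_rootsD(2)[OF b]] pos_rootsD(2)[OF c] by auto
  ultimately show ?thesis by simp
qed

text \<open>A positive root other than \<open>simple_root s\<close> is no multiple of it, so it has
  a positive coordinate away from \<open>s\<close>, which \<open>refl s\<close> leaves
  alone.\<close>

lemma pos_roots_refl:
  assumes s: "s \<in> S" and b: "\<beta> \<in> pos_roots" and ne: "\<beta> \<noteq> simple_root s"
  shows "refl s \<beta> \<in> pos_roots"
proof -
  have "\<exists>r. r \<noteq> s \<and> \<beta> r \<noteq> 0"
  proof (rule ccontr)
    assume "\<not> ?thesis"
    then have e: "\<beta> = (\<lambda>r. \<beta> s * simple_root s r)" by (intro ext) (auto simp: simple_root_def)
    then have "\<beta> s = 1" using pos_roots_scale[OF pos_roots_simple[OF s], of "\<beta> s"] b by simp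
    then show False using e ne by simp
  qed
  then obtain r where r: "r \<noteq> s" "\<beta> r \<noteq> 0" by auto
  then have "0 < refl s \<beta> r" using vpos_nonneg[OF pos_rootsD(2)[OF b], of r] by simp
  then have "\<not> vpos (\<lambda>r. - refl s \<beta> r)" unfolding vpos_def by (metis neg_0_le_iff_le not_less)
  moreover have P: "refl s \<beta> \<in> Phi" by (rule Phi_refl[OF pos_rootsD(1)[OF b] s])
  ultimately show ?thesis using Phi_sign pos_rootsI by blast
qed

lemma N_pos: "N w \<subseteq> pos_roots" by (auto simp: N_def)

lemma N_posD: "\<beta> \<in> N w \<Longrightarrow> \<beta> \<in> pos_roots" by (simp add: N_def)

lemma N_iff: "\<beta> \<in> pos_roots \<Longrightarrow> \<beta> \<in> N w \<longleftrightarrow> \<not> vpos (rep (inv w) \<beta>)"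
  by (simp add: N_def)

lemma N_one: "N \<one> = {}"
  by (auto simp: N_def pos_roots_def)

lemma N_cons:
  assumes w: "w \<in> carrier G" and s: "s \<in> S"
  shows "simple_root s \<in> N (s \<otimes> w) \<longleftrightarrow> simple_root s \<notin> N w"
    and "\<beta> \<in> pos_roots \<Longrightarrow> \<beta> \<noteq> simple_root s \<Longrightarrow> \<beta> \<in> N (s \<otimes> w) \<longleftrightarrow> refl s \<beta> \<in> N w"
proof -
  have i: "rep (inv (s \<otimes> w)) v = rep (inv w) (refl s v)" for v
    using w s by (simp add: inv_mult_group S_carrier S_inv rep_mult rep_simple)
  have P: "rep (inv w) (simple_root s) \<in> Phi" using PhiI w s by simp
  show "simple_root s \<in> N (s \<otimes> w) \<longleftrightarrow> simple_root s \<notin> N w"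
    using N_iff[OF pos_roots_simple[OF s]] i[of "simple_root s"] Phi_sign[OF P] w
    by (simp add: refl_simple[OF s] rep_neg)
  show "\<beta> \<in> N (s \<otimes> w) \<longleftrightarrow> refl s \<beta> \<in> N w" if "\<beta> \<in> pos_roots" "\<beta> \<noteq> simple_root s"
    using N_iff[OF that(1)] N_iff[OF pos_roots_refl[OF s that]] i by simp
qed

lemma refl_pos_ne: "s \<in> S \<Longrightarrow> \<beta> \<in> pos_roots \<Longrightarrow> refl s \<beta> \<noteq> simple_root s"
proof
  assume s: "s \<in> S" and b: "\<beta> \<in> pos_roots" and e: "refl s \<beta> = simple_root s"
  have "\<beta> = refl s (refl s \<beta>)" using s by simp
  also have "\<dots> = (\<lambda>r. - simple_root s r)" by (simp only: e refl_simple[OF s])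
  finally show False using pos_rootsD(2)[OF b] not_vpos_both[of "simple_root s"] by simp
qed

lemma N_cons_below:
  assumes w: "w \<in> carrier G" and s: "s \<in> S" and a: "simple_root s \<notin> N w"
  shows "N (s \<otimes> w) = insert (simple_root s) (refl s ` N w)"
proof (rule Set.set_eqI)
  fix \<beta>
  have im: "\<beta> \<in> refl s ` N w \<longleftrightarrow> refl s \<beta> \<in> N w" by (rule refl_image_iff[OF s])
  show "\<beta> \<in> N (s \<otimes> w) \<longleftrightarrow> \<beta> \<in> insert (simple_root s) (refl s ` N w)"
  proof (cases "\<beta> = simple_root s")
    case True
    then show ?thesis using N_cons(1)[OF w s] a by simp
  next
    case ne: False
    show ?thesis
    proof (cases "\<beta> \<in> pos_roots")
      case True
      then show ?thesis using N_cons(2)[OF w s True ne] im ne by simp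
    next
      case False
      have "refl s \<beta> \<notin> N w"
      proof
        assume m: "refl s \<beta> \<in> N w"
        then have "refl s \<beta> \<noteq> simple_root s" using a by auto
        from pos_roots_refl[OF s N_posD[OF m] this] show False using False s by simp
      qed
      then show ?thesis using N_posD[of \<beta> "s \<otimes> w"] False im ne by auto
    qed
  qed
qed

lemma N_cons_above:
  assumes w: "w \<in> carrier G" and s: "s \<in> S" and a: "simple_root s \<in> N w"
  shows "N (s \<otimes> w) = refl s ` (N w - {simple_root s})"
proof -
  have c: "s \<otimes> w \<in> carrier G" using w s S_carrier by simp
  have n: "simple_root s \<notin> N (s \<otimes> w)" using N_cons(1)[OF w s] a by simp
  have e: "N w = insert (simple_root s) (refl s ` N (s \<otimes> w))"
    using N_cons_below[OF c s n] S_cancel[OF s w] by simp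
  have "simple_root s \<notin> refl s ` N (s \<otimes> w)"
    using refl_pos_ne[OF s pos_roots_simple[OF s]] refl_pos_ne[OF s] N_pos[of "s \<otimes> w"] by (auto simp: eq_commute[of "simple_root s"])
  then have "N w - {simple_root s} = refl s ` N (s \<otimes> w)" using e by auto
  then show ?thesis using s by (simp add: image_image)
qed

lemma N_snoc:
  assumes w: "w \<in> carrier G" and s: "s \<in> S" and up: "vpos (rep w (simple_root s))"
  shows "N (w \<otimes> s) = insert (rep w (simple_root s)) (N w) \<and> rep w (simple_root s) \<notin> N w"
proof -
  let ?b = "rep w (simple_root s)"
  have bP: "?b \<in> pos_roots" using PhiI[OF w s] up pos_rootsI by blast
  have i: "rep (inv (w \<otimes> s)) v = refl s (rep (inv w) v)" for v
    using w s by (simp add: inv_mult_group S_carrier S_inv rep_mult rep_simple)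
  have nb: "?b \<notin> N w" using N_iff[OF bP] w by simp
  have ib: "?b \<in> N (w \<otimes> s)"
    using N_iff[OF bP] i w not_vpos_both[of "simple_root s"] by (simp add: refl_simple[OF s])
  have main: "\<beta> \<in> N (w \<otimes> s) \<longleftrightarrow> \<beta> \<in> N w" if b: "\<beta> \<in> pos_roots" "\<beta> \<noteq> ?b" for \<beta>
  proof -
    let ?g = "rep (inv w) \<beta>"
    have gP: "?g \<in> Phi" using Phi_rep[OF pos_rootsD(1)[OF b(1)]] w by simp
    have bg: "\<beta> = rep w ?g" using w by simp
    have ne: "?g \<noteq> simple_root s" using b(2) bg by auto
    have "vpos (refl s ?g) \<longleftrightarrow> vpos ?g"
    proof (cases "vpos ?g")
      case True
      then show ?thesis using pos_rootsD(2)[OF pos_roots_refl[OF s pos_rootsI[OF gP True] ne]] by simp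
    next
      case False
      have neg: "(\<lambda>r. - ?g r) \<in> pos_roots" using Phi_neg[OF gP] Phi_sign[OF gP] False pos_rootsI by simp
      have "(\<lambda>r. - ?g r) \<noteq> simple_root s"
      proof
        assume e: "(\<lambda>r. - ?g r) = simple_root s"
        have "(\<lambda>r. - \<beta> r) = rep w (\<lambda>r. - ?g r)" using w by (simp add: rep_neg)
        then have "(\<lambda>r. - \<beta> r) = ?b" using e by simp
        then show False using up not_vpos_both[OF pos_rootsD(2)[OF b(1)]] by simp
      qed
      then have "vpos (refl s (\<lambda>r. - ?g r))" using pos_rootsD(2)[OF pos_roots_refl[OF s neg]] by simp
      moreover have "refl s (\<lambda>r. - ?g r) = (\<lambda>r. - refl s ?g r)" using refl_scale[of s "-1" ?g] by simp
      ultimately show ?thesis using False not_vpos_both[of "refl s ?g"] by auto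
    qed
    then show ?thesis using N_iff[OF b(1)] i by simp
  qed
  have "N (w \<otimes> s) = insert ?b (N w)"
  proof (rule Set.set_eqI)
    fix \<beta>
    show "\<beta> \<in> N (w \<otimes> s) \<longleftrightarrow> \<beta> \<in> insert ?b (N w)"
      using main[of \<beta>] ib N_posD[of \<beta> w] N_posD[of \<beta> "w \<otimes> s"] by auto
  qed
  then show ?thesis using nb by simp
qed

lemma N_snoc_subset:
  assumes w: "w \<in> carrier G" and s: "s \<in> S"
  shows "\<exists>\<beta>. N (w \<otimes> s) \<subseteq> insert \<beta> (N w)"
proof (cases "vpos (rep w (simple_root s))")
  case True
  then show ?thesis using N_snoc[OF w s] by blast
next
  case False
  have c: "w \<otimes> s \<in> carrier G" using w s S_carrier by simp
  have "vpos (rep (w \<otimes> s) (simple_root s))"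
    using False Phi_sign[OF PhiI[OF w s]] rep_snoc_simple[OF w s] by simp
  from N_snoc[OF c s this] show ?thesis using S_cancel_right[OF s w] by auto
qed

lemma N_word: "ws \<in> lists S \<Longrightarrow> finite (N (word_prod G ws)) \<and> card (N (word_prod G ws)) \<le> length ws"
proof (induction ws rule: rev_induct)
  case Nil
  then show ?case by (simp add: N_one)
next
  case (snoc s ws)
  then have ws: "ws \<in> lists S" "s \<in> S" by auto
  have "word_prod G (ws @ [s]) = word_prod G ws \<otimes> s"
    using ws word_prod_append[of ws "[s]"] S_carrier by simp
  then obtain \<beta> where b: "N (word_prod G (ws @ [s])) \<subseteq> insert \<beta> (N (word_prod G ws))"
    using N_snoc_subset[OF word_prod_closed[OF ws(1)] ws(2)] by auto
  have IH: "finite (N (word_prod G ws))" "card (N (word_prod G ws)) \<le> length ws" using snoc ws by auto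
  have "card (N (word_prod G (ws @ [s]))) \<le> card (insert \<beta> (N (word_prod G ws)))"
    by (rule card_mono) (use IH b in auto)
  also have "\<dots> \<le> Suc (length ws)" using IH by (simp add: card_insert_if)
  finally show ?case using IH b finite_subset by auto
qed

lemma N_finite: "w \<in> carrier G \<Longrightarrow> finite (N w)"
  using carrier_words[of w] N_word by blast

lemma N_nonempty: "w \<in> carrier G \<Longrightarrow> w \<noteq> \<one> \<Longrightarrow> N w \<noteq> {}"
proof -
  assume w: "w \<in> carrier G" "w \<noteq> \<one>"
  obtain ws where ws: "ws \<in> lists S" "length ws = len w" "word_prod G ws = w" using len_ex[OF w(1)] .
  then have "ws \<noteq> []" using w by auto
  then obtain us t where us: "ws = us @ [t]" by (metis rev_exhaust)
  have t: "t \<in> S" "us \<in> lists S" using ws us by auto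
  have "w = word_prod G us \<otimes> t" using ws us t word_prod_append[of us "[t]"] S_carrier by simp
  then have e: "w \<otimes> t = word_prod G us" using S_cancel_right[OF t(1) word_prod_closed[OF t(2)]] by simp
  then have "\<not> len w < len (w \<otimes> t)" using cox_length_le[OF t(2)] us ws by simp
  then have v: "vpos (rep (w \<otimes> t) (simple_root t))"
    using rep_vneg[OF w(1) t(1)] rep_snoc_simple[OF w(1) t(1)] by simp
  have c: "w \<otimes> t \<in> carrier G" using w t S_carrier by simp
  show ?thesis using N_snoc[OF c t(1) v] S_cancel_right[OF t(1) w(1)] by auto
qed

lemma N_supp:
  assumes J: "J \<subseteq> S" and w: "w \<in> generate G J" and b: "\<beta> \<in> N w"
  shows "supp_in J \<beta>"
proof -
  obtain ws where ws: "ws \<in> lists J" "w = word_prod G ws" using generate_words[OF J] w by auto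
  have "\<forall>\<beta>\<in>N (word_prod G ws). supp_in J \<beta>" using ws(1)
  proof (induction ws)
    case Nil
    then show ?case by (simp add: N_one)
  next
    case (Cons s ws)
    have sw: "s \<in> J" "s \<in> S" "ws \<in> lists S" using Cons J by auto
    show ?case
    proof
      fix \<beta> assume b: "\<beta> \<in> N (word_prod G (s # ws))"
      show "supp_in J \<beta>"
      proof (cases "\<beta> = simple_root s")
        case True
        then show ?thesis using sw by simp
      next
        case False
        then have "refl s \<beta> \<in> N (word_prod G ws)"
          using N_cons(2)[OF word_prod_closed[OF sw(3)] sw(2)] b N_pos by auto
        then have "supp_in J (refl s \<beta>)" using Cons by auto
        then have "supp_in J (refl s (refl s \<beta>))" using supp_in_refl sw by blast
        then show ?thesis using sw by simp
      qed
    qed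
  qed
  then show ?thesis using b ws by simp
qed

text \<open>Let \<open>j\<close> be the first letter of a reduced word of
  \<open>inv v \<otimes> w\<close>. Then \<open>inv w\<close> makes the root
  \<open>rep v (simple_root j)\<close> negative. That root is positive, since otherwise its negative
  would be an inversion of \<open>v\<close> but not of \<open>w\<close>. Inclusion of inversion sets
  can thus be climbed cover by cover.\<close>

lemma N_ascend:
  assumes v: "v \<in> carrier G" and w: "w \<in> carrier G" and sub: "N v \<subseteq> N w" and ne: "v \<noteq> w"
  shows "\<exists>j\<in>S. vpos (rep v (simple_root j)) \<and> rep v (simple_root j) \<in> N w"
proof -
  define u where "u = inv v \<otimes> w"
  have u: "u \<in> carrier G" "w = v \<otimes> u" using v w by (auto simp: u_def m_assoc[symmetric])
  have u1: "u \<noteq> \<one>" using u ne v by auto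
  obtain ws where ws: "ws \<in> lists S" "length ws = len u" "word_prod G ws = u" using len_ex[OF u(1)] .
  then obtain j us where us: "ws = j # us" using u1 by (cases ws) auto
  have j: "j \<in> S" "us \<in> lists S" using ws us by auto
  have iu: "inv u \<in> carrier G" using u by simp
  have "u = j \<otimes> word_prod G us" using ws us by simp
  then have "j \<otimes> u = word_prod G us" using S_cancel[OF j(1) word_prod_closed[OF j(2)]] by simp
  then have "len (j \<otimes> u) < len u" using cox_length_le[OF j(2)] us ws by simp
  moreover have "inv (j \<otimes> u) = inv u \<otimes> j" using j u S_carrier S_inv by (simp add: inv_mult_group)
  moreover have "len (inv (j \<otimes> u)) = len (j \<otimes> u)" "len (inv u) = len u"
    using len_inv u j S_carrier by simp_all
  ultimately have nv: "\<not> vpos (rep (inv u) (simple_root j))"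
    using rep_vpos_iff[OF iu j(1)] by simp
  have e: "rep (inv w) (rep v (simple_root j)) = rep (inv u) (simple_root j)"
    using u v by (simp add: inv_mult_group rep_mult)
  have P: "rep v (simple_root j) \<in> Phi" using PhiI[OF v j(1)] .
  have pos: "vpos (rep v (simple_root j))"
  proof (rule ccontr)
    assume n: "\<not> vpos (rep v (simple_root j))"
    let ?n = "\<lambda>r. - rep v (simple_root j) r"
    have nP: "?n \<in> pos_roots" using Phi_neg[OF P] Phi_sign[OF P] n pos_rootsI by simp
    have "rep (inv v) ?n = (\<lambda>r. - simple_root j r)" using v by (simp add: rep_neg)
    then have "?n \<in> N v" using N_iff[OF nP] not_vpos_both[of "simple_root j"] by auto
    then have "?n \<in> N w" using sub by auto
    then have "\<not> vpos (rep (inv w) ?n)" using N_iff[OF nP] by simp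
    moreover have "rep (inv w) ?n = (\<lambda>r. - rep (inv u) (simple_root j) r)" using e w by (simp add: rep_neg)
    ultimately show False using nv Phi_sign[OF PhiI[OF iu j(1)]] by simp
  qed
  have "rep v (simple_root j) \<in> N w" using N_iff[OF pos_rootsI[OF P pos]] e nv by simp
  then show ?thesis using pos j by auto
qed

lemma N_inj: "v \<in> carrier G \<Longrightarrow> w \<in> carrier G \<Longrightarrow> N v = N w \<Longrightarrow> v = w"
proof (rule ccontr)
  assume v: "v \<in> carrier G" and w: "w \<in> carrier G" and e: "N v = N w" and ne: "v \<noteq> w"
  obtain j where "j \<in> S" "vpos (rep v (simple_root j))" "rep v (simple_root j) \<in> N w"
    using N_ascend[OF v w _ ne] e by auto
  then show False using N_snoc[OF v] e by auto
qed

lemma rep_expand: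
  assumes x: "x \<in> carrier G" and v: "supp_in S v"
  shows "rep x v r = (\<Sum>j\<in>S. v j * rep x (simple_root j) r)"
proof -
  have "finite T \<Longrightarrow> rep x (\<lambda>r. if r \<in> T then v r else 0) r = (\<Sum>j\<in>T. v j * rep x (simple_root j) r)" for T
  proof (induction T rule: finite_induct)
    case empty
    have "(\<lambda>r. 0) = lin 0 v 0 v" by (simp add: lin_def)
    then show ?case by (simp add: rep_lin[OF x]) (simp add: lin_def)
  next
    case (insert j T)
    have "(\<lambda>r. if r \<in> insert j T then v r else 0) = lin 1 (\<lambda>r. if r \<in> T then v r else 0) (v j) (simple_root j)"
      using insert.hyps by (auto simp: lin_def simple_root_def)
    then have "rep x (\<lambda>r. if r \<in> insert j T then v r else 0) r
      = rep x (\<lambda>r. if r \<in> T then v r else 0) r + v j * rep x (simple_root j) r"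
      by (simp only: rep_lin[OF x]) (simp add: lin_def)
    then show ?case using insert by simp
  qed
  from this[OF fin] have "rep x (\<lambda>r. if r \<in> S then v r else 0) r = (\<Sum>j\<in>S. v j * rep x (simple_root j) r)" .
  moreover have "(\<lambda>r. if r \<in> S then v r else 0) = v" using v by (intro ext) (auto simp: supp_in_def)
  ultimately show ?thesis by simp
qed

text \<open>If \<open>inv w\<close> kept all simple roots of \<open>J\<close> positive, it would
  keep every positive root supported in \<open>J\<close> positive.\<close>

lemma N_simple_ex:
  assumes w: "w \<in> carrier G" and b: "\<beta> \<in> N w" and J: "J \<subseteq> S" "supp_in J \<beta>"
  shows "\<exists>j\<in>J. simple_root j \<in> N w"
proof (rule ccontr)
  assume n: "\<not> ?thesis"
  have bP: "\<beta> \<in> pos_roots" using b N_pos by auto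
  have "0 \<le> rep (inv w) \<beta> r" for r
  proof -
    have "0 \<le> \<beta> j * rep (inv w) (simple_root j) r" if j: "j \<in> S" for j
    proof (cases "j \<in> J")
      case True
      then have "vpos (rep (inv w) (simple_root j))" using n N_iff[OF pos_roots_simple[OF j]] by auto
      then show ?thesis using vpos_nonneg pos_rootsD(2)[OF bP] by (metis mult_nonneg_nonneg)
    next
      case False
      then have "\<beta> j = 0" using J by (auto simp: supp_in_def)
      then show ?thesis by simp
    qed
    then show ?thesis using rep_expand[of "inv w" \<beta> r] w supp_in_mono[OF J(2,1)] by (simp add: sum_nonneg)
  qed
  then have "vpos (rep (inv w) \<beta>)" using Phi_nonneg Phi_rep[OF pos_rootsD(1)[OF bP]] w by simp
  then show False using b N_iff[OF bP] by simp
qed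

section \<open>Standard parabolic subgroups\<close>

lemma generate_carrier: "J \<subseteq> S \<Longrightarrow> x \<in> generate G J \<Longrightarrow> x \<in> carrier G"
proof -
  assume J: "J \<subseteq> S" "x \<in> generate G J"
  then obtain ws where ws: "ws \<in> lists J" "x = word_prod G ws" using generate_words by auto
  then have "ws \<in> lists S" using J by auto
  then show ?thesis using ws word_prod_closed by simp
qed

lemma generate_cons: "J \<subseteq> S \<Longrightarrow> j \<in> J \<Longrightarrow> x \<in> generate G J \<Longrightarrow> j \<otimes> x \<in> generate G J"
  by (blast intro: generate.intros)

text \<open>Letters of \<open>J\<close> whose simple roots are inversions are stripped from the
  left; their reflections preserve support in \<open>J\<close>. When none is left, no inversion is
  supported in \<open>J\<close>, by \<open>N_simple_ex\<close>.\<close>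

lemma par_N:
  assumes w: "w \<in> carrier G" and J: "J \<subseteq> S"
  shows "\<exists>u\<in>generate G J. N u = par J (N w)"
  using w
proof (induction "card (N w)" arbitrary: w rule: less_induct)
  case less
  show ?case
  proof (cases "par J (N w) = {}")
    case True
    then show ?thesis by (intro bexI[of _ \<one>]) (auto simp: N_one intro: generate.one)
  next
    case False
    then obtain \<beta> where "\<beta> \<in> N w" "supp_in J \<beta>" by (auto simp: par_def)
    then obtain j where j: "j \<in> J" "simple_root j \<in> N w" using N_simple_ex[OF less.prems _ J] by auto
    have jS: "j \<in> S" using j J by auto
    have c: "j \<otimes> w \<in> carrier G" using less.prems jS S_carrier by simp
    have fin: "finite (N w)" by (rule N_finite[OF less.prems])
    have Nj: "N (j \<otimes> w) = refl j ` (N w - {simple_root j})" by (rule N_cons_above[OF less.prems jS j(2)])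
    have "card (N (j \<otimes> w)) \<le> card (N w - {simple_root j})" unfolding Nj by (rule card_image_le) (use fin in auto)
    also have "\<dots> < card (N w)" using fin j by (intro card_Diff1_less) auto
    finally obtain u where u: "u \<in> generate G J" "N u = par J (N (j \<otimes> w))" using less.hyps c by blast
    have uc: "u \<in> carrier G" by (rule generate_carrier[OF J u(1)])
    have nj: "simple_root j \<notin> N u" using u(2) N_cons(1)[OF less.prems jS] j by (auto simp: par_def)
    have supp: "supp_in J (refl j \<beta>) \<longleftrightarrow> supp_in J \<beta>" for \<beta>
      using supp_in_refl[of J \<beta> j] supp_in_refl[of J "refl j \<beta>" j] j jS by auto
    have "N (j \<otimes> u) = par J (N w)"
    proof (rule Set.set_eqI)
      fix \<beta>
      show "\<beta> \<in> N (j \<otimes> u) \<longleftrightarrow> \<beta> \<in> par J (N w)"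
      proof (cases "\<beta> = simple_root j")
        case True
        then show ?thesis using N_cons(1)[OF uc jS] nj j by (simp add: par_def)
      next
        case ne: False
        show ?thesis
        proof (cases "\<beta> \<in> pos_roots")
          case True
          have "\<beta> \<in> N (j \<otimes> u) \<longleftrightarrow> refl j \<beta> \<in> N (j \<otimes> w) \<and> supp_in J \<beta>"
            using N_cons(2)[OF uc jS True ne] u(2) supp by (simp add: par_def)
          also have "refl j \<beta> \<in> N (j \<otimes> w) \<longleftrightarrow> \<beta> \<in> N w"
            using N_cons(2)[OF c jS True ne] S_cancel[OF jS less.prems] by simp
          finally show ?thesis by (simp add: par_def)
        next
          case False
          then show ?thesis using N_pos by (auto simp: par_def)
        qed
      qed
    qed
    then show ?thesis using generate_cons[OF J j(1) u(1)] by blast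
  qed
qed

text \<open>Stripping a letter whose simple root is an inversion removes exactly one inversion, and
  inside \<open>generate G J\<close> the letter can be taken from \<open>J\<close>. The count does
  not depend on \<open>J\<close>, so lengths in a parabolic subgroup and in the group agree.\<close>

lemma cox_length_card:
  assumes J: "J \<subseteq> S" and w: "w \<in> generate G J"
  shows "cox_length G J w = card (N w)"
proof (rule antisym)
  have "w \<in> generate G J \<Longrightarrow> \<exists>ws\<in>lists J. length ws = card (N w) \<and> word_prod G ws = w" for w
  proof (induction "card (N w)" arbitrary: w rule: less_induct)
    case less
    have wc: "w \<in> carrier G" by (rule generate_carrier[OF J less.prems])
    show ?case
    proof (cases "w = \<one>")
      case True
      then show ?thesis by (intro bexI[of _ "[]"]) (auto simp: N_one)
    next
      case False
      obtain \<beta> where b: "\<beta> \<in> N w" using N_nonempty[OF wc False] by auto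
      obtain j where j: "j \<in> J" "simple_root j \<in> N w" using N_simple_ex[OF wc b J N_supp[OF J less.prems b]] by auto
      have jS: "j \<in> S" using j J by auto
      have fin: "finite (N w)" by (rule N_finite[OF wc])
      have inj: "inj_on (refl j) X" for X by (rule inj_on_inverseI[of _ "refl j"]) (use jS in simp)
      have cn: "card (N w) = Suc (card (N (j \<otimes> w)))"
        unfolding N_cons_above[OF wc jS j(2)] card_image[OF inj] by (rule card_Suc_Diff1[OF fin j(2), symmetric])
      obtain ws where ws: "ws \<in> lists J" "length ws = card (N (j \<otimes> w))" "word_prod G ws = j \<otimes> w"
        using less.hyps[of "j \<otimes> w"] cn generate_cons[OF J j(1) less.prems] by auto
      show ?thesis
        by (rule bexI[of _ "j # ws"]) (use ws cn j S_cancel[OF jS wc] in auto)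
    qed
  qed
  from this[OF w] show "cox_length G J w \<le> card (N w)" using cox_length_le by metis
  obtain ws where ws: "ws \<in> lists J" "length ws = cox_length G J w" "word_prod G ws = w"
    using cox_length_ex[OF J w] .
  then have "ws \<in> lists S" using J by auto
  then show "card (N w) \<le> cox_length G J w" using N_word[of ws] ws by simp
qed

section \<open>Dihedral cosets, covers and expansions of roots\<close>

lemma pair_root:
  assumes "\<gamma> \<in> pos_roots" "supp_in {j, k} \<gamma>" "j \<noteq> k"
  shows "\<gamma> = lin (\<gamma> j) (simple_root j) (\<gamma> k) (simple_root k)"
  using assms(2,3) by (auto simp: lin_def simple_root_def supp_in_def fun_eq_iff)

text \<open>\<open>y\<close> is minimal in its coset of the dihedral subgroup: it keeps the positive
  roots of that subgroup positive, so no inversion of \<open>e\<close> cancels one of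
  \<open>y\<close>.\<close>

lemma coset_N:
  assumes y: "y \<in> carrier G" and jk: "j \<in> S" "k \<in> S" "j \<noteq> k"
    and pos: "vpos (rep y (simple_root j))" "vpos (rep y (simple_root k))"
    and e: "e \<in> generate G {j, k}"
  shows "N (y \<otimes> e) = N y \<union> rep y ` N e"
    and "rep y ` N e \<subseteq> {\<beta> \<in> pos_roots. \<exists>a\<ge>0. \<exists>b\<ge>0. \<beta> = lin a (rep y (simple_root j)) b (rep y (simple_root k))}"
proof -
  have J: "{j, k} \<subseteq> S" using jk by simp
  have ec: "e \<in> carrier G" by (rule generate_carrier[OF J e])
  have i: "rep (inv (y \<otimes> e)) v = rep (inv e) (rep (inv y) v)" for v
    using y ec by (simp add: inv_mult_group rep_mult)
  have im: "rep y \<gamma> \<in> pos_roots \<and> (\<exists>a\<ge>0. \<exists>b\<ge>0. rep y \<gamma> = lin a (rep y (simple_root j)) b (rep y (simple_root k)))"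
    if g: "\<gamma> \<in> N e" for \<gamma>
  proof -
    have gP: "\<gamma> \<in> pos_roots" using g N_pos by auto
    have nn: "0 \<le> \<gamma> j" "0 \<le> \<gamma> k" using vpos_nonneg[OF pos_rootsD(2)[OF gP]] by auto
    have eq: "rep y \<gamma> = lin (\<gamma> j) (rep y (simple_root j)) (\<gamma> k) (rep y (simple_root k))"
      using pair_root[OF gP N_supp[OF J e g] jk(3)] rep_lin[OF y] by metis
    have "0 \<le> rep y \<gamma> r" for r
      unfolding eq using nn vpos_nonneg[OF pos(1)] vpos_nonneg[OF pos(2)] by (simp add: lin_def)
    then have "vpos (rep y \<gamma>)" by (rule Phi_nonneg[OF Phi_rep[OF pos_rootsD(1)[OF gP] y]])
    then show ?thesis using pos_rootsI[OF Phi_rep[OF pos_rootsD(1)[OF gP] y]] nn eq by blast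
  qed
  show "rep y ` N e \<subseteq> {\<beta> \<in> pos_roots. \<exists>a\<ge>0. \<exists>b\<ge>0. \<beta> = lin a (rep y (simple_root j)) b (rep y (simple_root k))}"
    using im by blast
  show "N (y \<otimes> e) = N y \<union> rep y ` N e"
  proof (rule Set.set_eqI)
    fix \<beta>
    have im_iff: "\<beta> \<in> rep y ` N e \<longleftrightarrow> rep (inv y) \<beta> \<in> N e"
      using y image_eqI[of \<beta> "rep y" "rep (inv y) \<beta>" "N e"] by auto
    show "\<beta> \<in> N (y \<otimes> e) \<longleftrightarrow> \<beta> \<in> N y \<union> rep y ` N e"
    proof (cases "\<beta> \<in> pos_roots")
      case False
      moreover have "\<beta> \<notin> rep y ` N e" using False im by auto
      ultimately show ?thesis using N_posD[of \<beta> "y \<otimes> e"] N_posD[of \<beta> y] by auto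
    next
      case True
      let ?g = "rep (inv y) \<beta>"
      have gP: "?g \<in> Phi" using Phi_rep[OF pos_rootsD(1)[OF True]] y by simp
      have in_ye: "\<beta> \<in> N (y \<otimes> e) \<longleftrightarrow> \<not> vpos (rep (inv e) ?g)" using N_iff[OF True] i by simp
      show ?thesis
      proof (cases "vpos ?g")
        case pg: True
        then have "\<beta> \<notin> N y" using N_iff[OF True] by simp
        then show ?thesis using in_ye im_iff N_iff[OF pos_rootsI[OF gP pg]] by simp
      next
        case ng: False
        let ?h = "\<lambda>r. - ?g r"
        have hP: "?h \<in> pos_roots" using Phi_neg[OF gP] Phi_sign[OF gP] ng pos_rootsI by simp
        have "?h \<notin> N e"
        proof
          assume "?h \<in> N e"
          then have "rep y ?h \<in> pos_roots" using im by blast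
          moreover have "rep y ?h = (\<lambda>r. - \<beta> r)" using y by (simp add: rep_neg)
          ultimately show False using pos_rootsD(2) not_vpos_both[OF pos_rootsD(2)[OF True]] by metis
        qed
        then have "vpos (\<lambda>r. - rep (inv e) ?g r)" using N_iff[OF hP] ec by (simp add: rep_neg)
        then have "\<not> vpos (rep (inv e) ?g)" using not_vpos_both by blast
        then show ?thesis using in_ye N_iff[OF True] ng by simp
      qed
    qed
  qed
qed

lemma N_cover:
  assumes w: "w \<in> carrier G" and x: "x \<in> carrier G" and c: "N x = insert \<beta> (N w)" "\<beta> \<notin> N w"
  shows "\<exists>j\<in>S. x = w \<otimes> j \<and> \<beta> = rep w (simple_root j) \<and> vpos (rep w (simple_root j))"
proof -
  have "w \<noteq> x" using c by auto
  then obtain j where j: "j \<in> S" "vpos (rep w (simple_root j))" "rep w (simple_root j) \<in> N x"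
    using N_ascend[OF w x] c by auto
  have s: "N (w \<otimes> j) = insert (rep w (simple_root j)) (N w)" "rep w (simple_root j) \<notin> N w"
    using N_snoc[OF w j(1,2)] by auto
  have b: "\<beta> = rep w (simple_root j)" using j c s by auto
  then have "N (w \<otimes> j) = N x" using s c by simp
  then have "w \<otimes> j = x" using N_inj w x j S_carrier by simp
  then show ?thesis using j b by auto
qed

text \<open>Telescoping: reflecting \<open>simple_root s\<close> in the \<open>i\<close>-th letter
  adds \<open>- A (ws ! i) s\<close> times the simple root of that letter, which the preceding
  prefix then carries along.\<close>

lemma act_expand:
  assumes "ws \<in> lists S" "s \<in> S"
  shows "act ws (simple_root s) = (\<lambda>r. simple_root s r
    + (\<Sum>i\<in>{..<length ws}. (- A (ws ! i) s) * act (take i ws) (simple_root (ws ! i)) r))"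
  using assms
proof (induction ws rule: rev_induct)
  case (snoc x ws)
  have xS: "x \<in> S" "ws \<in> lists S" using snoc by auto
  have "act (ws @ [x]) (simple_root s) = act ws (lin 1 (simple_root s) (- A x s) (simple_root x))"
    using snoc.prems by (simp add: refl_eq_lin coroot_simple)
  also have "\<dots> = lin 1 (act ws (simple_root s)) (- A x s) (act ws (simple_root x))" by (rule act_lin)
  finally have e: "act (ws @ [x]) (simple_root s) = lin 1 (act ws (simple_root s)) (- A x s) (act ws (simple_root x))" .
  show ?case
  proof (rule ext)
    fix r
    have "(\<Sum>i\<in>{..<length ws}. (- A ((ws @ [x]) ! i) s) * act (take i (ws @ [x])) (simple_root ((ws @ [x]) ! i)) r)
       = (\<Sum>i\<in>{..<length ws}. (- A (ws ! i) s) * act (take i ws) (simple_root (ws ! i)) r)"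
      by (rule sum.cong) (auto simp: nth_append)
    then show "act (ws @ [x]) (simple_root s) r = simple_root s r
      + (\<Sum>i\<in>{..<length (ws @ [x])}. (- A ((ws @ [x]) ! i) s) * act (take i (ws @ [x])) (simple_root ((ws @ [x]) ! i)) r)"
      using fun_cong[OF snoc.IH[OF xS(2) snoc.prems(2)], of r] unfolding e by (simp add: lin_def)
  qed
qed simp

lemma Phi_coord_pos: "\<beta> \<in> Phi \<Longrightarrow> 0 < \<beta> r \<Longrightarrow> vpos \<beta>"
proof (rule ccontr)
  assume b: "\<beta> \<in> Phi" "0 < \<beta> r" "\<not> vpos \<beta>"
  then have "vpos (\<lambda>r. - \<beta> r)" using Phi_sign by blast
  then show False using b(2) vpos_nonneg[of "\<lambda>r. - \<beta> r" r] by simp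
qed

lemma act_Phi: "ws \<in> lists S \<Longrightarrow> s \<in> S \<Longrightarrow> act ws (simple_root s) \<in> Phi"
  using PhiI[OF word_prod_closed, of ws s] rep_word by simp

lemma reduced_prefix_pos:
  assumes ws: "u @ x # d \<in> lists S" and red: "len (word_prod G (u @ x # d)) = length (u @ x # d)"
  shows "vpos (act u (simple_root x))" "vpos (rep (inv (word_prod G d)) (simple_root x))"
proof -
  have l: "u \<in> lists S" "x \<in> S" "d \<in> lists S" "u @ [x] \<in> lists S" "x # d \<in> lists S" using ws by auto
  have ux: "word_prod G (u @ [x]) = word_prod G u \<otimes> x" using l word_prod_append[of u "[x]"] S_carrier by simp
  have c: "word_prod G u \<in> carrier G" "word_prod G d \<in> carrier G" "word_prod G (u @ [x]) \<in> carrier G"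
    "x \<in> carrier G" "word_prod G (x # d) \<in> carrier G"
    using l word_prod_closed S_carrier by blast+
  have "word_prod G (u @ x # d) = word_prod G (u @ [x]) \<otimes> word_prod G d"
    using word_prod_append[OF l(4,3)] by simp
  then have "length (u @ x # d) \<le> len (word_prod G (u @ [x])) + len (word_prod G d)"
    using len_mult[OF c(3,2)] red by simp
  then have "length u < len (word_prod G (u @ [x]))" using cox_length_le[OF l(3)] by simp
  then have "len (word_prod G u) < len (word_prod G u \<otimes> x)" using cox_length_le[OF l(1)] ux by simp
  from rep_vpos[OF c(1) l(2) this] show "vpos (act u (simple_root x))" using rep_word[OF l(1)] by simp
  have "word_prod G (u @ x # d) = word_prod G u \<otimes> word_prod G (x # d)"
    using word_prod_append[OF l(1,5)] by simp
  then have "length (u @ x # d) \<le> len (word_prod G u) + len (word_prod G (x # d))"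
    using len_mult[OF c(1,5)] red by simp
  then have "length d < len (word_prod G (x # d))" using cox_length_le[OF l(1)] by simp
  then have "len (word_prod G d) < len (x \<otimes> word_prod G d)" using cox_length_le[OF l(3)] by simp
  moreover have "inv (x \<otimes> word_prod G d) = inv (word_prod G d) \<otimes> x"
    using c l S_inv by (simp add: inv_mult_group)
  ultimately have "len (inv (word_prod G d)) < len (inv (word_prod G d) \<otimes> x)"
    using len_inv[of "x \<otimes> word_prod G d"] len_inv[OF c(2)] c by simp
  from rep_vpos[OF _ l(2) this] show "vpos (rep (inv (word_prod G d)) (simple_root x))" using c by simp
qed

text \<open>A root \<open>t\<close> of minimal height among the inversions of the form \<open>y(simple_root s)\<close>, \<open>y \<in> generate G K\<close>,
  expanded along a shortest word for \<open>y\<close>.\<close>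

lemma descend:
  assumes w: "w \<in> carrier G" and s: "s \<in> S" and K: "K \<subseteq> S" "s \<notin> K"
    and par1: "N w = par (insert s K) (N w)" and a: "simple_root s \<notin> N w" and ne: "N w \<noteq> par K (N w)"
  shows "\<exists>t\<in>N w. \<exists>(I::nat set) a a' \<delta>. finite I \<and> t s = 1 \<and>
          t = (\<lambda>r. simple_root s r + (\<Sum>i\<in>I. a i * \<delta> i r)) \<and>
          (\<forall>i\<in>I. 0 \<le> a i \<and> 0 < a' i \<and> \<delta> i \<in> pos_roots \<and> lin 1 t (- a' i) (\<delta> i) \<in> pos_roots - N w)"
proof -
  obtain x where x: "x \<in> generate G K" "N x = par K (N w)" using par_N[OF w K(1)] by auto
  have xc: "x \<in> carrier G" by (rule generate_carrier[OF K(1) x(1)])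
  have "N x \<subseteq> N w" "x \<noteq> w" using x ne par_subset by auto
  then obtain j where j: "j \<in> S" "vpos (rep x (simple_root j))" "rep x (simple_root j) \<in> N w"
    using N_ascend[OF xc w] by auto
  \<comment> \<open>\<open>x\<close> is the parabolic part for \<open>K\<close>, so a further step
    towards \<open>w\<close> cannot use a letter of \<open>K\<close>; a letter outside
    \<open>insert s K\<close> would show in the support.\<close>
  have "j = s"
  proof (rule ccontr)
    assume js: "j \<noteq> s"
    have sup: "supp_in (insert s K) (rep x (simple_root j))" using j(3) par1 by (auto simp: par_def)
    have "j \<in> K"
    proof (rule ccontr)
      assume "j \<notin> K"
      then have "rep x (simple_root j) j = 1" using rep_fix_coord[OF K(1) x(1)] by simp
      then have "j \<in> insert s K" using sup unfolding supp_in_def by (metis zero_neq_one)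
      then show False using \<open>j \<notin> K\<close> js by simp
    qed
    then have "rep x (simple_root j) \<in> N x" using j(3) x rep_supp_J[OF K(1) x(1), of "simple_root j"] by (simp add: par_def)
    then show False using N_snoc[OF xc j(1,2)] by simp
  qed
  obtain ws0 where ws0: "ws0 \<in> lists K" "x = word_prod G ws0" using generate_words[OF K(1)] x by auto
  have KS: "ws \<in> lists K \<Longrightarrow> ws \<in> lists S" for ws using K by auto
  define T where "T = {t \<in> N w. \<exists>ws\<in>lists K. t = act ws (simple_root s)}"
  have T: "finite T" "T \<noteq> {}"
    using N_finite[OF w] j(3) \<open>j = s\<close> ws0 rep_word[OF KS[OF ws0(1)]] by (auto simp: T_def)
  define h where "h v = (\<Sum>r\<in>S. v r)" for v :: "'a \<Rightarrow> real"
  define t where "t = arg_min_on h T"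
  have tT: "t \<in> T" and min: "\<And>z. z \<in> T \<Longrightarrow> \<not> h z < h t"
    using arg_min_if_finite[OF T, of h] by (auto simp: t_def)
  have "\<exists>ws. (ws \<in> lists K \<and> t = act ws (simple_root s)) \<and>
      (\<forall>vs. vs \<in> lists K \<and> t = act vs (simple_root s) \<longrightarrow> length ws \<le> length vs)"
    using tT ex_has_least_nat[of "\<lambda>ws. ws \<in> lists K \<and> t = act ws (simple_root s)" _ length] by (auto simp: T_def)
  then obtain ws where ws: "ws \<in> lists K" "t = act ws (simple_root s)"
    and short: "\<And>vs. vs \<in> lists K \<Longrightarrow> t = act vs (simple_root s) \<Longrightarrow> length ws \<le> length vs" by auto
  have wsS: "ws \<in> lists S" by (rule KS[OF ws(1)])
  have wK: "word_prod G ws \<in> generate G K" using generate_words[OF K(1)] ws by auto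
  have red: "len (word_prod G ws) = length ws"
  proof (rule antisym)
    show "len (word_prod G ws) \<le> length ws" by (rule cox_length_le[OF wsS])
    obtain vs where vs: "vs \<in> lists K" "length vs = cox_length G K (word_prod G ws)" "word_prod G vs = word_prod G ws"
      using cox_length_ex[OF K(1) wK] .
    have "act vs = act ws" using word_act[OF KS[OF vs(1)] wsS vs(3)] by simp
    then have "length ws \<le> length vs" by (intro short[OF vs(1)]) (simp only: ws(2))
    also have "\<dots> = len (word_prod G ws)"
      using vs cox_length_card[OF K(1) wK] cox_length_card[of S "word_prod G ws"] gens_generate word_prod_closed[OF wsS] by simp
    finally show "length ws \<le> len (word_prod G ws)" .
  qed
  define \<delta> where "\<delta> i = act (take i ws) (simple_root (ws ! i))" for i
  define a1 where "a1 i = - coroot (ws ! i) (act (drop (Suc i) ws) (simple_root s))" for i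
  have main: "0 \<le> - A (ws ! i) s \<and> 0 < a1 i \<and> \<delta> i \<in> pos_roots \<and> lin 1 t (- a1 i) (\<delta> i) \<in> pos_roots - N w"
    if i: "i < length ws" for i
  proof -
    let ?u = "take i ws" and ?x = "ws ! i" and ?d = "drop (Suc i) ws"
    have dec: "ws = ?u @ ?x # ?d" by (rule id_take_nth_drop[OF i])
    have xK: "?x \<in> K" "?u \<in> lists K" "?d \<in> lists K" using ws(1) dec by (metis append_in_lists_conv Cons_in_lists_iff)+
    have xS: "?x \<in> S" "?u \<in> lists S" "?d \<in> lists S" using xK K KS by auto
    have xs: "?x \<noteq> s" using xK K by auto
    have dc: "word_prod G ?d \<in> carrier G" by (rule word_prod_closed[OF xS(3)])
    have pos: "vpos (act ?u (simple_root ?x))" "vpos (rep (inv (word_prod G ?d)) (simple_root ?x))"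
      using reduced_prefix_pos[of ?u ?x ?d] wsS red dec by simp_all
    have dP: "\<delta> i \<in> pos_roots" unfolding \<delta>_def using pos_rootsI[OF act_Phi[OF xS(2,1)] pos(1)] .
    define v where "v = rep (inv (word_prod G ?d)) (simple_root ?x)"
    have vsup: "supp_in K v"
    proof -
      have "inv (word_prod G ?d) \<in> generate G K" using inv_word[OF xS(3)] generate_words[OF K(1)] xK by auto
      then show ?thesis unfolding v_def using rep_supp_J[OF K(1)] xK by simp
    qed
    \<comment> \<open>\<open>v\<close> is positive and supported away from \<open>s\<close>. By
      invariance of \<open>bil\<close> this pairing equals \<open>- a1 i\<close>.\<close>
    have "coroot s v \<le> 0" unfolding coroot_def
    proof (rule sum_nonpos)
      fix r assume r: "r \<in> S"
      show "A s r * v r \<le> 0"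
      proof (cases "r = s")
        case True
        moreover have "v s = 0" using vsup K(2) unfolding supp_in_def by metis
        ultimately show ?thesis by simp
      next
        case False
        then show ?thesis using A_nonpos[OF s r] vpos_nonneg[OF pos(2), of r] by (auto simp: v_def intro: mult_nonpos_nonneg)
      qed
    qed
    moreover have "coroot s v = coroot ?x (act ?d (simple_root s))"
    proof -
      have "coroot ?x (act ?d (simple_root s)) = bil (simple_root ?x) (rep (word_prod G ?d) (simple_root s))"
        using bil_simple_left[OF xS(1)] rep_word[OF xS(3)] by simp
      also have "\<dots> = bil (rep (word_prod G ?d) v) (rep (word_prod G ?d) (simple_root s))"
        using dc by (simp add: v_def)
      also have "\<dots> = bil (simple_root s) v" using rep_bil[OF dc] bil_sym by simp
      finally show ?thesis using bil_simple_left[OF s] by simp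
    qed
    ultimately have a0: "0 \<le> a1 i" by (simp add: a1_def)
    have "a1 i \<noteq> 0"
    proof
      assume "a1 i = 0"
      then have "refl ?x (act ?d (simple_root s)) = act ?d (simple_root s)" by (simp add: a1_def refl_def)
      moreover have "t = act ?u (refl ?x (act ?d (simple_root s)))" using ws(2) dec by (metis act_simps(2,3))
      ultimately have "t = act (?u @ ?d) (simple_root s)" by simp
      then have "length ws \<le> length (?u @ ?d)" by (intro short) (use xK in auto)
      then show False using i by simp
    qed
    then have a1: "0 < a1 i" using a0 by simp
    \<comment> \<open>Deleting the \<open>i\<close>-th letter subtracts \<open>a1 i\<close> times
      \<open>\<delta> i\<close>. The result has smaller height, so minimality of \<open>t\<close>
      keeps it out of \<open>N w\<close>.\<close>
    let ?t = "act (?u @ ?d) (simple_root s)"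
    have "t = act ?u (refl ?x (act ?d (simple_root s)))" using ws(2) dec by (metis act_simps(2,3))
    also have "\<dots> = lin 1 ?t (a1 i) (\<delta> i)"
      unfolding refl_eq_lin act_lin by (simp add: \<delta>_def a1_def)
    finally have tt: "t = lin 1 ?t (a1 i) (\<delta> i)" .
    then have t': "lin 1 t (- a1 i) (\<delta> i) = ?t" by (simp add: lin_def)
    have udK: "?u @ ?d \<in> lists K" using xK by auto
    have "s \<notin> set (?u @ ?d)" using udK K by auto
    then have "?t s = 1" using act_other by simp
    then have tP: "?t \<in> pos_roots"
      using Phi_coord_pos[of ?t s] act_Phi[OF KS[OF udK] s] pos_rootsI by simp
    have "?t \<notin> N w"
    proof
      assume "?t \<in> N w"
      then have "?t \<in> T" unfolding T_def using udK by blast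
      then have nl: "\<not> h ?t < h t" by (rule min)
      have ht: "h t = h ?t + a1 i * h (\<delta> i)"
        by (subst tt) (simp add: h_def lin_def sum.distrib sum_distrib_left)
      have "0 < h (\<delta> i)"
      proof -
        obtain r where r: "\<delta> i r \<noteq> 0" using pos_rootsD(2)[OF dP] unfolding vpos_def by blast
        have rS: "r \<in> S" using r Phi_supp[OF pos_rootsD(1)[OF dP]] by (auto simp: supp_in_def)
        show ?thesis unfolding h_def
          by (rule sum_pos2[OF fin rS])
            (use r vpos_nonneg[OF pos_rootsD(2)[OF dP]] in \<open>auto simp: order_less_le\<close>)
      qed
      then show False using nl ht a1 by simp
    qed
    then have "lin 1 t (- a1 i) (\<delta> i) \<in> pos_roots - N w" using t' tP by simp
    moreover have "0 \<le> - A ?x s" using A_nonpos[OF xS(1) s xs] by simp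
    ultimately show ?thesis using a1 dP by blast
  qed
  show ?thesis
  proof (intro bexI exI conjI ballI)
    show "t \<in> N w" using tT by (simp add: T_def)
    show "finite {..<length ws}" by simp
    have "s \<notin> set ws" using ws K by auto
    then show "t s = 1" using ws(2) act_other by simp
    show "t = (\<lambda>r. simple_root s r + (\<Sum>i\<in>{..<length ws}. (- A (ws ! i) s) * \<delta> i r))"
      unfolding \<delta>_def ws(2) by (rule act_expand[OF wsS s])
  qed (use main in \<open>blast+\<close>)
qed

section \<open>The group as a family of inversion sets\<close>

sublocale inversion_sets S A pos_roots "N ` carrier G"
proof
  fix \<beta> assume "\<beta> \<in> pos_roots"
  then show "vpos \<beta>" "supp_in S \<beta>" using pos_rootsD Phi_supp by blast+
next
  show "s \<in> S \<Longrightarrow> simple_root s \<in> pos_roots" for s by (rule pos_roots_simple)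
  show "\<beta> \<in> pos_roots \<Longrightarrow> (\<lambda>r. c * \<beta> r) \<in> pos_roots \<Longrightarrow> c = 1" for \<beta> c by (rule pos_roots_scale)
  show "s \<in> S \<Longrightarrow> \<beta> \<in> pos_roots \<Longrightarrow> \<beta> \<noteq> simple_root s \<Longrightarrow> refl s \<beta> \<in> pos_roots" for s \<beta>
    by (rule pos_roots_refl)
  show "R \<in> N ` carrier G \<Longrightarrow> R \<subseteq> pos_roots" for R using N_pos by auto
  show "R \<in> N ` carrier G \<Longrightarrow> finite R" for R using N_finite by auto
  show "{} \<in> N ` carrier G" by (rule image_eqI[of _ _ \<one>]) (simp_all add: N_one)
next
  fix R s assume R: "R \<in> N ` carrier G" and s: "s \<in> S"
  then obtain w where w: "w \<in> carrier G" "R = N w" by auto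
  have c: "s \<otimes> w \<in> carrier G" using w s S_carrier by simp
  show "refl s ` (R - {simple_root s}) \<in> N ` carrier G" if "simple_root s \<in> R"
    using N_cons_above[OF w(1) s] that w c by (metis image_eqI)
  show "insert (simple_root s) (refl s ` R) \<in> N ` carrier G" if "simple_root s \<notin> R"
    using N_cons_below[OF w(1) s] that w c by (metis image_eqI)
next
  fix R R' assume R: "R \<in> N ` carrier G" "R' \<in> N ` carrier G" "R \<subset> R'"
  then obtain v w where vw: "v \<in> carrier G" "R = N v" "w \<in> carrier G" "R' = N w" by auto
  have "v \<noteq> w" using R vw by auto
  then obtain j where j: "j \<in> S" "vpos (rep v (simple_root j))" "rep v (simple_root j) \<in> N w"
    using N_ascend[OF vw(1,3)] R vw by auto
  have "N (v \<otimes> j) = insert (rep v (simple_root j)) (N v)" "rep v (simple_root j) \<notin> N v"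
    using N_snoc[OF vw(1) j(1,2)] by auto
  moreover have "v \<otimes> j \<in> carrier G" using vw j S_carrier by simp
  ultimately show "\<exists>\<beta>\<in>R' - R. insert \<beta> R \<in> N ` carrier G"
    using j vw by (intro bexI[of _ "rep v (simple_root j)"]) (auto intro: image_eqI)
next
  fix R \<beta> \<gamma> and a b :: real
  assume R: "R \<in> N ` carrier G" and ab: "0 \<le> a" "0 \<le> b"
  obtain w where w: "w \<in> carrier G" "R = N w" using R by auto
  have l: "rep (inv w) (lin a \<beta> b \<gamma>) = lin a (rep (inv w) \<beta>) b (rep (inv w) \<gamma>)" using w by (simp add: rep_lin)
  have PI: "rep (inv w) \<rho> \<in> Phi" if "\<rho> \<in> pos_roots" for \<rho> using Phi_rep[OF pos_rootsD(1)[OF that]] w by simp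
  show "lin a \<beta> b \<gamma> \<in> R" if bg: "\<beta> \<in> R" "\<gamma> \<in> R" and P: "lin a \<beta> b \<gamma> \<in> pos_roots"
  proof -
    have bP: "\<beta> \<in> pos_roots" "\<gamma> \<in> pos_roots" using bg w N_posD by auto
    have neg: "vpos (\<lambda>r. - rep (inv w) \<beta> r)" "vpos (\<lambda>r. - rep (inv w) \<gamma> r)"
      using bg w N_iff[OF bP(1)] N_iff[OF bP(2)] Phi_sign[OF PI[OF bP(1)]] Phi_sign[OF PI[OF bP(2)]] by auto
    have "rep (inv w) (lin a \<beta> b \<gamma>) r \<le> 0" for r
    proof -
      have "rep (inv w) \<beta> r \<le> 0" "rep (inv w) \<gamma> r \<le> 0" using vpos_nonneg[OF neg(1), of r] vpos_nonneg[OF neg(2), of r] by auto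
      then have "a * rep (inv w) \<beta> r \<le> 0" "b * rep (inv w) \<gamma> r \<le> 0" using ab by (auto simp: mult_nonneg_nonpos)
      moreover have "rep (inv w) (lin a \<beta> b \<gamma>) r = a * rep (inv w) \<beta> r + b * rep (inv w) \<gamma> r"
        by (subst l) (simp only: lin_def)
      ultimately show ?thesis by linarith
    qed
    then have "\<not> vpos (rep (inv w) (lin a \<beta> b \<gamma>))" unfolding vpos_def by (meson order_antisym)
    then show ?thesis using N_iff[OF P] w by simp
  qed
  show "\<beta> \<in> R \<or> \<gamma> \<in> R" if bP: "\<beta> \<in> pos_roots" "\<gamma> \<in> pos_roots" and m: "lin a \<beta> b \<gamma> \<in> R"
  proof (rule ccontr)
    assume n: "\<not> ?thesis"
    have pos: "vpos (rep (inv w) \<beta>)" "vpos (rep (inv w) \<gamma>)" using n w N_iff[OF bP(1)] N_iff[OF bP(2)] by auto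
    have lP: "lin a \<beta> b \<gamma> \<in> pos_roots" using m w N_posD by auto
    have "0 \<le> rep (inv w) (lin a \<beta> b \<gamma>) r" for r
      unfolding l using ab vpos_nonneg[OF pos(1)] vpos_nonneg[OF pos(2)] by (simp add: lin_def)
    then have "vpos (rep (inv w) (lin a \<beta> b \<gamma>))" by (rule Phi_nonneg[OF PI[OF lP]])
    then show False using m w N_iff[OF lP] by simp
  qed
next
  fix R J assume R: "R \<in> N ` carrier G" and J: "J \<subseteq> S"
  obtain w where w: "w \<in> carrier G" "R = N w" using R by auto
  obtain u where "u \<in> generate G J" "N u = par J (N w)" using par_N[OF w(1) J] by auto
  then show "par J R \<in> N ` carrier G" using generate_carrier[OF J] w by (metis image_eqI)
next
  fix R p q U
  assume R: "R \<in> N ` carrier G" "insert p R \<in> N ` carrier G" "insert q R \<in> N ` carrier G"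
    and n: "p \<notin> R" "q \<notin> R" "p \<noteq> q" and U: "U \<in> N ` carrier G" "insert p (insert q R) \<subseteq> U"
  obtain w x z u where wx: "w \<in> carrier G" "R = N w" "x \<in> carrier G" "insert p R = N x" "z \<in> carrier G" "insert q R = N z"
    "u \<in> carrier G" "U = N u" using R U by auto
  obtain j where j: "j \<in> S" "p = rep w (simple_root j)" "vpos (rep w (simple_root j))"
    using N_cover[OF wx(1,3), of p] wx n by auto
  obtain k where k: "k \<in> S" "q = rep w (simple_root k)" "vpos (rep w (simple_root k))"
    using N_cover[OF wx(1,5), of q] wx n by auto
  have jk: "j \<noteq> k" "{j, k} \<subseteq> S" using n j k by auto
  define d where "d = inv w \<otimes> u"
  have d: "d \<in> carrier G" "\<And>v. rep (inv d) v = rep (inv u) (rep w v)"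
    using wx by (auto simp: d_def inv_mult_group rep_mult)
  have simple: "simple_root j \<in> N d" "simple_root k \<in> N d"
  proof -
    have P: "p \<in> pos_roots" "q \<in> pos_roots" using pos_rootsI[OF PhiI[OF wx(1)]] j k by auto
    have "\<not> vpos (rep (inv u) p)" "\<not> vpos (rep (inv u) q)" using U wx N_iff[OF P(1)] N_iff[OF P(2)] by auto
    then show "simple_root j \<in> N d" "simple_root k \<in> N d"
      using N_iff[OF pos_roots_simple] d j k by auto
  qed
  \<comment> \<open>Both simple roots of the dihedral subgroup are inversions of \<open>d\<close>,
    hence so are all its positive roots; \<open>e\<close> collects them and is its longest element.
    The common bound \<open>U\<close> is what makes this subgroup finite.\<close>
  obtain e where e: "e \<in> generate G {j, k}" "N e = par {j, k} (N d)" using par_N[OF d(1) jk(2)] by auto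
  note cs = coset_N[OF wx(1) j(1) k(1) jk(1) j(3) k(3) e(1)]
  have ec: "w \<otimes> e \<in> carrier G" using wx generate_carrier[OF jk(2) e(1)] by simp
  have "{\<beta> \<in> pos_roots. \<exists>a\<ge>0. \<exists>b\<ge>0. \<beta> = lin a p b q} \<subseteq> rep w ` N e"
  proof
    fix \<beta> assume "\<beta> \<in> {\<beta> \<in> pos_roots. \<exists>a\<ge>0. \<exists>b\<ge>0. \<beta> = lin a p b q}"
    then obtain a b where b: "\<beta> \<in> pos_roots" "0 \<le> a" "0 \<le> b" "\<beta> = lin a p b q" by auto
    let ?g = "lin a (simple_root j) b (simple_root k)"
    have bg: "\<beta> = rep w ?g" using b j k by (simp add: rep_lin[OF wx(1)])
    then have gi: "?g = rep (inv w) \<beta>" using wx by simp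
    have gPhi: "?g \<in> Phi" unfolding gi using Phi_rep[OF pos_rootsD(1)[OF b(1)]] wx by simp
    have "0 \<le> ?g r" for r using b by (simp add: lin_def)
    then have gP: "?g \<in> pos_roots" using pos_rootsI[OF gPhi Phi_nonneg[OF gPhi]] by simp
    have "rep (inv d) ?g r \<le> 0" for r
    proof -
      have P: "rep (inv d) (simple_root j) \<in> Phi" "rep (inv d) (simple_root k) \<in> Phi" using PhiI[of "inv d" j] PhiI[of "inv d" k] d(1) j(1) k(1) by simp_all
      have "vpos (\<lambda>r. - rep (inv d) (simple_root j) r)" "vpos (\<lambda>r. - rep (inv d) (simple_root k) r)"
        using simple N_iff[OF pos_roots_simple[OF j(1)]] N_iff[OF pos_roots_simple[OF k(1)]] Phi_sign[OF P(1)] Phi_sign[OF P(2)] by auto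
      from vpos_nonneg[OF this(1), of r] vpos_nonneg[OF this(2), of r]
      have "rep (inv d) (simple_root j) r \<le> 0" "rep (inv d) (simple_root k) r \<le> 0" by auto
      then have "a * rep (inv d) (simple_root j) r \<le> 0" "b * rep (inv d) (simple_root k) r \<le> 0"
        using b by (auto simp: mult_nonneg_nonpos)
      moreover have "rep (inv d) ?g r = a * rep (inv d) (simple_root j) r + b * rep (inv d) (simple_root k) r"
        using rep_lin[of "inv d"] d(1) by (simp add: lin_def)
      ultimately show ?thesis by linarith
    qed
    then have "\<not> vpos (rep (inv d) ?g)" unfolding vpos_def by (meson order_antisym)
    then have "?g \<in> N d" using N_iff[OF gP] by simp
    moreover have "supp_in {j, k} ?g" by (rule supp_in_lin) auto
    ultimately have "?g \<in> N e" using e by (simp add: par_def)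
    then show "\<beta> \<in> rep w ` N e" using bg by auto
  qed
  then have "R \<union> {\<beta> \<in> pos_roots. \<exists>a\<ge>0. \<exists>b\<ge>0. \<beta> = lin a p b q} = N (w \<otimes> e)"
    using cs wx(2) j(2) k(2) by auto
  then show "R \<union> {\<beta> \<in> pos_roots. \<exists>a\<ge>0. \<exists>b\<ge>0. \<beta> = lin a p b q} \<in> N ` carrier G" using ec by simp
next
  fix R X Y
  assume RXY: "R \<in> N ` carrier G" "X \<in> N ` carrier G" "Y \<in> N ` carrier G" "X \<noteq> Y"
    and aX: "\<exists>\<beta>. \<beta> \<notin> R \<inter> X \<and> (X = insert \<beta> R \<or> R = insert \<beta> X) \<and> X \<noteq> R"
    and aY: "\<exists>\<beta>. \<beta> \<notin> R \<inter> Y \<and> (Y = insert \<beta> R \<or> R = insert \<beta> Y) \<and> Y \<noteq> R"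
  obtain w where w: "w \<in> carrier G" "R = N w" using RXY by auto
  have adj: "\<exists>j\<in>S. Z = N (w \<otimes> j)" if Z: "Z \<in> N ` carrier G"
    and aZ: "\<exists>\<beta>. \<beta> \<notin> R \<inter> Z \<and> (Z = insert \<beta> R \<or> R = insert \<beta> Z) \<and> Z \<noteq> R" for Z
  proof -
    obtain z where z: "z \<in> carrier G" "Z = N z" using Z by auto
    obtain \<beta> where b: "Z = insert \<beta> R \<or> R = insert \<beta> Z" "Z \<noteq> R" using aZ by auto
    from b(1) show ?thesis
    proof
      assume e: "Z = insert \<beta> R"
      then have "\<beta> \<notin> R" using b by auto
      then show ?thesis using N_cover[OF w(1) z(1), of \<beta>] e w z by auto
    next
      assume e: "R = insert \<beta> Z"
      then have "\<beta> \<notin> Z" using b by auto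
      then obtain j where j: "j \<in> S" "w = z \<otimes> j" using N_cover[OF z(1) w(1), of \<beta>] e w z by auto
      have "N z = N (w \<otimes> j)" using S_cancel_right[OF j(1) z(1)] j(2) by simp
      then show ?thesis using z(2) j(1) by blast
    qed
  qed
  obtain j where j: "j \<in> S" "X = N (w \<otimes> j)" using adj[OF RXY(2) aX] by auto
  obtain k where k: "k \<in> S" "Y = N (w \<otimes> k)" using adj[OF RXY(3) aY] by auto
  have jk: "j \<noteq> k" "{j, k} \<subseteq> S" using RXY j k by auto
  let ?E = "generate G {j, k}"
  \<comment> \<open>The three elements lie in one coset of the dihedral subgroup, whose shortest
    element is the bottom of the polygon.\<close>
  have "\<exists>d. d \<in> ?E \<and> (\<forall>d'. d' \<in> ?E \<longrightarrow> len (w \<otimes> d) \<le> len (w \<otimes> d'))"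
    by (rule ex_has_least_nat[of "\<lambda>d. d \<in> ?E" \<one>]) (rule generate.one)
  then obtain d where d: "d \<in> ?E" "\<And>d'. d' \<in> ?E \<Longrightarrow> len (w \<otimes> d) \<le> len (w \<otimes> d')" by auto
  have dc: "d \<in> carrier G" by (rule generate_carrier[OF jk(2) d(1)])
  have gen: "subgroup ?E G" by (rule generate_is_subgroup) (use jk S_carrier in auto)
  define y where "y = w \<otimes> d"
  have yc: "y \<in> carrier G" using w dc by (simp add: y_def)
  have ypos: "vpos (rep y (simple_root i))" if i: "i \<in> {j, k}" for i
  proof -
    have iS: "i \<in> S" using i jk by auto
    have iE: "d \<otimes> i \<in> ?E" by (rule generate.eng[OF d(1) generate.incl[OF i]])
    have "y \<otimes> i = w \<otimes> (d \<otimes> i)" using w dc S_carrier[OF iS] by (simp add: y_def m_assoc)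
    then have "len y \<le> len (y \<otimes> i)" using d(2)[OF iE] by (simp add: y_def)
    then have "len y < len (y \<otimes> i)" using len_snoc[OF yc iS] by auto
    then show ?thesis by (rule rep_vpos[OF yc iS])
  qed
  let ?p = "rep y (simple_root j)" and ?q = "rep y (simple_root k)"
  have pq: "vpos ?p" "vpos ?q" using ypos by auto
  let ?C = "{\<beta> \<in> pos_roots. \<exists>a\<ge>0. \<exists>b\<ge>0. \<beta> = lin a ?p b ?q}"
  have inE: "N y \<subseteq> N (w \<otimes> e) \<and> N (w \<otimes> e) \<subseteq> N y \<union> ?C" if e: "e \<in> ?E" for e
  proof -
    have ec: "e \<in> carrier G" by (rule generate_carrier[OF jk(2) e])
    have f: "inv d \<otimes> e \<in> ?E" using gen d(1) e by (simp add: subgroup.m_closed subgroup.m_inv_closed)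
    have "w \<otimes> e = y \<otimes> (inv d \<otimes> e)" using w dc ec by (simp add: y_def m_assoc) (simp add: m_assoc[symmetric])
    then show ?thesis using coset_N[OF yc j(1) k(1) jk(1) pq f] by auto
  qed
  have E: "\<one> \<in> ?E" "j \<in> ?E" "k \<in> ?E" by (auto intro: generate.intros)
  have c: "y \<otimes> j \<in> carrier G" "y \<otimes> k \<in> carrier G" using yc j k S_carrier by auto
  show "\<exists>R0 p q. R0 \<in> N ` carrier G \<and> insert p R0 \<in> N ` carrier G \<and> insert q R0 \<in> N ` carrier G
      \<and> p \<notin> R0 \<and> q \<notin> R0 \<and> p \<noteq> q \<and> R0 \<subseteq> R \<inter> X \<inter> Y \<and>
      R \<union> X \<union> Y \<subseteq> R0 \<union> {\<beta> \<in> pos_roots. \<exists>a\<ge>0. \<exists>b\<ge>0. \<beta> = lin a p b q}"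
  proof (intro exI conjI)
    show "N y \<in> N ` carrier G" using yc by auto
    show "insert ?p (N y) \<in> N ` carrier G" "insert ?q (N y) \<in> N ` carrier G"
      using N_snoc[OF yc j(1) pq(1)] N_snoc[OF yc k(1) pq(2)] c by (metis image_eqI)+
    show "?p \<notin> N y" "?q \<notin> N y" using N_snoc[OF yc j(1) pq(1)] N_snoc[OF yc k(1) pq(2)] by auto
    show "?p \<noteq> ?q"
    proof
      assume "?p = ?q"
      then have "rep (inv y) ?p = rep (inv y) ?q" by simp
      then show False using yc jk by simp
    qed
    show "N y \<subseteq> R \<inter> X \<inter> Y" "R \<union> X \<union> Y \<subseteq> N y \<union> ?C"
      using inE[OF E(1)] inE[OF E(2)] inE[OF E(3)] w j k by auto
  qed
next
  fix R s K
  assume R: "R \<in> N ` carrier G" and h: "s \<in> S" "K \<subseteq> S" "s \<notin> K" "R = par (insert s K) R"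
    "simple_root s \<notin> R" "R \<noteq> par K R"
  obtain w where w: "w \<in> carrier G" "R = N w" using R by auto
  show "\<exists>t\<in>R. \<exists>(I::nat set) a a' \<delta>. finite I \<and> t s = 1 \<and>
          t = (\<lambda>r. simple_root s r + (\<Sum>i\<in>I. a i * \<delta> i r)) \<and>
          (\<forall>i\<in>I. 0 \<le> a i \<and> 0 < a' i \<and> \<delta> i \<in> pos_roots \<and> lin 1 t (- a' i) (\<delta> i) \<in> pos_roots - R)"
    using descend[OF w(1) h(1-3)] h(4-6) unfolding w(2) by blast
qed

text \<open>Only the entries between \<open>s\<close> and the letters it passes change place, and
  they vanish.\<close>

lemma euler_move:
  assumes "distinct (us @ s # vs)" "\<And>r. r \<in> set us \<Longrightarrow> A r s = 0 \<and> A s r = 0"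
  shows "euler (us @ s # vs) p q = euler (s # us @ vs) p q"
  using assms
proof (induction us)
  case (Cons u us)
  have z: "A u s = 0" "A s u = 0" using Cons.prems by auto
  have n: "s \<notin> set us \<union> set vs" "u \<notin> set us \<union> set vs" using Cons.prems by auto
  have IH: "euler (us @ s # vs) p q = euler (s # us @ vs) p q" using Cons by auto
  have 1: "(\<Sum>r\<in>set (us @ s # vs). A r u * p r) = (\<Sum>r\<in>set (us @ vs). A r u * p r)"
    using n z by simp
  have 2: "(\<Sum>r\<in>set (u # us @ vs). A r s * p r) = (\<Sum>r\<in>set (us @ vs). A r s * p r)"
    using n z by simp
  have "euler ((u # us) @ s # vs) p q
      = p u * q u + (\<Sum>r\<in>set (us @ s # vs). A r u * p r) * q u + euler (us @ s # vs) p q" by simp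
  also have "\<dots> = p s * q s + (\<Sum>r\<in>set (u # us @ vs). A r s * p r) * q s + euler (u # us @ vs) p q"
    unfolding 1 2 IH by simp
  finally show ?case by simp
qed simp

section \<open>Reflections and their roots\<close>

definition reflection :: "('a \<Rightarrow> real) \<Rightarrow> 'a" where
  "reflection \<beta> = (THE t. \<exists>w\<in>carrier G. \<exists>s\<in>S. \<beta> = rep w (simple_root s) \<and> t = w \<otimes> s \<otimes> inv w)"

text \<open>The element \<open>x = inv v \<otimes> w\<close> maps \<open>simple_root s\<close> to
  \<open>simple_root r\<close>. By \<open>refl_invariant\<close>, \<open>r \<otimes> x\<close> and
  \<open>x \<otimes> s\<close> have the same inversions, so they are equal. This makes
  \<open>reflection\<close> well defined.\<close>

lemma conj_unique:
  assumes w: "w \<in> carrier G" "v \<in> carrier G" and s: "s \<in> S" "r \<in> S"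
    and e: "rep w (simple_root s) = rep v (simple_root r)"
  shows "w \<otimes> s \<otimes> inv w = v \<otimes> r \<otimes> inv v"
proof -
  note sc = S_carrier[OF s(1)] S_carrier[OF s(2)]
  define x where "x = inv v \<otimes> w"
  have x: "x \<in> carrier G" "w = v \<otimes> x" using w by (auto simp: x_def m_assoc[symmetric])
  have rx: "rep x (simple_root s) = simple_root r" using e w by (simp add: x_def rep_mult)
  have up: "N (x \<otimes> s) = insert (simple_root r) (N x)" "simple_root r \<notin> N x"
    using N_snoc[OF x(1) s(1)] rx by auto
  have c: "x \<otimes> s \<in> carrier G" "r \<otimes> x \<in> carrier G" using x sc by auto
  have "refl r ` N x = N x"
    by (rule refl_invariant[OF s(2) _ _ up(2)]) (use x c up in \<open>auto intro: image_eqI[of _ _ "x \<otimes> s"]\<close>)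
  then have "N (r \<otimes> x) = N (x \<otimes> s)" using N_cons_below[OF x(1) s(2) up(2)] up by simp
  then have "r \<otimes> x = x \<otimes> s" by (rule N_inj[OF c(2,1)])
  then have "w \<otimes> s = v \<otimes> r \<otimes> x" using x w sc by (simp add: m_assoc)
  then have "w \<otimes> s \<otimes> inv w = v \<otimes> r \<otimes> x \<otimes> inv w" by simp
  also have "\<dots> = v \<otimes> r \<otimes> (x \<otimes> (inv x \<otimes> inv v))" using x w sc by (simp add: m_assoc inv_mult_group)
  also have "\<dots> = v \<otimes> r \<otimes> inv v" using x w by (simp add: m_assoc[symmetric])
  finally show ?thesis .
qed

lemma reflection_rep:
  assumes "w \<in> carrier G" "s \<in> S"
  shows "reflection (rep w (simple_root s)) = w \<otimes> s \<otimes> inv w"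
  unfolding reflection_def
proof (rule the_equality)
  show "\<exists>v\<in>carrier G. \<exists>r\<in>S. rep w (simple_root s) = rep v (simple_root r) \<and> w \<otimes> s \<otimes> inv w = v \<otimes> r \<otimes> inv v"
    using assms by blast
  show "t = w \<otimes> s \<otimes> inv w"
    if "\<exists>v\<in>carrier G. \<exists>r\<in>S. rep w (simple_root s) = rep v (simple_root r) \<and> t = v \<otimes> r \<otimes> inv v" for t
    using that conj_unique[OF assms(1) _ assms(2)] by metis
qed

lemma reflection_carrier: "\<beta> \<in> Phi \<Longrightarrow> reflection \<beta> \<in> carrier G"
  by (elim PhiE) (simp add: reflection_rep S_carrier)

lemma reflection_square: "\<beta> \<in> Phi \<Longrightarrow> reflection \<beta> \<otimes> reflection \<beta> = \<one>"
proof (elim PhiE)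
  fix w s assume w: "w \<in> carrier G" "s \<in> S" "\<beta> = rep w (simple_root s)"
  note sc = S_carrier[OF w(2)]
  have "reflection \<beta> \<otimes> reflection \<beta> = w \<otimes> s \<otimes> (inv w \<otimes> (w \<otimes> (s \<otimes> inv w)))"
    using w sc by (simp add: reflection_rep m_assoc)
  also have "\<dots> = w \<otimes> s \<otimes> (s \<otimes> inv w)" using w sc by (simp add: m_assoc[symmetric])
  also have "\<dots> = \<one>" using w sc S_cancel[OF w(2), of "inv w"] by (simp add: m_assoc)
  finally show ?thesis .
qed

lemma reflection_act: "\<beta> \<in> Phi \<Longrightarrow> \<exists>c. rep (reflection \<beta>) v = lin 1 v c \<beta>"
proof (elim PhiE)
  fix w s assume w: "w \<in> carrier G" "s \<in> S" "\<beta> = rep w (simple_root s)"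
  have "rep (reflection \<beta>) v = rep w (refl s (rep (inv w) v))"
    using w S_carrier[OF w(2)] by (simp add: reflection_rep rep_mult rep_simple)
  also have "\<dots> = lin 1 v (- coroot s (rep (inv w) v)) \<beta>"
    using w by (simp add: refl_eq_lin rep_lin)
  finally show ?thesis by blast
qed

lemma reflection_neg: "\<beta> \<in> Phi \<Longrightarrow> rep (reflection \<beta>) \<beta> = (\<lambda>r. - \<beta> r)"
proof (elim PhiE)
  fix w s assume w: "w \<in> carrier G" "s \<in> S" "\<beta> = rep w (simple_root s)"
  then show ?thesis
    using S_carrier[OF w(2)] by (simp add: reflection_rep rep_mult rep_simple refl_simple rep_neg)
qed

text \<open>A reflection moves vectors only along its root, so equal reflections have proportional
  roots.\<close>

lemma reflection_inj: "inj_on reflection pos_roots"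
proof (rule inj_onI)
  fix \<beta> \<gamma> assume b: "\<beta> \<in> pos_roots" "\<gamma> \<in> pos_roots" "reflection \<beta> = reflection \<gamma>"
  obtain c where c: "rep (reflection \<beta>) \<gamma> = lin 1 \<gamma> c \<beta>" using reflection_act[OF pos_rootsD(1)[OF b(1)]] by blast
  have "rep (reflection \<beta>) \<gamma> = (\<lambda>r. - \<gamma> r)" using reflection_neg[OF pos_rootsD(1)[OF b(2)]] b(3) by simp
  then have "lin 1 \<gamma> c \<beta> = (\<lambda>r. - \<gamma> r)" using c by simp
  then have g: "\<gamma> r + c * \<beta> r = - \<gamma> r" for r by (metis lin_def mult_1)
  have "\<gamma> r = (- c / 2) * \<beta> r" for r using g[of r] by (simp add: field_simps)
  then have e: "\<gamma> = (\<lambda>r. (- c / 2) * \<beta> r)" by blast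
  then have "- c / 2 = 1" using pos_roots_scale[OF b(1), of "- c / 2"] b(2) by simp
  then show "\<beta> = \<gamma>" using e by simp
qed

text \<open>Appending a letter adds at most one inversion, the image of its simple root under the
  preceding prefix.\<close>

lemma N_word_mem:
  assumes "ws \<in> lists S" "\<beta> \<in> N (word_prod G ws)"
  shows "\<exists>i<length ws. \<beta> = act (take i ws) (simple_root (ws ! i))"
  using assms
proof (induction ws rule: rev_induct)
  case Nil
  then show ?case by (simp add: N_one)
next
  case (snoc s ws)
  have l: "ws \<in> lists S" "s \<in> S" using snoc by auto
  let ?w = "word_prod G ws"
  have wc: "?w \<in> carrier G" by (rule word_prod_closed[OF l(1)])
  have e: "word_prod G (ws @ [s]) = ?w \<otimes> s" using l word_prod_append[of ws "[s]"] S_carrier by simp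
  have "\<beta> = rep ?w (simple_root s) \<or> \<beta> \<in> N ?w"
  proof (cases "vpos (rep ?w (simple_root s))")
    case True
    then show ?thesis using N_snoc[OF wc l(2) True] snoc.prems e by auto
  next
    case False
    have c: "?w \<otimes> s \<in> carrier G" using wc l S_carrier by simp
    have "vpos (rep (?w \<otimes> s) (simple_root s))"
      using False Phi_sign[OF PhiI[OF wc l(2)]] rep_snoc_simple[OF wc l(2)] by simp
    from N_snoc[OF c l(2) this] show ?thesis using S_cancel_right[OF l(2) wc] snoc.prems e by auto
  qed
  then show ?case
  proof
    assume "\<beta> = rep ?w (simple_root s)"
    then show ?thesis using rep_word[OF l(1)] by (intro exI[of _ "length ws"]) simp
  next
    assume "\<beta> \<in> N ?w"
    then obtain i where "i < length ws" "\<beta> = act (take i ws) (simple_root (ws ! i))" using snoc.IH[OF l(1)] by auto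
    then show ?thesis by (intro exI[of _ i]) (simp add: nth_append)
  qed
qed

lemma N_word_reflection:
  assumes ws: "ws \<in> lists S" and b: "\<beta> \<in> N (word_prod G ws)"
  obtains u s d where "ws = u @ s # d" "reflection \<beta> = word_prod G u \<otimes> s \<otimes> inv (word_prod G u)"
proof -
  obtain i where i: "i < length ws" "\<beta> = act (take i ws) (simple_root (ws ! i))" using N_word_mem[OF ws b] by auto
  have dec: "ws = take i ws @ ws ! i # drop (Suc i) ws" by (rule id_take_nth_drop[OF i(1)])
  have l: "take i ws \<in> lists S" "ws ! i \<in> S" using ws dec by (metis append_in_lists_conv Cons_in_lists_iff)+
  have "\<beta> = rep (word_prod G (take i ws)) (simple_root (ws ! i))" using rep_word[OF l(1)] i by simp
  then show thesis using that[OF dec] reflection_rep[OF word_prod_closed[OF l(1)] l(2)] by simp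
qed

text \<open>For an inversion \<open>\<beta>\<close> of \<open>x\<close>, multiplying by its
  reflection deletes a letter from a reduced word: strong exchange. Otherwise \<open>\<beta>\<close>
  is an inversion of \<open>reflection \<beta> \<otimes> x\<close>, and the argument applies with
  the two elements exchanged.\<close>

lemma reflection_card:
  assumes b: "\<beta> \<in> pos_roots" and x: "x \<in> carrier G"
  shows "card (N (reflection \<beta> \<otimes> x)) < card (N x) \<longleftrightarrow> \<beta> \<in> N x"
proof -
  have S': "generate G S = carrier G" by (rule gens_generate)
  have down: "card (N (reflection \<beta> \<otimes> x)) < card (N x)" if x: "x \<in> carrier G" and m: "\<beta> \<in> N x" for x
  proof -
    obtain ws where ws: "ws \<in> lists S" "length ws = len x" "word_prod G ws = x" using len_ex[OF x] .
    obtain u s d where u: "ws = u @ s # d" "reflection \<beta> = word_prod G u \<otimes> s \<otimes> inv (word_prod G u)"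
      using N_word_reflection[OF ws(1), of \<beta>] m ws by auto
    have l: "u \<in> lists S" "s \<in> S" "d \<in> lists S" using ws u by auto
    note c = word_prod_closed[OF l(1)] S_carrier[OF l(2)] word_prod_closed[OF l(3)]
    have "x = word_prod G u \<otimes> (s \<otimes> word_prod G d)" using ws u l word_prod_append[of u "s # d"] by simp
    then have "reflection \<beta> \<otimes> x = word_prod G u \<otimes> s \<otimes> (inv (word_prod G u) \<otimes> (word_prod G u \<otimes> (s \<otimes> word_prod G d)))"
      using u c by (simp add: m_assoc)
    also have "\<dots> = word_prod G u \<otimes> s \<otimes> (s \<otimes> word_prod G d)" using c by (simp add: m_assoc[symmetric])
    also have "\<dots> = word_prod G (u @ d)"
      using c S_cancel[OF l(2) c(3)] word_prod_append[OF l(1,3)] by (simp add: m_assoc)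
    finally have "card (N (reflection \<beta> \<otimes> x)) \<le> length (u @ d)" using N_word[of "u @ d"] l by simp
    also have "\<dots> < len x" using ws u by simp
    also have "len x = card (N x)" using cox_length_card[of S x] x S' by simp
    finally show ?thesis .
  qed
  show ?thesis
  proof
    show "\<beta> \<in> N x \<Longrightarrow> card (N (reflection \<beta> \<otimes> x)) < card (N x)" by (rule down[OF x])
    show "\<beta> \<in> N x" if lt: "card (N (reflection \<beta> \<otimes> x)) < card (N x)"
    proof (rule ccontr)
      assume n: "\<beta> \<notin> N x"
      let ?t = "reflection \<beta>"
      have bP: "\<beta> \<in> Phi" by (rule pos_rootsD(1)[OF b])
      have t: "?t \<in> carrier G" "?t \<otimes> ?t = \<one>" using reflection_carrier[OF bP] reflection_square[OF bP] by auto
      then have ti: "inv ?t = ?t" using inv_equality by simp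
      have tx: "?t \<otimes> x \<in> carrier G" using t x by simp
      have "rep (inv (?t \<otimes> x)) \<beta> = rep (inv x) (rep ?t \<beta>)"
        using t x ti by (simp add: inv_mult_group rep_mult)
      also have "\<dots> = (\<lambda>r. - rep (inv x) \<beta> r)" using x by (simp add: reflection_neg[OF bP] rep_neg)
      finally have "\<not> vpos (rep (inv (?t \<otimes> x)) \<beta>)" using n N_iff[OF b] not_vpos_both by simp
      then have "\<beta> \<in> N (?t \<otimes> x)" using N_iff[OF b] by simp
      then have "card (N (?t \<otimes> (?t \<otimes> x))) < card (N (?t \<otimes> x))" by (rule down[OF tx])
      moreover have "?t \<otimes> (?t \<otimes> x) = x" using t x by (simp add: m_assoc[symmetric])
      ultimately show False using lt by simp
    qed
  qed
qed

lemma word_reflection_generate: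
  assumes J: "J \<subseteq> S" and w: "w \<in> generate G J" and b: "\<beta> \<in> N w"
  shows "reflection \<beta> \<in> reflections G J" "reflection \<beta> \<in> generate G J"
proof -
  obtain ws where ws: "ws \<in> lists J" "w = word_prod G ws" using generate_words[OF J] w by auto
  have wsS: "ws \<in> lists S" using ws J by auto
  obtain u s d where u: "ws = u @ s # d" "reflection \<beta> = word_prod G u \<otimes> s \<otimes> inv (word_prod G u)"
    using N_word_reflection[OF wsS, of \<beta>] b ws by auto
  have l: "u \<in> lists J" "s \<in> J" "u \<in> lists S" using ws wsS u by auto
  have g: "word_prod G u \<in> generate G J" "inv (word_prod G u) \<in> generate G J"
    using generate_words[OF J] l inv_word[OF l(3)] by auto
  show "reflection \<beta> \<in> reflections G J" unfolding reflections_def using u l g by blast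
  show "reflection \<beta> \<in> generate G J"
    unfolding u(2) by (intro generate.eng g) (rule generate.incl[OF l(2)])
qed

text \<open>A root is an inversion of its own reflection. If supported in \<open>J\<close>, it is
  also an inversion of the parabolic part of that reflection, and inversions of elements of
  \<open>generate G J\<close> have their reflections there.\<close>

lemma reflection_generate:
  assumes J: "J \<subseteq> S" and b: "\<beta> \<in> pos_roots"
  shows "reflection \<beta> \<in> generate G J \<longleftrightarrow> supp_in J \<beta>"
proof -
  have bP: "\<beta> \<in> Phi" by (rule pos_rootsD(1)[OF b])
  let ?t = "reflection \<beta>"
  have t: "?t \<in> carrier G" "?t \<otimes> ?t = \<one>" using reflection_carrier[OF bP] reflection_square[OF bP] by auto
  then have "inv ?t = ?t" using inv_equality by simp
  then have bt: "\<beta> \<in> N ?t" using N_iff[OF b] reflection_neg[OF bP] not_vpos_both[OF pos_rootsD(2)[OF b]] by simp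
  show ?thesis
  proof
    show "?t \<in> generate G J \<Longrightarrow> supp_in J \<beta>" using N_supp[OF J _ bt] .
    assume s: "supp_in J \<beta>"
    obtain u where u: "u \<in> generate G J" "N u = par J (N ?t)" using par_N[OF t(1) J] by auto
    then have "\<beta> \<in> N u" using bt s by (simp add: par_def)
    then show "?t \<in> generate G J" by (rule word_reflection_generate(2)[OF J u(1)])
  qed
qed

text \<open>Lengths count \<open>N\<close>, so \<open>reflection_card\<close> turns the length
  condition into membership. If \<open>x\<close> makes \<open>simple_root s\<close> negative,
  \<open>x \<otimes> s\<close> gives the same reflection with a positive root.\<close>

lemma inversions_N:
  assumes J: "J \<subseteq> S" and w: "w \<in> generate G J"
  shows "inversions G J w = reflection ` N w"
proof
  show "inversions G J w \<subseteq> reflection ` N w"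
  proof
    fix t assume t: "t \<in> inversions G J w"
    then obtain x s where x: "x \<in> generate G J" "s \<in> J" "t = x \<otimes> s \<otimes> inv x"
      unfolding inversions_def reflections_def by auto
    have xc: "x \<in> carrier G" and sS: "s \<in> S" using generate_carrier[OF J x(1)] x J by auto
    note sc = S_carrier[OF sS]
    have "\<exists>\<beta>\<in>pos_roots. t = reflection \<beta>"
    proof (cases "vpos (rep x (simple_root s))")
      case True
      then show ?thesis using pos_rootsI[OF PhiI[OF xc sS]] reflection_rep[OF xc sS] x by metis
    next
      case False
      have c: "x \<otimes> s \<in> carrier G" using xc sc by simp
      have "vpos (rep (x \<otimes> s) (simple_root s))"
        using False Phi_sign[OF PhiI[OF xc sS]] rep_snoc_simple[OF xc sS] by simp
      then have "rep (x \<otimes> s) (simple_root s) \<in> pos_roots" using pos_rootsI[OF PhiI[OF c sS]] by simp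
      moreover have "reflection (rep (x \<otimes> s) (simple_root s)) = t"
        using reflection_rep[OF c sS] S_cancel_right[OF sS xc] x xc sc S_inv[OF sS] by (simp add: inv_mult_group m_assoc)
      ultimately show ?thesis by metis
    qed
    then obtain \<beta> where b: "\<beta> \<in> pos_roots" "t = reflection \<beta>" by auto
    have sg: "subgroup (generate G J) G" by (rule generate_is_subgroup) (use J S_carrier in auto)
    have tJ: "t \<in> generate G J"
      unfolding x(3) by (intro subgroup.m_closed[OF sg] subgroup.m_inv_closed[OF sg] x(1) generate.incl[OF x(2)])
    have twJ: "t \<otimes> w \<in> generate G J" by (rule generate.eng[OF tJ w])
    have "card (N (t \<otimes> w)) < card (N w)"
      using t cox_length_card[OF J w] cox_length_card[OF J twJ] unfolding inversions_def by auto
    then show "t \<in> reflection ` N w" using reflection_card[OF b(1) generate_carrier[OF J w]] b by auto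
  qed
  show "reflection ` N w \<subseteq> inversions G J w"
  proof
    fix t assume "t \<in> reflection ` N w"
    then obtain \<beta> where b: "\<beta> \<in> N w" "t = reflection \<beta>" by auto
    have r: "t \<in> reflections G J" "t \<in> generate G J" using word_reflection_generate[OF J w b(1)] b by auto
    have twJ: "t \<otimes> w \<in> generate G J" by (rule generate.eng[OF r(2) w])
    have "card (N (t \<otimes> w)) < card (N w)"
      using reflection_card[OF N_posD[OF b(1)] generate_carrier[OF J w]] b by simp
    then show "t \<in> inversions G J w"
      unfolding inversions_def using r cox_length_card[OF J w] cox_length_card[OF J twJ] by auto
  qed
qed

lemma reflection_image_subset: "X \<subseteq> pos_roots \<Longrightarrow> Y \<subseteq> pos_roots \<Longrightarrow> reflection ` X \<subseteq> reflection ` Y \<longleftrightarrow> X \<subseteq> Y"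
  using reflection_inj unfolding inj_on_def by blast

lemma weak_order_le:
  assumes "J \<subseteq> S" "v \<in> generate G J" "w \<in> generate G J"
  shows "v \<sqsubseteq>\<^bsub>weak_order G J\<^esub> w \<longleftrightarrow> N v \<subseteq> N w"
  using assms reflection_image_subset[OF N_pos N_pos] by (simp add: weak_order_def inversions_N)

lemma parabolic_part_N:
  assumes J: "J \<subseteq> S" and K: "K \<subseteq> J" and w: "w \<in> generate G J"
  shows "parabolic_part G J K w \<in> generate G K \<and> N (parabolic_part G J K w) = par K (N w)"
proof -
  have KS: "K \<subseteq> S" using J K by auto
  have wc: "w \<in> carrier G" by (rule generate_carrier[OF J w])
  obtain u where u: "u \<in> generate G K" "N u = par K (N w)" using par_N[OF wc KS] by auto
  have char: "inversions G J v = inversions G J w \<inter> generate G K \<longleftrightarrow> N v = par K (N w)" if v: "v \<in> generate G K" for v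
  proof -
    have vJ: "v \<in> generate G J" using v mono_generate[OF K] by auto
    have "reflection ` N w \<inter> generate G K = reflection ` par K (N w)"
      unfolding par_def using reflection_generate[OF KS N_posD] by auto
    then have "inversions G J v = inversions G J w \<inter> generate G K \<longleftrightarrow> reflection ` N v = reflection ` par K (N w)"
      using inversions_N[OF J vJ] inversions_N[OF J w] by simp
    also have "\<dots> \<longleftrightarrow> N v = par K (N w)"
      by (rule inj_on_image_eq_iff[OF reflection_inj N_pos]) (use par_subset N_pos in blast)
    finally show ?thesis .
  qed
  have "parabolic_part G J K w = u" unfolding parabolic_part_def
  proof (rule the_equality)
    show "u \<in> generate G K \<and> inversions G J u = inversions G J w \<inter> generate G K" using char u by simp
    show "v = u" if "v \<in> generate G K \<and> inversions G J v = inversions G J w \<inter> generate G K" for v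
      using that char[of v] u generate_carrier[OF KS] N_inj[of v u] by auto
  qed
  then show ?thesis using u by simp
qed

section \<open>The recursion for the projection\<close>

text \<open>Earlier letters leave the coordinate of a new simple root at its own letter equal to 1,
  so its image is positive and the length grows: words without repetitions are reduced.\<close>

lemma N_distinct_word: "distinct cs \<Longrightarrow> cs \<in> lists S \<Longrightarrow> card (N (word_prod G cs)) = length cs"
proof (induction cs rule: rev_induct)
  case Nil
  then show ?case by (simp add: N_one)
next
  case (snoc s cs)
  have l: "distinct cs" "s \<notin> set cs" "cs \<in> lists S" "s \<in> S" using snoc by auto
  have e: "word_prod G (cs @ [s]) = word_prod G cs \<otimes> s" using l word_prod_append[of cs "[s]"] S_carrier by simp
  have "act cs (simple_root s) s = 1" using act_other[OF l(2), of "simple_root s"] by simp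
  then have "vpos (act cs (simple_root s))" using Phi_coord_pos[OF act_Phi[OF l(3,4)], of s] by simp
  then have "vpos (rep (word_prod G cs) (simple_root s))" using rep_word[OF l(3)] by simp
  from N_snoc[OF word_prod_closed[OF l(3)] l(4) this]
  show ?case using e snoc.IH[OF l(1,3)] N_finite[OF word_prod_closed[OF l(3)]] by simp
qed

text \<open>Compare coordinates at the first letter \<open>u\<close>: the later letters leave that
  coordinate zero, so \<open>coroot u (simple_root s) = 0\<close>. Then \<open>u\<close> fixes the
  simple root, and so does the rest of the word.\<close>

lemma act_fix_simple:
  assumes "distinct us" "s \<notin> set us" "us \<in> lists S" "s \<in> S" "act us (simple_root s) = simple_root s" "r \<in> set us"
  shows "A r s = 0"
  using assms
proof (induction us)
  case (Cons u us)
  have u: "u \<in> S" "us \<in> lists S" "u \<noteq> s" "u \<notin> set us" using Cons.prems by auto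
  have "refl u (act us (simple_root s)) = simple_root s" using Cons.prems by simp
  then have "refl u (refl u (act us (simple_root s))) = refl u (simple_root s)" by simp
  then have e: "act us (simple_root s) = refl u (simple_root s)" using u by simp
  have "act us (simple_root s) u = 0" using act_other[OF u(4), of "simple_root s"] u by simp
  then have "coroot u (simple_root s) = 0" using e u by (simp add: refl_same)
  then have z: "A u s = 0" using coroot_simple[OF Cons.prems(4)] by simp
  then have "act us (simple_root s) = simple_root s" using e coroot_simple[OF Cons.prems(4)] by (simp add: refl_def)
  then show ?case using Cons z by auto
qed simp

lemma initial_simple:
  assumes J: "J \<subseteq> S" and i: "initial G J c s"
  shows "s \<in> J" "simple_root s \<in> N c"
proof -
  obtain ws where ws: "reduced_word G J (s # ws) c" using i unfolding initial_def by auto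
  then have l: "s \<in> J" "ws \<in> lists J" "c = s \<otimes> word_prod G ws" "Suc (length ws) = cox_length G J c"
    by (auto simp: reduced_word_def)
  have lS: "s \<in> S" "ws \<in> lists S" using l J by auto
  have dc: "word_prod G ws \<in> carrier G" by (rule word_prod_closed[OF lS(2)])
  have cJ: "c \<in> generate G J" using ws unfolding reduced_word_def generate_words[OF J] by blast
  show "s \<in> J" by fact
  show "simple_root s \<in> N c"
  proof (rule ccontr)
    assume n: "simple_root s \<notin> N c"
    have "s \<otimes> c = word_prod G ws" using l S_cancel[OF lS(1) dc] by simp
    moreover have "N (s \<otimes> c) = insert (simple_root s) (refl s ` N c)"
      by (rule N_cons_below[OF generate_carrier[OF J cJ] lS(1) n])
    moreover have "simple_root s \<notin> refl s ` N c"
    proof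
      assume "simple_root s \<in> refl s ` N c"
      then obtain \<gamma> where "\<gamma> \<in> N c" "refl s \<gamma> = simple_root s" by auto
      then show False using refl_pos_ne[OF lS(1)] N_posD by blast
    qed
    moreover have "card (refl s ` N c) = card (N c)"
      by (rule card_image, rule inj_on_inverseI[of _ "refl s"]) (use lS in simp)
    ultimately have "card (N (word_prod G ws)) = Suc (card (N c))"
      using N_finite[OF generate_carrier[OF J cJ]] by simp
    then show False using N_word[OF lS(2)] cox_length_card[OF J cJ] l by simp
  qed
qed

text \<open>As an inversion, \<open>simple_root s\<close> is the image of the simple root of some
  letter \<open>cs ! k\<close> under the prefix before it; the coordinate at that letter gives
  \<open>cs ! k = s\<close>. The prefix then fixes \<open>simple_root s\<close>, so its letters are
  orthogonal to \<open>s\<close>, and \<open>s\<close> moves to the front without changing product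
  or Euler form.\<close>

lemma initial_front:
  assumes cs: "distinct cs" "cs \<in> lists S" and i: "initial G (set cs) (word_prod G cs) s"
  obtains us vs where "cs = us @ s # vs" "word_prod G cs = s \<otimes> word_prod G (us @ vs)"
    "\<And>p q. euler cs p q = euler (s # us @ vs) p q"
proof -
  have J: "set cs \<subseteq> S" using cs by auto
  have s: "s \<in> set cs" "simple_root s \<in> N (word_prod G cs)" using initial_simple[OF J i] by auto
  have sS: "s \<in> S" using s J by auto
  obtain k where k: "k < length cs" "simple_root s = act (take k cs) (simple_root (cs ! k))"
    using N_word_mem[OF cs(2) s(2)] by auto
  let ?us = "take k cs" and ?vs = "drop (Suc k) cs"
  have dec: "cs = ?us @ cs ! k # ?vs" by (rule id_take_nth_drop[OF k(1)])
  have d: "distinct (?us @ cs ! k # ?vs)" using cs(1) dec by simp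
  have "act ?us (simple_root (cs ! k)) (cs ! k) = 1" using act_other[of "cs ! k" ?us "simple_root (cs ! k)"] d by simp
  then have "simple_root s (cs ! k) = 1" using k(2) by simp
  then have x: "cs ! k = s" by (metis simple_root_apply(2) zero_neq_one)
  have l: "?us \<in> lists S" "?vs \<in> lists S" using cs(2) dec by (metis append_in_lists_conv Cons_in_lists_iff)+
  have fix1: "act ?us (simple_root s) = simple_root s" using k(2) x by simp
  have du: "distinct ?us" "s \<notin> set ?us" using d x by auto
  have zero: "A r s = 0 \<and> A s r = 0" if r: "r \<in> set ?us" for r
    using act_fix_simple[OF du l(1) sS fix1 r] A_sym[of r s] r l(1) sS by auto
  note c = word_prod_closed[OF l(1)] word_prod_closed[OF l(2)] S_carrier[OF sS]
  have "rep (word_prod G ?us) (simple_root s) = rep \<one> (simple_root s)" using fix1 rep_word[OF l(1)] by simp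
  then have "word_prod G ?us \<otimes> s \<otimes> inv (word_prod G ?us) = \<one> \<otimes> s \<otimes> inv \<one>"
    by (rule conj_unique[OF c(1) one_closed sS sS])
  then have "word_prod G ?us \<otimes> s \<otimes> inv (word_prod G ?us) \<otimes> word_prod G ?us = s \<otimes> word_prod G ?us" using c by simp
  then have comm: "word_prod G ?us \<otimes> s = s \<otimes> word_prod G ?us" using c by (simp add: m_assoc)
  have "word_prod G cs = word_prod G (?us @ s # ?vs)" using dec x by simp
  also have "\<dots> = word_prod G ?us \<otimes> s \<otimes> word_prod G ?vs"
    using word_prod_append[OF l(1), of "s # ?vs"] l sS c by (simp add: m_assoc)
  also have "\<dots> = s \<otimes> word_prod G (?us @ ?vs)"
    using comm c word_prod_append[OF l] by (simp add: m_assoc)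
  finally have w: "word_prod G cs = s \<otimes> word_prod G (?us @ ?vs)" .
  have e: "euler cs p q = euler (s # ?us @ ?vs) p q" for p q
    using euler_move[of ?us s ?vs p q] d x zero dec by simp
  show thesis by (rule that[OF _ w e]) (use dec x in simp)
qed

lemma N_Wp: "J \<subseteq> S \<Longrightarrow> w \<in> generate G J \<Longrightarrow> N w \<in> Wp J"
  unfolding Wp_def using N_supp generate_carrier by auto

lemma N_tog: "w \<in> carrier G \<Longrightarrow> s \<in> S \<Longrightarrow> N (s \<otimes> w) = tog s (N w)"
  unfolding tog_def using N_cons_above N_cons_below by simp

lemma N_simple: "s \<in> S \<Longrightarrow> N s = {simple_root s}"
  using N_cons_below[of \<one> s] S_carrier[of s] by (simp add: N_one)

lemma simple_le_iff:
  assumes "J \<subseteq> S" "s \<in> J" "w \<in> generate G J"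
  shows "s \<sqsubseteq>\<^bsub>weak_order G J\<^esub> w \<longleftrightarrow> simple_root s \<in> N w"
  using weak_order_le[OF assms(1) generate.incl[OF assms(2)] assms(3)] N_simple[of s] assms by auto

text \<open>A derivation chooses initial letters freely, whereas \<open>P\<close> follows a word.
  \<open>initial_front\<close> moves the chosen letter to the front, and \<open>P_cong_euler\<close>
  makes this invisible to \<open>P\<close>, so all derivations yield the same value.\<close>

lemma cox_proj_P:
  assumes "cox_proj G J c w x" "distinct cs" "set cs = J" "J \<subseteq> S" "word_prod G cs = c" "w \<in> generate G J"
  shows "x \<in> generate G J \<and> N x = P cs (N w)"
  using assms
proof (induction arbitrary: cs rule: cox_proj.induct)
  case (one J c)
  then show ?case by (simp add: N_one P_empty generate.one)
next
  case (above J c s w x)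
  note J = above.prems(3) and w = above.prems(5)
  have csS: "cs \<in> lists S" using above.prems by auto
  obtain us vs where uv: "cs = us @ s # vs" "word_prod G cs = s \<otimes> word_prod G (us @ vs)"
    "\<And>p q. euler cs p q = euler (s # us @ vs) p q"
    using initial_front[OF above.prems(1) csS, of s] above.hyps(1) above.prems by auto
  have sJ: "s \<in> J" "s \<in> S" using uv above.prems by auto
  have l: "us @ vs \<in> lists S" "us @ vs @ [s] \<in> lists S" using csS uv by auto
  note c = word_prod_closed[OF l(1)] S_carrier[OF sJ(2)]
  have wc: "w \<in> carrier G" by (rule generate_carrier[OF J w])
  have a: "simple_root s \<in> N w" using above.hyps(2) simple_le_iff[OF J sJ(1) w] by simp
  have "word_prod G (us @ vs @ [s]) = word_prod G (us @ vs) \<otimes> s"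
    using word_prod_append[OF l(1), of "[s]"] sJ c by simp
  also have "\<dots> = s \<otimes> word_prod G cs \<otimes> s" using uv(2) S_cancel[OF sJ(2) c(1)] by simp
  finally have rot: "word_prod G (us @ vs @ [s]) = s \<otimes> c \<otimes> s" using above.prems by simp
  have IH: "x \<in> generate G J \<and> N x = P (us @ vs @ [s]) (N (s \<otimes> w))"
    by (rule above.IH) (use above.prems uv rot generate_cons[OF J sJ(1) w] in auto)
  have xc: "x \<in> carrier G" using IH generate_carrier[OF J] by auto
  have "P cs (N w) = P (s # us @ vs) (N w)"
    by (rule P_cong_euler) (use above.prems uv N_Wp[OF J w] in auto)
  also have "\<dots> = tog s (P ((us @ vs) @ [s]) (tog s (N w)))"
    by (rule P_above) (use wc a in auto)
  also have "\<dots> = tog s (N x)" using IH N_tog[OF wc sJ(2)] by simp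
  also have "\<dots> = N (s \<otimes> x)" using N_tog[OF xc sJ(2)] by simp
  finally show ?case using generate_cons[OF J sJ(1)] IH by simp
next
  case (not_above J c s w x)
  note J = not_above.prems(3) and w = not_above.prems(5)
  have csS: "cs \<in> lists S" using not_above.prems by auto
  obtain us vs where uv: "cs = us @ s # vs" "word_prod G cs = s \<otimes> word_prod G (us @ vs)"
    "\<And>p q. euler cs p q = euler (s # us @ vs) p q"
    using initial_front[OF not_above.prems(1) csS, of s] not_above.hyps(1) not_above.prems by auto
  have sJ: "s \<in> J" "s \<in> S" using uv not_above.prems by auto
  have l: "us @ vs \<in> lists S" using csS uv by auto
  have a: "simple_root s \<notin> N w" using not_above.hyps(2) simple_le_iff[OF J sJ(1) w] by simp
  have sc: "word_prod G (us @ vs) = s \<otimes> c"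
    using uv(2) S_cancel[OF sJ(2) word_prod_closed[OF l]] not_above.prems by simp
  have K: "J - {s} \<subseteq> J" "J - {s} \<subseteq> S" "set (us @ vs) = J - {s}" using J uv not_above.prems by auto
  have pp: "parabolic_part G J (J - {s}) w \<in> generate G (J - {s})"
    "N (parabolic_part G J (J - {s}) w) = par (J - {s}) (N w)"
    using parabolic_part_N[OF J K(1) w] by auto
  have IH: "x \<in> generate G (J - {s}) \<and> N x = P (us @ vs) (N (parabolic_part G J (J - {s}) w))"
    by (rule not_above.IH) (use not_above.prems uv sc K pp in auto)
  have "P cs (N w) = P (s # us @ vs) (N w)"
    by (rule P_cong_euler) (use not_above.prems uv N_Wp[OF J w] in auto)
  also have "\<dots> = P (us @ vs) (par (set (us @ vs)) (N w))" by (rule P_below[OF a])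
  also have "\<dots> = N x" using IH pp K by simp
  finally show ?case using IH mono_generate[OF K(1)] by auto
qed

lemma initial_head:
  assumes "distinct (s # cs)" "s # cs \<in> lists S"
  shows "initial G (set (s # cs)) (word_prod G (s # cs)) s"
proof -
  have J: "set (s # cs) \<subseteq> S" using assms by auto
  have l: "s # cs \<in> lists (set (s # cs))" by auto
  have "word_prod G (s # cs) \<in> generate G (set (s # cs))" using generate_words[OF J] l by blast
  then have "cox_length G (set (s # cs)) (word_prod G (s # cs)) = length (s # cs)"
    using cox_length_card[OF J] N_distinct_word[OF assms] by simp
  then have "reduced_word G (set (s # cs)) (s # cs) (word_prod G (s # cs))"
    using l unfolding reduced_word_def by simp
  then show ?thesis unfolding initial_def by blast
qed

text \<open>Always choosing the head of the word gives a derivation, by lexicographic induction on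
  the length of the word and the number of inversions.\<close>

lemma cox_proj_ex:
  assumes "distinct cs" "set cs \<subseteq> S" "w \<in> generate G (set cs)"
  shows "\<exists>x. cox_proj G (set cs) (word_prod G cs) w x"
proof -
  have "\<forall>cs w. length cs = n \<longrightarrow> card (N w) = k \<longrightarrow> distinct cs \<longrightarrow> set cs \<subseteq> S \<longrightarrow> w \<in> generate G (set cs) \<longrightarrow>
      (\<exists>x. cox_proj G (set cs) (word_prod G cs) w x)" for n k
  proof (induction n arbitrary: k)
    case 0
    have "w = \<one>" if "w \<in> generate G {}" for w using that by (simp add: generate_empty)
    then show ?case by (auto intro: cox_proj.one)
  next
    case (Suc n)
    show ?case
    proof (induction k rule: less_induct)
      case (less k)
      show ?case
      proof (intro allI impI)
        fix cs w assume h: "length cs = Suc n" "card (N w) = k" "distinct cs" "set cs \<subseteq> S" "w \<in> generate G (set cs)"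
        obtain s ds where cs: "cs = s # ds" using h by (cases cs) auto
        have s: "s \<in> S" "s \<notin> set ds" "s \<in> set cs" and dsS: "ds \<in> lists S" "cs \<in> lists S" using h cs by auto
        have wc: "w \<in> carrier G" by (rule generate_carrier[OF h(4,5)])
        have dc: "word_prod G ds \<in> carrier G" by (rule word_prod_closed[OF dsS(1)])
        have init: "initial G (set cs) (word_prod G cs) s" using initial_head[of s ds] h cs dsS by simp
        have sc: "s \<otimes> word_prod G cs = word_prod G ds" using S_cancel[OF s(1) dc] cs by simp
        show "\<exists>x. cox_proj G (set cs) (word_prod G cs) w x"
        proof (cases "simple_root s \<in> N w")
          case True
          have "card (N (s \<otimes> w)) < k"
            using card_tog_less[OF N_finite[OF wc] True] N_tog[OF wc s(1)] h by simp
          moreover have "word_prod G (ds @ [s]) = s \<otimes> word_prod G cs \<otimes> s"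
            using word_prod_append[OF dsS(1), of "[s]"] s sc S_carrier by simp
          moreover have "s \<otimes> w \<in> generate G (set (ds @ [s]))"
            using generate_cons[OF h(4) s(3) h(5)] cs by simp
          moreover have "length (ds @ [s]) = Suc n" "distinct (ds @ [s])" "set (ds @ [s]) \<subseteq> S" "set (ds @ [s]) = set cs"
            using h cs by auto
          ultimately obtain x where "cox_proj G (set cs) (s \<otimes> word_prod G cs \<otimes> s) (s \<otimes> w) x"
            using less by metis
          then show ?thesis using cox_proj.above[OF init] simple_le_iff[OF h(4) s(3) h(5)] True by blast
        next
          case False
          have d: "set cs - {s} = set ds" using cs s by auto
          have "parabolic_part G (set cs) (set ds) w \<in> generate G (set ds)"
            using parabolic_part_N[OF h(4) _ h(5), of "set ds"] cs by auto
          moreover have "length ds = n" "distinct ds" "set ds \<subseteq> S" using h cs by auto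
          ultimately obtain x where "cox_proj G (set ds) (word_prod G ds) (parabolic_part G (set cs) (set ds) w) x"
            using Suc by blast
          then show ?thesis using cox_proj.not_above[OF init] simple_le_iff[OF h(4) s(3) h(5)] False sc d by metis
        qed
      qed
    qed
  qed
  then show ?thesis using assms by blast
qed

lemma pi_down_N:
  assumes cs: "distinct cs" "set cs = S" and w: "w \<in> carrier G"
  shows "pi_down G S (word_prod G cs) w \<in> carrier G" "N (pi_down G S (word_prod G cs) w) = P cs (N w)"
proof -
  have wS: "w \<in> generate G S" using w gens_generate by simp
  have P: "x \<in> carrier G \<and> N x = P cs (N w)" if "cox_proj G S (word_prod G cs) w x" for x
    using cox_proj_P[OF that cs subset_refl refl wS] gens_generate by simp
  obtain x where x: "cox_proj G S (word_prod G cs) w x" using cox_proj_ex[of cs w] cs wS by auto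
  have "pi_down G S (word_prod G cs) w = x" unfolding pi_down_def
    by (rule the_equality, rule x) (use P x N_inj in metis)
  then show "pi_down G S (word_prod G cs) w \<in> carrier G" "N (pi_down G S (word_prod G cs) w) = P cs (N w)"
    using P[OF x] by auto
qed

section \<open>The weak order\<close>

abbreviation L :: "'a gorder" where "L \<equiv> weak_order G S"

lemma carrier_L: "carrier L = carrier G"
  by (simp add: weak_order_def gens_generate)

lemma le_L: "v \<in> carrier G \<Longrightarrow> w \<in> carrier G \<Longrightarrow> v \<sqsubseteq>\<^bsub>L\<^esub> w \<longleftrightarrow> N v \<subseteq> N w"
  using weak_order_le[of S v w] gens_generate by simp

lemma Lower_L: "X \<subseteq> carrier G \<Longrightarrow> Lower L X = {l \<in> carrier G. \<forall>a\<in>X. N l \<subseteq> N a}"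
  using le_L by (auto simp: Lower_def carrier_L)

lemma Upper_L: "X \<subseteq> carrier G \<Longrightarrow> Upper L X = {u \<in> carrier G. \<forall>a\<in>X. N a \<subseteq> N u}"
  using le_L by (auto simp: Upper_def carrier_L)

lemma is_glb_iff:
  assumes "X \<subseteq> carrier G"
  shows "is_glb L x X \<longleftrightarrow> x \<in> carrier G \<and> is_meet (N x) (N ` X)"
proof -
  have "is_glb L x X \<longleftrightarrow> x \<in> carrier G \<and> (\<forall>a\<in>X. N x \<subseteq> N a)
      \<and> (\<forall>v\<in>carrier G. (\<forall>a\<in>X. N v \<subseteq> N a) \<longrightarrow> N v \<subseteq> N x)"
    unfolding greatest_def Lower_L[OF assms] carrier_L by (auto simp: le_L) blast
  also have "\<dots> \<longleftrightarrow> x \<in> carrier G \<and> is_meet (N x) (N ` X)"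
    unfolding is_meet_def by (simp, blast)
  finally show ?thesis .
qed

lemma is_lub_iff:
  assumes "X \<subseteq> carrier G"
  shows "is_lub L x X \<longleftrightarrow> x \<in> carrier G \<and> is_join (N x) (N ` X)"
proof -
  have "is_lub L x X \<longleftrightarrow> x \<in> carrier G \<and> (\<forall>a\<in>X. N a \<subseteq> N x)
      \<and> (\<forall>v\<in>carrier G. (\<forall>a\<in>X. N a \<subseteq> N v) \<longrightarrow> N x \<subseteq> N v)"
    unfolding least_def Upper_L[OF assms] carrier_L by (auto simp: le_L) blast
  also have "\<dots> \<longleftrightarrow> x \<in> carrier G \<and> is_join (N x) (N ` X)"
    unfolding is_join_def by (simp, blast)
  finally show ?thesis .
qed

lemma inf_L:
  assumes X: "X \<subseteq> carrier G" and g: "is_glb L g X"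
  shows "\<Sqinter>\<^bsub>L\<^esub> X = g"
  unfolding inf_def
proof (rule some_equality, rule g)
  fix x assume "is_glb L x X"
  then show "x = g" using g is_glb_iff[OF X] by (intro N_inj) (auto intro!: antisym simp: is_meet_def)
qed

lemma sup_L:
  assumes X: "X \<subseteq> carrier G" and g: "is_lub L g X"
  shows "\<Squnion>\<^bsub>L\<^esub> X = g"
  unfolding sup_def
proof (rule some_equality, rule g)
  fix x assume "is_lub L x X"
  then show "x = g" using g is_lub_iff[OF X] by (intro N_inj) (auto intro!: antisym simp: is_join_def)
qed

text \<open>The meet and join operators choose some extremum; the \<open>is_glb\<close> and
  \<open>is_lub\<close> clauses say that one exists, so the equations concern genuine meets and
  joins.\<close>

theorem pi_down_meet_join:
  assumes c: "coxeter_element G S c" and X: "X \<subseteq> carrier G"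
  shows "(X \<noteq> {} \<longrightarrow>
            is_glb L (\<Sqinter>\<^bsub>L\<^esub> X) X \<and>
            is_glb L (\<Sqinter>\<^bsub>L\<^esub> (pi_down G S c ` X)) (pi_down G S c ` X) \<and>
            \<Sqinter>\<^bsub>L\<^esub> (pi_down G S c ` X) = pi_down G S c (\<Sqinter>\<^bsub>L\<^esub> X))
       \<and> (Upper L X \<noteq> {} \<longrightarrow>
            is_lub L (\<Squnion>\<^bsub>L\<^esub> X) X \<and>
            is_lub L (\<Squnion>\<^bsub>L\<^esub> (pi_down G S c ` X)) (pi_down G S c ` X) \<and>
            \<Squnion>\<^bsub>L\<^esub> (pi_down G S c ` X) = pi_down G S c (\<Squnion>\<^bsub>L\<^esub> X))"
proof -
  obtain cs where cs: "distinct cs" "set cs = S" "c = word_prod G cs"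
    using c unfolding coxeter_element_def by auto
  let ?\<pi> = "pi_down G S c"
  have pi: "?\<pi> w \<in> carrier G" "N (?\<pi> w) = P cs (N w)" if "w \<in> carrier G" for w
    using pi_down_N[OF cs(1,2) that] cs(3) by auto
  have piX: "?\<pi> ` X \<subseteq> carrier G" using pi X by auto
  have NpiX: "N ` ?\<pi> ` X = P cs ` N ` X"
    unfolding image_image by (rule image_cong) (use pi X in auto)
  have NX: "N ` X \<subseteq> N ` carrier G" using X by auto
  show ?thesis
  proof (intro conjI impI)
    assume ne: "X \<noteq> {}"
    obtain M where M: "is_meet M (N ` X)" using meet_exists[OF NX] ne by auto
    then obtain g where g: "g \<in> carrier G" "M = N g" using is_meetD(1) by auto
    have glb: "is_glb L g X" using is_glb_iff[OF X] M g by simp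
    have "is_meet (P cs M) (P cs ` N ` X)" by (rule is_meet_P[OF cs(1,2) M NX]) (use ne in simp)
    then have glb': "is_glb L (?\<pi> g) (?\<pi> ` X)" using is_glb_iff[OF piX] pi[OF g(1)] NpiX g by simp
    show "is_glb L (\<Sqinter>\<^bsub>L\<^esub> X) X" "is_glb L (\<Sqinter>\<^bsub>L\<^esub> (?\<pi> ` X)) (?\<pi> ` X)"
      "\<Sqinter>\<^bsub>L\<^esub> (?\<pi> ` X) = ?\<pi> (\<Sqinter>\<^bsub>L\<^esub> X)"
      using glb glb' inf_L[OF X glb] inf_L[OF piX glb'] by simp_all
  next
    assume "Upper L X \<noteq> {}"
    then obtain u where u: "u \<in> carrier G" "\<And>a. a \<in> X \<Longrightarrow> N a \<subseteq> N u"
      unfolding Upper_L[OF X] by blast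
    obtain M where M: "is_join M (N ` X)" using join_exists[OF NX, of "N u"] u by auto
    then obtain g where g: "g \<in> carrier G" "M = N g" using is_joinD(1) by auto
    have lub: "is_lub L g X" using is_lub_iff[OF X] M g by simp
    have "is_join (P cs M) (P cs ` N ` X)" by (rule is_join_P[OF cs(1,2) M NX])
    then have lub': "is_lub L (?\<pi> g) (?\<pi> ` X)" using is_lub_iff[OF piX] pi[OF g(1)] NpiX g by simp
    show "is_lub L (\<Squnion>\<^bsub>L\<^esub> X) X" "is_lub L (\<Squnion>\<^bsub>L\<^esub> (?\<pi> ` X)) (?\<pi> ` X)"
      "\<Squnion>\<^bsub>L\<^esub> (?\<pi> ` X) = ?\<pi> (\<Squnion>\<^bsub>L\<^esub> X)"
      using lub lub' sup_L[OF X lub] sup_L[OF piX lub'] by simp_all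
  qed
qed

end

theorem theorem7p3:
  fixes G :: "('a, 'b) monoid_scheme" and S A :: "'a set" and c :: 'a
  defines "L \<equiv> weak_order G S"
  assumes "coxeter_system G S" and "finite S"
    and "coxeter_element G S c"
    and "A \<subseteq> carrier G"
  shows "(A \<noteq> {} \<longrightarrow>
            is_glb L (\<Sqinter>\<^bsub>L\<^esub> A) A \<and>
            is_glb L (\<Sqinter>\<^bsub>L\<^esub> (pi_down G S c ` A)) (pi_down G S c ` A) \<and>
            \<Sqinter>\<^bsub>L\<^esub> (pi_down G S c ` A) = pi_down G S c (\<Sqinter>\<^bsub>L\<^esub> A))
       \<and> (Upper L A \<noteq> {} \<longrightarrow>
            is_lub L (\<Squnion>\<^bsub>L\<^esub> A) A \<and>
            is_lub L (\<Squnion>\<^bsub>L\<^esub> (pi_down G S c ` A)) (pi_down G S c ` A) \<and>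
            \<Squnion>\<^bsub>L\<^esub> (pi_down G S c ` A) = pi_down G S c (\<Squnion>\<^bsub>L\<^esub> A))"
proof -
  interpret coxeter_system G S by fact
  obtain m where m: "coxeter_matrix S m"
    "\<forall>us\<in>lists S. \<forall>vs\<in>lists S. word_prod G us = word_prod G vs \<longleftrightarrow> equivclp (coxeter_step S m) us vs"
    using presentation by auto
  interpret coxeter_group G S m
    by unfold_locales (use m assms(3) in auto)
  show ?thesis unfolding L_def by (rule pi_down_meet_join[OF assms(4,5)])
qed

end
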